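(* Let $d$ be a positive integer, and let $Y_0, Y_1, Y_2, \ldots$ be a sequence of $\mathbb{R}^d$-valued random variables. Suppose that there exists a function $g \colon U \to \mathbb{C}$, where $U$ is an open neighborhood of $\{0\} \times \{z \in \mathbb{C} : |z| \leq 1\}$ in $\mathbb{R}^d \times \mathbb{C}$, such that (i) $g(x, z)$ is holomorphic as a function of $z$ for any fixed $x$; (ii) $g$ is twice differentiable; (iii) for all $(x, z) \in U$ with $|z| < 1$, we have $$\sum_{n = 0}^\infty \varphi_{Y_n}(x) z^n = \frac{1}{g(x, z)}.$$ For all $j, k$ with $1 \leq j, k \leq d$, define $$\mu_j = i\, g_{x_j}(0, 1)$$ and $$\Sigma_{j, k} = g_{x_j x_k}(0, 1) - i \left(\mu_j\, g_{x_k z}(0, 1) + \mu_k\, g_{x_j z}(0, 1)\right) + \mu_j \mu_k,$$ and let $\mu = (\mu_1, \ldots, \mu_d)$ and $\Sigma = (\Sigma_{j,k})_{1 \leq j,k \leq d}$. Then $\lim_{n \to \infty} \mathbb{E}[Y_n]/n = \mu$ and $\lim_{n \to \infty} \operatorname{Var}[Y_n]/n = \Sigma$. Moreover, $Z_n = (Y_n - \mu n)/\sqrt{n}$ converges in distribution, as $n \to \infty$, to $Z \sim \mathcal{N}(0, \Sigma)$.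
   Context: For $x, y \in \mathbb{R}^d$, $\langle x, y \rangle = x_1 y_1 + \cdots + x_d y_d$. For an $\mathbb{R}^d$-valued random variable $Y$, $\varphi_Y \colon \mathbb{R}^d \to \mathbb{C}$ is its characteristic function, $\varphi_Y(\omega) = \mathbb{E}[\exp(i \langle Y, \omega \rangle)]$, and $\operatorname{Var}[Y]$ denotes its covariance matrix. Subscripts denote partial derivatives: for example, $g_{x_1 z}(x, z) = \frac{\partial}{\partial x_1}\frac{\partial}{\partial z} g(x, z)$. For a real, symmetric, positive semidefinite matrix $\Sigma \in \mathbb{R}^{d \times d}$ (possibly singular), $\mathcal{N}(0, \Sigma)$ denotes the multivariate normal distribution with mean $0$ and covariance matrix $\Sigma$.
   Formalization: In (ii), "twice differentiable" is replaced by "twice continuously differentiable" (jointly in (x,z) on U, in the real sense); if the second derivative merely exists at every point, the claim on the limit of Var[Y_n]/n can fail. *)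

theory Defs
  imports "HOL-Probability.Probability" "HOL-Complex_Analysis.Complex_Analysis"
begin

(* Random vectors Y live on a probability space M. *)

definition char_fun :: "'a measure \<Rightarrow> ('a \<Rightarrow> real ^ 'd) \<Rightarrow> real ^ 'd \<Rightarrow> complex" where
  "char_fun M Y \<omega> = (CLINT s|M. exp (\<i> * complex_of_real (Y s \<bullet> \<omega>)))"

definition mean_vec :: "'a measure \<Rightarrow> ('a \<Rightarrow> real ^ 'd) \<Rightarrow> real ^ 'd" where
  "mean_vec M Y = integral\<^sup>L M Y"

definition covariance_matrix :: "'a measure \<Rightarrow> ('a \<Rightarrow> real ^ 'd) \<Rightarrow> real ^ 'd ^ 'd" where
  "covariance_matrix M Y =
     (\<chi> j k. LINT s|M. (Y s $ j - mean_vec M Y $ j) * (Y s $ k - mean_vec M Y $ k))"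

definition positive_semidefinite :: "real ^ 'd ^ 'd \<Rightarrow> bool" where
  "positive_semidefinite S \<longleftrightarrow> transpose S = S \<and> (\<forall>v. 0 \<le> v \<bullet> (S *v v))"

definition std_normal_vec :: "(real ^ 'd) measure" where
  "std_normal_vec =
     distr (\<Pi>\<^sub>M i\<in>(UNIV :: 'd set). std_normal_distribution) borel (\<lambda>w. \<chi> i. w i)"

(* For S symmetric positive semidefinite, possibly singular, N(0, S) is the law of A X, where
   A is a square matrix with A A^T = S and X is standard normal. Such an A exists, and the law
   does not depend on which one is chosen. For other S the value is meaningless. *)
definition centered_normal :: "real ^ 'd ^ 'd \<Rightarrow> (real ^ 'd) measure" where
  "centered_normal S =
     distr std_normal_vec borel (\<lambda>x. (SOME A :: real ^ 'd ^ 'd. A ** transpose A = S) *v x)"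

(* Each X n may live on its own probability space M n; N is the limit law. *)
definition converges_in_distribution ::
    "(nat \<Rightarrow> 'a measure) \<Rightarrow> (nat \<Rightarrow> 'a \<Rightarrow> real ^ 'd) \<Rightarrow> (real ^ 'd) measure \<Rightarrow> bool" where
  "converges_in_distribution M X N \<longleftrightarrow>
     (\<forall>f :: real ^ 'd \<Rightarrow> real. continuous_on UNIV f \<and> bounded (range f) \<longrightarrow>
        (\<lambda>n. LINT s|M n. f (X n s)) \<longlonglongrightarrow> (LINT y|N. f y))"

(* Frechet sense, over the reals: for g on (a subset of) R^d x C the derivative in the complex
   variable is taken here with C regarded as a real plane. The second derivative is required to
   be continuous: if it merely exists at every point, the variance asymptotics of the theorem
   can fail. *)
definition twice_continuously_differentiable_on ::
    "('a::real_normed_vector \<Rightarrow> 'b::real_normed_vector) \<Rightarrow> 'a set \<Rightarrow> bool" where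
  "twice_continuously_differentiable_on g U \<longleftrightarrow>
     (\<exists>(g' :: 'a \<Rightarrow> 'a \<Rightarrow>\<^sub>L 'b) (g'' :: 'a \<Rightarrow> 'a \<Rightarrow>\<^sub>L 'a \<Rightarrow>\<^sub>L 'b).
        (\<forall>p\<in>U. (g has_derivative blinfun_apply (g' p)) (at p)) \<and>
        (\<forall>p\<in>U. (g' has_derivative blinfun_apply (g'' p)) (at p)) \<and>
        continuous_on U g'')"

(* d_x j f is the real partial derivative of f in x_j, and d_z f the complex derivative of f
   in z. The mixed derivative g_{x_j z} is d_x j (d_z g), and g_{x_j x_k} is d_x j (d_x k g). *)
definition d_x :: "'d \<Rightarrow> ((real ^ 'd) \<times> complex \<Rightarrow> complex) \<Rightarrow> (real ^ 'd) \<times> complex \<Rightarrow> complex" where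
  "d_x j f = (\<lambda>(x, z). vector_derivative (\<lambda>t. f (x + t *\<^sub>R axis j 1, z)) (at 0))"

definition d_z :: "((real ^ 'd) \<times> complex \<Rightarrow> complex) \<Rightarrow> (real ^ 'd) \<times> complex \<Rightarrow> complex" where
  "d_z f = (\<lambda>(x, z). deriv (\<lambda>w. f (x, w)) z)"

end

theory Submission
  imports Defs "HOL-Real_Asymp.Real_Asymp"
begin

text \<open>
  Along a line \<open>x = s v\<close> only the real random variables \<open>Y n \<bullet> v\<close> matter, and
  \<open>G s z = g (s v, z)\<close> expands, uniformly for \<open>z\<close> in a disc of
  radius larger than 1, as \<open>1 - z + s a(z) + s\<^sup>2 b(z) / 2 + o(s\<^sup>2)\<close>. Inserting this in \<open>1 / G\<close>
  and extracting the coefficient of \<open>z ^ n\<close> gives a second-order expansion in \<open>s\<close> of the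
  \<open>n\<close>-th characteristic function, hence the first two moments: \<open>E = \<i> [z\<^sup>n] a / (1 - z)\<^sup>2\<close> and
  \<open>E\<^sub>2 = [z\<^sup>n] (b / (1 - z)\<^sup>2 - 2 a\<^sup>2 / (1 - z)\<^sup>3)\<close>, whose growth is read off from the poles at 1.

  For the limit law, \<open>G s\<close> has for small \<open>s\<close> a single zero \<open>\<zeta>\<close> near 1, so the \<open>n\<close>-th
  characteristic function at \<open>s\<close> is \<open>\<zeta> ^ -(n + 1) (1 + O(s))\<close> uniformly in \<open>n\<close>. With
  \<open>s = 1 / sqrt n\<close> the second-order expansion of \<open>\<zeta>\<close> yields the Gaussian characteristic function.
  Pointwise convergence of the multivariate characteristic functions gives convergence in
  distribution because the second moments of \<open>Z n\<close> are bounded, which provides tightness.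
\<close>

subsection \<open>Coefficients of meromorphic functions\<close>

text \<open>Nothing is assumed about moments: square integrability has to come out of the behaviour
  of the characteristic functions at 0. The differentiability of \<open>g\<close> is real, so the
  holomorphy of \<open>a\<close> and \<open>b\<close> is not given either; they inherit it from
  difference quotients in \<open>s\<close> that are holomorphic in \<open>z\<close> and converge
  uniformly. The leading term \<open>1 - z\<close> is forced by the value 1 of every characteristic
  function at 0. Two kinds of uniformity are at work. For moments \<open>n\<close> is fixed while
  \<open>s\<close> tends to 0, so coefficients are taken on the circle of radius 1/2, away from the
  pole, at the cost of a factor \<open>2 ^ n\<close>. For the limit law \<open>n\<close> and
  \<open>s\<close> move together, and the expansion is needed beyond the unit disc, where the zero
  may lie. The terms quadratic in \<open>n\<close> cancel in the variance. This dictates the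
  precision: the coefficients behind the mean must be known up to o(1), whereas O(1) is enough for
  the others. In the limit law the drift has to be divided out of each of the \<open>n\<close>
  factors before the power is taken, since the linear term alone contributes an exponent of order
  \<open>sqrt n\<close>.\<close>

lemma sums_partial_sums_power:
  fixes c :: "nat \<Rightarrow> complex"
  assumes c: "\<And>z. norm z < 1 \<Longrightarrow> (\<lambda>n. c n * z ^ n) sums f z" and z: "norm z < 1"
  shows "(\<lambda>n. (\<Sum>k\<le>n. c k) * z ^ n) sums (f z / (1 - z))"
proof -
  \<comment> \<open>A point strictly between \<open>norm z\<close> and 1: convergence there makes
    the series converge absolutely at \<open>z\<close>, as the Cauchy product requires.\<close>
  define x :: complex where "x = of_real ((1 + norm z) / 2)"
  have nx: "norm x = (1 + norm z) / 2"
    unfolding x_def norm_of_real by simp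
  have x: "norm x < 1" "norm z < norm x"
    using z by (auto simp: nx)
  have s1: "summable (\<lambda>n. norm (c n * z ^ n))"
    using powser_insidea[OF sums_summable[OF c[OF x(1)]] x(2)] .
  have s2: "summable (\<lambda>n. norm (z ^ n))"
    using z by (simp add: norm_power)
  have "(\<lambda>k. \<Sum>i\<le>k. c i * z ^ i * z ^ (k - i)) sums ((\<Sum>k. c k * z ^ k) * (\<Sum>k. z ^ k))"
    by (rule Cauchy_product_sums[OF s1 s2])
  moreover have "(\<Sum>k. c k * z ^ k) = f z"
    using c[OF z] by (simp add: sums_iff)
  moreover have "(\<Sum>k. z ^ k) = 1 / (1 - z)"
    using z by (simp add: suminf_geometric)
  moreover have "(\<Sum>i\<le>k. c i * z ^ i * z ^ (k - i)) = (\<Sum>i\<le>k. c i) * z ^ k" for k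
    by (simp add: sum_distrib_right mult.assoc flip: power_add)
  ultimately show ?thesis by simp
qed

text \<open>Each further factor \<open>1 / (1 - z)\<close> replaces the coefficients by their
  partial sums.\<close>

lemma sums_inverse_power:
  fixes z :: complex
  assumes "norm z < 1"
  shows "(\<lambda>n. z ^ n) sums (1 / (1 - z))"
    and "(\<lambda>n. of_nat (n + 1) * z ^ n) sums (1 / (1 - z) ^ 2)"
    and "(\<lambda>n. of_nat ((n + 1) * (n + 2)) / 2 * z ^ n) sums (1 / (1 - z) ^ 3)"
proof -
  have 1: "(\<lambda>n. 1 * z ^ n) sums (1 / (1 - z))" if "norm z < 1" for z :: complex
    using geometric_sums[OF that] by simp
  then show "(\<lambda>n. z ^ n) sums (1 / (1 - z))" using assms by simp
  have "(\<lambda>n. (\<Sum>k\<le>n. 1) * z ^ n) sums (1 / (1 - z) / (1 - z))" if "norm z < 1" for z :: complex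
    by (rule sums_partial_sums_power[OF 1 that])
  then have 2: "(\<lambda>n. of_nat (n + 1) * z ^ n) sums (1 / (1 - z) ^ 2)" if "norm z < 1" for z :: complex
    using that by (simp add: power2_eq_square add.commute)
  then show "(\<lambda>n. of_nat (n + 1) * z ^ n) sums (1 / (1 - z) ^ 2)" using assms .
  have "(\<lambda>n. (\<Sum>k\<le>n. of_nat (k + 1)) * z ^ n) sums (1 / (1 - z) ^ 2 / (1 - z))"
    by (rule sums_partial_sums_power[OF 2 assms])
  moreover have "(\<Sum>k\<le>n. of_nat (k + 1)) = (of_nat ((n + 1) * (n + 2)) / 2 :: complex)" for n
    by (induction n) (auto simp: field_simps)
  ultimately show "(\<lambda>n. of_nat ((n + 1) * (n + 2)) / 2 * z ^ n) sums (1 / (1 - z) ^ 3)"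
    by (simp only: divide_divide_eq_left power_Suc2[symmetric] Suc_1 numeral_2_eq_2 numeral_3_eq_3)
qed

text \<open>Coefficients depend on the function alone. They can therefore be estimated through
  \<open>f\<close>, and two series of the same function may be compared term by term.\<close>

lemma power_series_coeff_eq:
  fixes c :: "nat \<Rightarrow> complex"
  assumes "r > 0" and c: "\<And>z. norm z < r \<Longrightarrow> (\<lambda>n. c n * z ^ n) sums f z"
  shows "f holomorphic_on ball 0 r" and "c n = (deriv ^^ n) f 0 / fact n"
proof -
  show "f holomorphic_on ball 0 r"
    using c by (intro power_series_holomorphic[where a = c]) (auto simp: dist_norm)
  have "ereal (r / 2) \<le> conv_radius c"
    using conv_radius_geI[OF sums_summable[OF c], of "of_real (r / 2)"] \<open>r > 0\<close> by simp
  moreover have "ereal 0 < ereal (r / 2)" using \<open>r > 0\<close> by simp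
  ultimately have "0 < conv_radius c"
    unfolding zero_ereal_def by (rule less_le_trans[rotated])
  then have "fps_conv_radius (Abs_fps c) > 0"
    by (simp add: fps_conv_radius_def)
  moreover have "eventually (\<lambda>z. eval_fps (Abs_fps c) z = f z) (nhds 0)"
    using eventually_nhds_in_open[OF open_ball, of 0 0 r] \<open>r > 0\<close>
    by (auto elim!: eventually_mono simp: eval_fps_def dest!: c[THEN sums_unique, symmetric])
  ultimately have "f has_fps_expansion Abs_fps c"
    by (simp add: has_fps_expansion_def)
  from fps_nth_fps_expansion[OF this, of n] show "c n = (deriv ^^ n) f 0 / fact n"
    by simp
qed

lemma norm_coeff_le:
  fixes c :: "nat \<Rightarrow> complex"
  assumes c: "\<And>z. norm z < r \<Longrightarrow> (\<lambda>n. c n * z ^ n) sums f z"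
    and r: "0 < \<rho>" "\<rho> < r" and B: "\<And>z. norm z = \<rho> \<Longrightarrow> norm (f z) \<le> B"
  shows "norm (c n) \<le> B / \<rho> ^ n"
proof -
  have hol: "f holomorphic_on ball 0 r" and cn: "c n = (deriv ^^ n) f 0 / fact n"
    using power_series_coeff_eq[OF _ c] r by auto
  have "norm ((deriv ^^ n) f 0) \<le> fact n * B / \<rho> ^ n"
  proof (rule Cauchy_inequality)
    show "f holomorphic_on ball 0 \<rho>" "continuous_on (cball 0 \<rho>) f"
      using r by (auto intro!: holomorphic_on_subset[OF hol] holomorphic_on_imp_continuous_on)
  qed (use r B in auto)
  then show ?thesis
    by (simp add: cn norm_divide field_simps)
qed

text \<open>\<open>h\<close> is the difference quotient with its removable singularity filled in.
  The identity holds for every \<open>z\<close>, inside \<open>S\<close> or not, because off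
  \<open>w\<close> it is the definition of \<open>h\<close>.\<close>

lemma holomorphic_taylor_remainder:
  assumes f: "f holomorphic_on S" and S: "open S" "w \<in> S"
  obtains h where "h holomorphic_on S" "h w = deriv f w" "\<And>z. f z = f w + (z - w) * h z"
proof
  define h where "h = (\<lambda>z. if z = w then deriv f w else (f z - f w) / (z - w))"
  show "h holomorphic_on S"
    unfolding h_def by (rule pole_lemma[OF f]) (use S in \<open>auto simp: interior_open\<close>)
  show "h w = deriv f w" "\<And>z. f z = f w + (z - w) * h z"
    by (auto simp: h_def)
qed

text \<open>Convergence at the boundary point 1, available because \<open>R > 1\<close>, later makes
  these coefficients tend to 0 and their partial sums converge.\<close>

lemma holomorphic_coeffs:
  fixes f :: "complex \<Rightarrow> complex"
  assumes "f holomorphic_on ball 0 R" "R > 1"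
  obtains c where "\<And>z. norm z < 1 \<Longrightarrow> (\<lambda>n. c n * z ^ n) sums f z" "c sums f 1"
proof
  have "(\<lambda>n. (deriv ^^ n) f 0 / fact n * z ^ n) sums f z" if "norm z < R" for z
    using holomorphic_power_series[OF assms(1), of z] that by simp
  from this this[of 1] assms(2) show
    "\<And>z. norm z < 1 \<Longrightarrow> (\<lambda>n. (deriv ^^ n) f 0 / fact n * z ^ n) sums f z"
    "(\<lambda>n. (deriv ^^ n) f 0 / fact n) sums f 1"
    by auto
qed

text \<open>Subtracting the principal part at 1 leaves a function holomorphic beyond the unit
  circle, whose coefficients tend to 0. The constant \<open>- deriv f 1\<close> has to be exact: the
  mean is squared in the variance, so an error here is multiplied by \<open>n\<close>.\<close>

lemma coeffs_double_pole:
  assumes f: "f holomorphic_on ball 0 R" and R: "R > 1"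
  obtains c where "\<And>z. norm z < 1 \<Longrightarrow> (\<lambda>n. c n * z ^ n) sums (f z / (1 - z) ^ 2)"
    "(\<lambda>n. c n - of_nat (n + 1) * f 1) \<longlonglongrightarrow> - deriv f 1"
proof -
  have 1: "1 \<in> ball (0::complex) R" using R by simp
  obtain h1 where h1: "h1 holomorphic_on ball 0 R" "h1 1 = deriv f 1"
    "\<And>z. f z = f 1 + (z - 1) * h1 z"
    using holomorphic_taylor_remainder[OF f open_ball 1] by blast
  obtain h2 where h2: "h2 holomorphic_on ball 0 R" "\<And>z. h1 z = h1 1 + (z - 1) * h2 z"
    using holomorphic_taylor_remainder[OF h1(1) open_ball 1] by metis
  obtain d where d: "\<And>z. norm z < 1 \<Longrightarrow> (\<lambda>n. d n * z ^ n) sums h2 z" "d sums h2 1"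
    using holomorphic_coeffs[OF h2(1) R] by blast
  define c where "c = (\<lambda>n. of_nat (n + 1) * f 1 - deriv f 1 + d n)"
  show thesis
  proof
    fix z :: complex assume z: "norm z < 1"
    then have nz: "1 - z \<noteq> 0" by auto
    have fz: "f z = f 1 - (1 - z) * deriv f 1 + (1 - z)\<^sup>2 * h2 z"
      by (subst h1(3), subst h2(2)) (simp add: h1(2) algebra_simps power2_eq_square)
    have "(\<lambda>n. f 1 * (of_nat (n + 1) * z ^ n) - deriv f 1 * z ^ n + d n * z ^ n) sums
        (f 1 * (1 / (1 - z) ^ 2) - deriv f 1 * (1 / (1 - z)) + h2 z)"
      by (intro sums_add sums_diff sums_mult sums_inverse_power d z)
    also have "f 1 * (1 / (1 - z) ^ 2) - deriv f 1 * (1 / (1 - z)) + h2 z = f z / (1 - z) ^ 2"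
      using nz by (simp add: fz diff_divide_distrib add_divide_distrib power2_eq_square)
    finally show "(\<lambda>n. c n * z ^ n) sums (f z / (1 - z) ^ 2)"
      by (simp add: c_def algebra_simps)
  next
    have "d \<longlonglongrightarrow> 0" using d(2) by (simp add: sums_iff summable_LIMSEQ_zero)
    then have "(\<lambda>n. - deriv f 1 + d n) \<longlonglongrightarrow> - deriv f 1 + 0"
      by (intro tendsto_intros)
    then show "(\<lambda>n. c n - of_nat (n + 1) * f 1) \<longlonglongrightarrow> - deriv f 1"
      by (simp add: c_def)
  qed
qed

text \<open>Two Taylor steps at 1 leave a simple pole. Its coefficients are partial sums of a
  convergent series, hence bounded, and a bounded error disappears after division by
  \<open>n\<close>.\<close>

lemma coeffs_triple_pole:
  assumes f: "f holomorphic_on ball 0 R" and R: "R > 1"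
  obtains c where "\<And>z. norm z < 1 \<Longrightarrow> (\<lambda>n. c n * z ^ n) sums (f z / (1 - z) ^ 3)"
    "Bseq (\<lambda>n. c n - (of_nat ((n + 1) * (n + 2)) / 2 * f 1 - of_nat (n + 1) * deriv f 1))"
proof -
  have 1: "1 \<in> ball (0::complex) R" using R by simp
  obtain h1 where h1: "h1 holomorphic_on ball 0 R" "h1 1 = deriv f 1"
    "\<And>z. f z = f 1 + (z - 1) * h1 z"
    using holomorphic_taylor_remainder[OF f open_ball 1] by blast
  obtain h2 where h2: "h2 holomorphic_on ball 0 R" "\<And>z. h1 z = h1 1 + (z - 1) * h2 z"
    using holomorphic_taylor_remainder[OF h1(1) open_ball 1] by metis
  obtain d where d: "\<And>z. norm z < 1 \<Longrightarrow> (\<lambda>n. d n * z ^ n) sums h2 z" "d sums h2 1"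
    using holomorphic_coeffs[OF h2(1) R] by blast
  define e where "e = (\<lambda>n. \<Sum>k\<le>n. d k)"
  define c where "c = (\<lambda>n. of_nat ((n + 1) * (n + 2)) / 2 * f 1 - of_nat (n + 1) * deriv f 1 + e n)"
  show thesis
  proof
    fix z :: complex assume z: "norm z < 1"
    then have nz: "1 - z \<noteq> 0" by auto
    have fz: "f z = f 1 - (1 - z) * deriv f 1 + (1 - z)\<^sup>2 * h2 z"
      by (subst h1(3), subst h2(2)) (simp add: h1(2) algebra_simps power2_eq_square)
    have "(\<lambda>n. e n * z ^ n) sums (h2 z / (1 - z))"
      unfolding e_def by (rule sums_partial_sums_power[OF d(1) z])
    then have "(\<lambda>n. f 1 * (of_nat ((n + 1) * (n + 2)) / 2 * z ^ n) - deriv f 1 * (of_nat (n + 1) * z ^ n) + e n * z ^ n) sums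
        (f 1 * (1 / (1 - z) ^ 3) - deriv f 1 * (1 / (1 - z) ^ 2) + h2 z / (1 - z))"
      by (intro sums_add sums_diff sums_mult sums_inverse_power z)
    also have "f 1 * (1 / (1 - z) ^ 3) - deriv f 1 * (1 / (1 - z) ^ 2) + h2 z / (1 - z) = f z / (1 - z) ^ 3"
      using nz by (simp add: fz diff_divide_distrib add_divide_distrib power2_eq_square power3_eq_cube)
    finally show "(\<lambda>n. c n * z ^ n) sums (f z / (1 - z) ^ 3)"
      by (simp add: c_def algebra_simps)
  next
    have "convergent e"
      using d(2) unfolding e_def sums_def_le convergent_def by blast
    then show "Bseq (\<lambda>n. c n - (of_nat ((n + 1) * (n + 2)) / 2 * f 1 - of_nat (n + 1) * deriv f 1))"
      by (simp add: c_def convergent_imp_Bseq)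
  qed
qed

text \<open>The zero is split off with a quotient \<open>q\<close> that is uniformly close to 1, so
  that \<open>1 / f\<close> is a simple pole times a nearly constant function.\<close>

lemma simple_zero_factor:
  fixes f :: "complex \<Rightarrow> complex"
  assumes f: "f holomorphic_on ball 0 R" and \<rho>: "1 < \<rho>" "\<rho> < R"
    and near: "\<And>z. norm z \<le> \<rho> \<Longrightarrow> norm (f z - (1 - z)) \<le> \<epsilon>"
    and \<epsilon>: "0 \<le> \<epsilon>" "\<epsilon> \<le> (\<rho> - 1) / 8"
  obtains \<zeta> q where "norm (\<zeta> - 1) \<le> \<epsilon>" "f \<zeta> = 0" "q holomorphic_on ball 0 R"
    "\<And>z. f z = (\<zeta> - z) * q z" "\<And>z. norm z \<le> \<rho> \<Longrightarrow> norm (q z - 1) \<le> 3 * \<epsilon> / (\<rho> - 1)"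
proof -
  have cont: "continuous_on (cball 0 \<rho>) f"
    using \<rho> by (intro holomorphic_on_imp_continuous_on holomorphic_on_subset[OF f]) auto
  have sub: "cball 1 \<epsilon> \<subseteq> cball (0::complex) \<rho>"
  proof
    fix z :: complex assume "z \<in> cball 1 \<epsilon>"
    then have "norm (z - 1) \<le> \<epsilon>" by (simp add: dist_norm norm_minus_commute)
    moreover have "norm z \<le> norm (1::complex) + norm (z - 1)"
      by (metis add.commute diff_add_cancel norm_triangle_ineq)
    ultimately show "z \<in> cball 0 \<rho>" using \<epsilon> \<rho> by auto
  qed
  \<comment> \<open>A zero of \<open>f\<close> is a fixed point of \<open>f z + z\<close>, and
    \<open>near\<close> says precisely that this map sends the disc of radius
    \<open>\<epsilon>\<close> around 1 into itself.\<close>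
  obtain \<zeta> where "\<zeta> \<in> cball 1 \<epsilon>" "f \<zeta> + \<zeta> = \<zeta>"
  proof (rule brouwer[of "cball 1 \<epsilon>" "\<lambda>z. f z + z"])
    show "continuous_on (cball 1 \<epsilon>) (\<lambda>z. f z + z)"
      by (intro continuous_intros continuous_on_subset[OF cont] sub)
    show "(\<lambda>z. f z + z) \<in> cball 1 \<epsilon> \<rightarrow> cball 1 \<epsilon>"
    proof
      fix z :: complex assume "z \<in> cball 1 \<epsilon>"
      then have "norm (f z - (1 - z)) \<le> \<epsilon>" using sub by (intro near) auto
      then show "f z + z \<in> cball 1 \<epsilon>"
        by (simp add: dist_norm norm_minus_commute algebra_simps)
    qed
  qed (use \<epsilon> in auto)
  then have \<zeta>: "norm (\<zeta> - 1) \<le> \<epsilon>" "f \<zeta> = 0"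
    by (auto simp: dist_norm norm_minus_commute)
  have n\<zeta>: "norm \<zeta> \<le> 1 + \<epsilon>"
    using norm_triangle_ineq[of 1 "\<zeta> - 1"] \<zeta> by simp
  have "\<zeta> \<in> ball 0 R" using n\<zeta> \<epsilon> \<rho> by simp
  then obtain h where h: "h holomorphic_on ball 0 R" "\<And>z. f z = f \<zeta> + (z - \<zeta>) * h z"
    using holomorphic_taylor_remainder[OF f open_ball] by metis
  have fz: "f z = (\<zeta> - z) * - h z" for z
    by (subst h(2)) (simp add: \<zeta> algebra_simps)
  \<comment> \<open>By the maximum principle the circle of radius \<open>\<rho>\<close> suffices;
    there the divisor \<open>\<zeta> - w\<close> is bounded away from 0.\<close>
  have bound: "norm (- h z - 1) \<le> 3 * \<epsilon> / (\<rho> - 1)" if z: "norm z \<le> \<rho>" for z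
  proof (rule maximum_modulus_frontier[of "\<lambda>z. - h z - 1" "cball 0 \<rho>"])
    show "(\<lambda>z. - h z - 1) holomorphic_on interior (cball 0 \<rho>)"
      using \<rho> by (intro holomorphic_intros holomorphic_on_subset[OF h(1)]) auto
    show "continuous_on (closure (cball 0 \<rho>)) (\<lambda>z. - h z - 1)"
      using \<rho> by (intro continuous_intros holomorphic_on_imp_continuous_on holomorphic_on_subset[OF h(1)]) auto
    fix w :: complex assume "w \<in> frontier (cball 0 \<rho>)"
    then have w: "norm w = \<rho>" using \<rho> by (simp add: frontier_cball)
    have d: "\<rho> - 1 - \<epsilon> \<le> norm (\<zeta> - w)"
      using norm_triangle_ineq2[of w \<zeta>] n\<zeta> w by (simp add: norm_minus_commute)
    have "(\<zeta> - w) * (- h w - 1) = (f w - (1 - w)) - (\<zeta> - 1)"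
      by (subst fz) (simp add: algebra_simps)
    then have "norm (\<zeta> - w) * norm (- h w - 1) = norm ((f w - (1 - w)) - (\<zeta> - 1))"
      by (metis norm_mult)
    also have "\<dots> \<le> 2 * \<epsilon>"
      using norm_triangle_ineq4[of "f w - (1 - w)" "\<zeta> - 1"] near[of w] w \<zeta> by simp
    finally have le: "norm (\<zeta> - w) * norm (- h w - 1) \<le> 2 * \<epsilon>" .
    \<comment> \<open>\<open>\<epsilon>\<close> is at most an eighth of \<open>\<rho> - 1\<close>,
      which leaves seven eighths as a lower bound for the divisor; 16/7 is then rounded up to
      3.\<close>
    have "(7 / 8 * (\<rho> - 1)) * norm (- h w - 1) \<le> norm (\<zeta> - w) * norm (- h w - 1)"
      using d \<epsilon> \<rho> by (intro mult_right_mono) auto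
    with le have "(7 / 8 * (\<rho> - 1)) * norm (- h w - 1) \<le> 2 * \<epsilon>" by linarith
    then have "norm (- h w - 1) * (\<rho> - 1) \<le> 3 * \<epsilon>" using \<epsilon>(1) by (simp add: algebra_simps)
    then show "norm (- h w - 1) \<le> 3 * \<epsilon> / (\<rho> - 1)"
      using \<rho> by (simp add: pos_le_divide_eq)
  qed (use z in auto)
  have "(\<lambda>z. - h z) holomorphic_on ball 0 R"
    by (intro holomorphic_intros h)
  then show thesis
    by (rule that[OF \<zeta> _ fz bound])
qed

text \<open>The point is that the error is uniform in the index of the coefficient.\<close>

lemma coeff_near_simple_pole:
  fixes f :: "complex \<Rightarrow> complex"
  assumes f: "f holomorphic_on ball 0 R" and \<rho>: "1 < \<rho>" "\<rho> < R"
    and near: "\<And>z. norm z \<le> \<rho> \<Longrightarrow> norm (f z - (1 - z)) \<le> \<epsilon>"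
    and \<epsilon>: "0 \<le> \<epsilon>" "\<epsilon> \<le> (\<rho> - 1) / 8"
    and c: "\<And>z. norm z < 1 \<Longrightarrow> (\<lambda>n. c n * z ^ n) sums (1 / f z)"
    and nz: "\<And>z. norm z < 1 \<Longrightarrow> f z \<noteq> 0"
  obtains \<zeta> where "norm (\<zeta> - 1) \<le> \<epsilon>" "f \<zeta> = 0"
    "\<And>n. norm (c n * \<zeta> ^ (n + 1) - 1) \<le> 16 * \<rho> / (\<rho> - 1)\<^sup>2 * \<epsilon>"
proof -
  obtain \<zeta> q where \<zeta>: "norm (\<zeta> - 1) \<le> \<epsilon>" "f \<zeta> = 0" and q: "q holomorphic_on ball 0 R"
    "\<And>z. f z = (\<zeta> - z) * q z" "\<And>z. norm z \<le> \<rho> \<Longrightarrow> norm (q z - 1) \<le> 3 * \<epsilon> / (\<rho> - 1)"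
    using simple_zero_factor[OF f \<rho> near \<epsilon>] by blast
  define \<eta> where "\<eta> = 3 * \<epsilon> / (\<rho> - 1)"
  have \<eta>: "0 \<le> \<eta>" "\<eta> \<le> 1 / 2"
    using \<epsilon> \<rho> by (auto simp: \<eta>_def field_simps)
  have q2: "1 / 2 \<le> norm (q z)" if "norm z \<le> \<rho>" for z
    using q(3)[OF that] \<eta> norm_triangle_ineq2[of 1 "1 - q z"] by (simp add: \<eta>_def norm_minus_commute)
  have qnz: "q z \<noteq> 0" if "norm z \<le> \<rho>" for z
    using q2[OF that] by auto
  \<comment> \<open>\<open>1 / q = 1 + p\<close> with \<open>p\<close> of size
    \<open>2 * \<eta>\<close>: the 1 yields the main term of the coefficients, \<open>p\<close> the
    error.\<close>
  define p where "p = (\<lambda>z. 1 / q z - 1)"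
  have p: "norm (p z) \<le> 2 * \<eta>" if "norm z \<le> \<rho>" for z
  proof -
    have "norm (p z) * norm (q z) = norm (q z - 1)"
      using qnz[OF that] by (simp add: p_def norm_minus_commute diff_divide_distrib left_diff_distrib flip: norm_mult)
    then have "norm (p z) * (1 / 2) \<le> norm (q z - 1)"
      using mult_left_mono[OF q2[OF that] norm_ge_zero[of "p z"]] by simp
    then show ?thesis using q(3)[OF that] by (simp add: \<eta>_def)
  qed
  have "p holomorphic_on ball 0 \<rho>"
    unfolding p_def using \<rho> qnz
    by (intro holomorphic_intros holomorphic_on_subset[OF q(1)]) auto
  define d where "d = (\<lambda>n. (deriv ^^ n) p 0 / fact n)"
  have d: "(\<lambda>n. d n * z ^ n) sums p z" if "norm z < \<rho>" for z
    using holomorphic_power_series[OF \<open>p holomorphic_on ball 0 \<rho>\<close>, of z] that by (simp add: d_def)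
  have dn: "norm (d n) \<le> 2 * \<eta> / \<rho>' ^ n" if "0 < \<rho>'" "\<rho>' < \<rho>" for n \<rho>'
    by (rule norm_coeff_le[where r = \<rho> and f = p]) (use that d p in auto)
  \<comment> \<open>The midpoint of 1 and \<open>\<rho>\<close> separates
    \<open>norm \<zeta>\<close> from \<open>\<rho>\<close>. Cauchy estimates on radius
    \<open>r\<close> then make the sum of the errors \<open>d k * \<zeta> ^ k\<close>
    geometric.\<close>
  define r where "r = (\<rho> + 1) / 2"
  have r: "1 < r" "r < \<rho>" using \<rho> by (auto simp: r_def field_simps)
  have \<zeta>r: "norm \<zeta> < r" "norm \<zeta> \<le> 1 + \<epsilon>"
    using norm_triangle_ineq[of 1 "\<zeta> - 1"] \<zeta> \<epsilon> \<rho> by (auto simp: r_def)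
  \<comment> \<open>Comparison of coefficients in
    \<open>(\<zeta> - z) / f z = 1 / q z = 1 + p z\<close>; multiplication by \<open>z\<close>
    shifts the index, hence the special case \<open>n = 0\<close>.\<close>
  have cd: "c n * \<zeta> - (if n = 0 then 0 else c (n - 1)) = (if n = 0 then 1 else 0) + d n" for n
  proof -
    have "(\<lambda>n. (c n * \<zeta> - (if n = 0 then 0 else c (n - 1))) * z ^ n) sums (1 / q z)" if z: "norm z < 1" for z
    proof -
      have "(\<lambda>n. (if Suc n = 0 then 0 else c (Suc n - 1)) * z ^ Suc n) sums (z * (1 / f z))"
        using sums_mult[OF c[OF z], of z] by (simp add: mult_ac)
      then have "(\<lambda>n. (if n = 0 then 0 else c (n - 1)) * z ^ n) sums (z * (1 / f z))"
        by (subst (asm) sums_Suc_iff) simp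
      from sums_diff[OF sums_mult[OF c[OF z], of \<zeta>] this]
      have "(\<lambda>n. (c n * \<zeta> - (if n = 0 then 0 else c (n - 1))) * z ^ n) sums ((\<zeta> - z) * (1 / f z))"
        by (simp add: algebra_simps diff_divide_distrib cong: if_cong)
      moreover have "\<zeta> - z \<noteq> 0" "q z \<noteq> 0"
        using nz[OF z] q(2)[of z] by auto
      ultimately show ?thesis by (simp add: q(2))
    qed
    from power_series_coeff_eq(2)[OF zero_less_one this]
    have 1: "c n * \<zeta> - (if n = 0 then 0 else c (n - 1)) = (deriv ^^ n) (\<lambda>z. 1 / q z) 0 / fact n" .
    have "(\<lambda>n. ((if n = 0 then 1 else 0) + d n) * z ^ n) sums (1 / q z)" if z: "norm z < 1" for z
    proof -
      have "(\<lambda>n. (if n = 0 then 1 else 0) * z ^ n) sums 1"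
        using sums_single[of 0 "\<lambda>n. z ^ n"] by (simp add: if_distrib if_distribR cong: if_cong)
      moreover have "(\<lambda>n. d n * z ^ n) sums p z" using z \<rho> by (intro d) auto
      ultimately show ?thesis
        using sums_add by (fastforce simp: p_def distrib_right)
    qed
    from power_series_coeff_eq(2)[OF zero_less_one this]
    show ?thesis using 1 by simp
  qed
  \<comment> \<open>Multiplied by \<open>\<zeta> ^ n\<close>, the recurrence \<open>cd\<close>
    telescopes.\<close>
  have sum: "c n * \<zeta> ^ (n + 1) - 1 = (\<Sum>k\<le>n. d k * \<zeta> ^ k)" for n
  proof (induction n)
    case 0
    then show ?case using cd[of 0] by simp
  next
    case (Suc n)
    have "c (Suc n) * \<zeta> = c n + d (Suc n)" using cd[of "Suc n"] by (simp add: diff_eq_eq add.commute)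
    then have "(c (Suc n) * \<zeta>) * \<zeta> ^ Suc n = c n * \<zeta> ^ (n + 1) + d (Suc n) * \<zeta> ^ Suc n"
      by (simp add: distrib_right)
    then have "c (Suc n) * \<zeta> ^ (Suc n + 1) = c n * \<zeta> ^ (n + 1) + d (Suc n) * \<zeta> ^ Suc n"
      by (simp add: mult_ac)
    then show ?case using Suc by simp
  qed
  show thesis
  proof
    fix n
    have "norm (c n * \<zeta> ^ (n + 1) - 1) \<le> (\<Sum>k\<le>n. norm (d k * \<zeta> ^ k))"
      unfolding sum by (rule norm_sum)
    also have "\<dots> \<le> (\<Sum>k\<le>n. 2 * \<eta> * (norm \<zeta> / r) ^ k)"
    proof (rule sum_mono)
      fix k
      have "norm (d k * \<zeta> ^ k) = norm (d k) * norm \<zeta> ^ k"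
        by (simp add: norm_mult norm_power)
      also have "\<dots> \<le> 2 * \<eta> / r ^ k * norm \<zeta> ^ k"
        using r by (intro mult_right_mono dn) auto
      finally show "norm (d k * \<zeta> ^ k) \<le> 2 * \<eta> * (norm \<zeta> / r) ^ k"
        by (simp add: power_divide)
    qed
    also have "\<dots> = 2 * \<eta> * (\<Sum>k\<le>n. (norm \<zeta> / r) ^ k)"
      by (simp add: sum_distrib_left)
    also have "\<dots> \<le> 2 * \<eta> * (\<Sum>k. (norm \<zeta> / r) ^ k)"
      using \<eta> \<zeta>r r by (intro mult_left_mono sum_le_suminf summable_geometric) (auto simp: field_simps)
    also have "(\<Sum>k. (norm \<zeta> / r) ^ k) = 1 / (1 - norm \<zeta> / r)"
      using \<zeta>r r by (intro suminf_geometric) (auto simp: field_simps)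
    also have "\<dots> = r / (r - norm \<zeta>)"
      using \<zeta>r r by (simp add: field_simps)
    \<comment> \<open>\<open>r\<close> exceeds 1 by half of \<open>\<rho> - 1\<close>, and
      \<open>norm \<zeta>\<close> by at most an eighth of it; the difference is 3/8.\<close>
    also have "\<dots> \<le> r / (3 / 8 * (\<rho> - 1))"
    proof (rule divide_left_mono)
      show "3 / 8 * (\<rho> - 1) \<le> r - norm \<zeta>" using \<zeta>r \<epsilon> by (simp add: r_def field_simps)
      show "0 < (r - norm \<zeta>) * (3 / 8 * (\<rho> - 1))" using \<zeta>r \<rho> by simp
    qed (use r in simp)
    finally have "norm (c n * \<zeta> ^ (n + 1) - 1) \<le> 2 * \<eta> * (r / (3 / 8 * (\<rho> - 1)))"
      using \<eta> by (simp add: mult_left_mono)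
    also have "\<dots> = 16 * r / (\<rho> - 1)\<^sup>2 * \<epsilon>"
    proof -
      have "2 * (3 * \<epsilon> / k) * (r / (3 / 8 * k)) = 16 * r / k\<^sup>2 * \<epsilon>" if "k \<noteq> 0" for k
        using that by (simp add: power2_eq_square field_simps)
      from this[of "\<rho> - 1"] show ?thesis using \<rho> by (simp add: \<eta>_def)
    qed
    finally show "norm (c n * \<zeta> ^ (n + 1) - 1) \<le> 16 * \<rho> / (\<rho> - 1)\<^sup>2 * \<epsilon>"
      using r \<epsilon> by (smt (verit) divide_right_mono mult_right_mono zero_le_power2)
  qed (use \<zeta> in auto)
qed

subsection \<open>Weak convergence from characteristic functions\<close>

text \<open>Frequencies are arbitrary and coefficients complex, so convergence of characteristic
  functions passes to all expectations of members by linearity.\<close>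

inductive trigonometric_polynomial :: "('a::euclidean_space \<Rightarrow> complex) \<Rightarrow> bool" where
  exp: "trigonometric_polynomial (\<lambda>x. c * exp (\<i> * complex_of_real (x \<bullet> t)))"
| add: "trigonometric_polynomial p \<Longrightarrow> trigonometric_polynomial q \<Longrightarrow>
    trigonometric_polynomial (\<lambda>x. p x + q x)"

lemma trigonometric_polynomial_const: "trigonometric_polynomial (\<lambda>x. c)"
  using trigonometric_polynomial.exp[of c 0] by simp

lemma trigonometric_polynomial_mult:
  assumes "trigonometric_polynomial p" "trigonometric_polynomial q"
  shows "trigonometric_polynomial (\<lambda>x. p x * q x)"
  using assms
proof (induction rule: trigonometric_polynomial.induct)
  case (exp c t)
  from exp.prems show ?case
  proof (induction rule: trigonometric_polynomial.induct)
    case (exp d u)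
    have "trigonometric_polynomial (\<lambda>x. (c * d) * exp (\<i> * complex_of_real (x \<bullet> (t + u))))"
      by (rule trigonometric_polynomial.exp)
    then show ?case
      by (simp add: inner_add_right distrib_left exp_add mult_ac)
  next
    case (add p q)
    then show ?case using trigonometric_polynomial.add by (simp add: distrib_left)
  qed
next
  case (add p1 p2)
  then show ?case using trigonometric_polynomial.add by (simp add: distrib_right)
qed

lemma trigonometric_polynomial_sum:
  assumes "finite I" "\<And>i. i \<in> I \<Longrightarrow> trigonometric_polynomial (p i)"
  shows "trigonometric_polynomial (\<lambda>x. \<Sum>i\<in>I. p i x)"
  using assms
  by (induction I rule: finite_induct)
    (auto intro: trigonometric_polynomial_const trigonometric_polynomial.add)

lemma trigonometric_polynomial_measurable [measurable]:
  assumes "trigonometric_polynomial p"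
  shows "p \<in> borel_measurable borel"
  using assms by (induction rule: trigonometric_polynomial.induct) simp_all

text \<open>Coordinates are wrapped onto unit circles with period \<open>2 * pi * L\<close>.
  Polynomials on the torus become trigonometric polynomials in \<open>x\<close>, and on the box
  where all \<open>\<bar>x $ i\<bar> \<le> L\<close> the angles stay in [-1, 1], so that the map is
  injective there.\<close>

definition circle_map :: "real \<Rightarrow> real ^ 'd \<Rightarrow> complex ^ 'd" where
  "circle_map L x = (\<chi> i. exp (\<i> * complex_of_real (x $ i / L)))"

lemma trigonometric_polynomial_circle_map:
  fixes P :: "complex ^ 'd \<Rightarrow> real"
  assumes "real_polynomial_function P"
  shows "trigonometric_polynomial (\<lambda>x. complex_of_real (P (circle_map L x)))"
  using assms
proof (induction rule: real_polynomial_function.induct)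
  case (linear f)
  have coord: "trigonometric_polynomial (\<lambda>x. complex_of_real (Re (exp (\<i> * complex_of_real (x $ i / L)))))"
     "trigonometric_polynomial (\<lambda>x. complex_of_real (Im (exp (\<i> * complex_of_real (x $ i / L)))))"
    for i :: 'd
  proof -
    have 1: "x \<bullet> axis i (c / L) = c * (x $ i / L)" for x :: "real ^ 'd" and c
      by (simp add: inner_axis)
    have cos: "complex_of_real (cos y) = 1/2 * exp (\<i> * complex_of_real (1 * y)) + 1/2 * exp (\<i> * complex_of_real (-1 * y))"
      and sin: "complex_of_real (sin y) = (1/(2*\<i>)) * exp (\<i> * complex_of_real (1 * y)) + (-1/(2*\<i>)) * exp (\<i> * complex_of_real (-1 * y))" for y
      by (simp_all add: cos_of_real[symmetric] sin_of_real[symmetric] cos_exp_eq sin_exp_eq field_simps)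
    show "trigonometric_polynomial (\<lambda>x. complex_of_real (Re (exp (\<i> * complex_of_real (x $ i / L)))))"
      unfolding Re_exp Re_i_times Im_complex_of_real Im_i_times Re_complex_of_real minus_zero exp_zero mult_1 cos 1[symmetric]
      by (intro trigonometric_polynomial.intros)
    show "trigonometric_polynomial (\<lambda>x. complex_of_real (Im (exp (\<i> * complex_of_real (x $ i / L)))))"
      unfolding Im_exp Re_i_times Im_complex_of_real Im_i_times Re_complex_of_real minus_zero exp_zero mult_1 sin 1[symmetric]
      by (intro trigonometric_polynomial.intros)
  qed
  \<comment> \<open>The polynomials are real ones, so a linear form is only real-linear and needs
    the real basis made of \<open>axis i 1\<close> and \<open>axis i \<i>\<close>.\<close>
  have f_coord: "f u = (\<Sum>i\<in>UNIV. Re (u $ i) * f (axis i 1) + Im (u $ i) * f (axis i \<i>))" for u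
  proof -
    interpret f: bounded_linear f by fact
    have "u = (\<Sum>i\<in>UNIV. Re (u $ i) *\<^sub>R axis i 1 + Im (u $ i) *\<^sub>R axis i \<i>)"
      by (auto simp: vec_eq_iff axis_def complex_eq_iff if_distrib sum.distrib sum.delta cong: if_cong)
    then have "f u = f (\<Sum>i\<in>UNIV. Re (u $ i) *\<^sub>R axis i 1 + Im (u $ i) *\<^sub>R axis i \<i>)" by (rule arg_cong)
    also have "\<dots> = (\<Sum>i\<in>UNIV. Re (u $ i) * f (axis i 1) + Im (u $ i) * f (axis i \<i>))"
      by (simp only: f.sum f.add f.scaleR real_scaleR_def)
    finally show ?thesis .
  qed
  have "(\<lambda>x. complex_of_real (f (circle_map L x))) = (\<lambda>x. \<Sum>i\<in>UNIV.
      complex_of_real (Re (exp (\<i> * complex_of_real (x $ i / L)))) * complex_of_real (f (axis i 1)) +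
      complex_of_real (Im (exp (\<i> * complex_of_real (x $ i / L)))) * complex_of_real (f (axis i \<i>)))"
    by (rule ext, subst f_coord) (simp add: circle_map_def)
  moreover have "trigonometric_polynomial (\<lambda>x. \<Sum>i\<in>UNIV.
      complex_of_real (Re (exp (\<i> * complex_of_real (x $ i / L)))) * complex_of_real (f (axis i 1)) +
      complex_of_real (Im (exp (\<i> * complex_of_real (x $ i / L)))) * complex_of_real (f (axis i \<i>)))"
    using coord by (intro trigonometric_polynomial_sum[OF finite] trigonometric_polynomial.add
        trigonometric_polynomial_mult trigonometric_polynomial_const)
  ultimately show ?case by (simp only:)
next
  case (const c)
  then show ?case by (rule trigonometric_polynomial_const)
next
  case (add f g)
  then show ?case by (simp add: trigonometric_polynomial.add)
next
  case (mult f g)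
  then show ?case by (simp add: trigonometric_polynomial_mult)
qed

text \<open>On the box the approximation is uniform; outside of it, periodicity keeps the
  trigonometric polynomial bounded.\<close>

lemma trigonometric_approximation:
  fixes f :: "real ^ 'd \<Rightarrow> real"
  assumes f: "continuous_on UNIV f" "\<And>x. \<bar>f x\<bar> \<le> B" and L: "L > 0" and e: "e > 0"
  obtains P where "trigonometric_polynomial (\<lambda>x. complex_of_real (P x))"
    "\<And>x. (\<And>i. \<bar>x $ i\<bar> \<le> L) \<Longrightarrow> \<bar>f x - P x\<bar> \<le> e" "\<And>x. \<bar>P x\<bar> \<le> B + e"
proof -
  define K where "K = (cbox (\<chi> i. - L) (\<chi> i. L) :: (real ^ 'd) set)"
  have K: "x \<in> K \<longleftrightarrow> (\<forall>i. \<bar>x $ i\<bar> \<le> L)" for x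
    by (auto simp: K_def mem_box_cart abs_le_iff minus_le_iff)
  have comp: "compact K" by (simp add: K_def compact_cbox)
  have cont: "continuous_on S (circle_map L)" for S :: "(real ^ 'd) set"
    unfolding circle_map_def using L by (intro continuous_intros continuous_on_component) auto
  define C where "C = circle_map L ` K"
  have C: "compact C" unfolding C_def by (rule compact_continuous_image[OF cont comp])
  \<comment> \<open>The principal logarithm inverts the wrapping on the image of the box. All angles
    there have positive cosine, so the branch cut is avoided and \<open>inv\<close> is
    continuous.\<close>
  define inv where "inv = (\<lambda>u :: complex ^ 'd. (\<chi> i. L * Im (Ln (u $ i))) :: real ^ 'd)"
  have Ln: "Ln (circle_map L x $ i) = \<i> * complex_of_real (x $ i / L)" if "x \<in> K" for x i
  proof -
    have "- 1 \<le> x $ i / L" "x $ i / L \<le> 1" using that L by (auto simp: K field_simps abs_le_iff minus_le_iff)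
    then show ?thesis
      unfolding circle_map_def vec_lambda_beta using pi_gt3 by (intro Ln_exp) auto
  qed
  have inv: "inv (circle_map L x) = x" if "x \<in> K" for x
    using Ln[OF that] L by (simp add: inv_def vec_eq_iff)
  have nonneg: "circle_map L x $ i \<notin> \<real>\<^sub>\<le>\<^sub>0" if "x \<in> K" for x i
  proof -
    have "- 1 \<le> x $ i / L" "x $ i / L \<le> 1" using that L by (auto simp: K field_simps abs_le_iff minus_le_iff)
    then have "cos (x $ i / L) > 0"
      using pi_gt3 by (intro cos_gt_zero_pi) linarith+
    then show ?thesis
      by (auto simp: circle_map_def complex_nonpos_Reals_iff Re_exp)
  qed
  have "continuous_on C inv"
    unfolding inv_def using nonneg
    by (intro continuous_intros continuous_on_component) (auto simp: C_def)
  then have "continuous_on C (\<lambda>u. f (inv u))"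
    by (rule continuous_on_compose2[OF f(1)]) auto
  moreover have "closedin (top_of_set UNIV) C" using C by (simp add: compact_imp_closed)
  moreover have B: "0 \<le> B" using f(2)[of 0] by linarith
  moreover have "norm (f (inv u)) \<le> B" for u using f(2) by simp
  \<comment> \<open>Tietze's theorem moves \<open>f\<close> from the image of the box to the whole
    space without enlarging the bound \<open>B\<close>.\<close>
  ultimately obtain F where F: "continuous_on UNIV F" "\<And>u. u \<in> C \<Longrightarrow> F u = f (inv u)"
    "\<And>u. norm (F u) \<le> B"
    by (metis Tietze UNIV_I)
  \<comment> \<open>The approximation is made on a ball containing the full torus, not just
    \<open>C\<close>: this is what bounds the polynomial for every \<open>x\<close>. A vector with
    unit coordinates has norm at most their number.\<close>
  have "compact (cball (0 :: complex ^ 'd) (real CARD('d)))" by simp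
  then obtain P where P: "real_polynomial_function P"
    "\<And>u. u \<in> cball (0 :: complex ^ 'd) (real CARD('d)) \<Longrightarrow> \<bar>F u - P u\<bar> < e"
    using Stone_Weierstrass_real_polynomial_function[OF _ continuous_on_subset[OF F(1)] e]
    by (metis subset_UNIV)
  have in_ball: "circle_map L x \<in> cball 0 (real CARD('d))" for x :: "real ^ 'd"
  proof -
    have "norm (circle_map L x) \<le> (\<Sum>i\<in>UNIV. norm (circle_map L x $ i))"
      unfolding norm_vec_def by (rule L2_set_le_sum) simp
    also have "\<dots> = real CARD('d)" by (simp add: circle_map_def)
    finally show ?thesis by simp
  qed
  show thesis
  proof
    show "trigonometric_polynomial (\<lambda>x. complex_of_real (P (circle_map L x)))"
      by (rule trigonometric_polynomial_circle_map[OF P(1)])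
    show "\<bar>f x - P (circle_map L x)\<bar> \<le> e" if "\<And>i. \<bar>x $ i\<bar> \<le> L" for x :: "real ^ 'd"
      using P(2)[OF in_ball, of x] F(2)[of "circle_map L x"] inv[of x] that
      by (auto simp: K C_def)
    show "\<bar>P (circle_map L x)\<bar> \<le> B + e" for x
      using P(2)[OF in_ball, of x] F(3)[of "circle_map L x"] by auto
  qed
qed

text \<open>A trigonometric polynomial close to \<open>f\<close> on a large box has convergent
  expectations. Outside the box both functions are bounded and all laws have small mass: the laws of
  \<open>X n\<close> by Markov's inequality for the squared norm, \<open>N\<close> because boxes
  exhaust the space.\<close>

lemma converges_in_distribution_char_fun:
  fixes X :: "nat \<Rightarrow> 'a \<Rightarrow> real ^ 'd" and N :: "(real ^ 'd) measure"
  assumes M: "\<And>n. prob_space (M n)" and X: "\<And>n. X n \<in> borel_measurable (M n)"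
    and N: "prob_space N" "sets N = sets borel"
    and sq: "\<And>n. integrable (M n) (\<lambda>s. (norm (X n s))\<^sup>2)"
    and bound: "Bseq (\<lambda>n. LINT s|M n. (norm (X n s))\<^sup>2)"
    and lim: "\<And>t. (\<lambda>n. char_fun (M n) (X n) t) \<longlonglongrightarrow> char_fun N (\<lambda>x. x) t"
  shows "converges_in_distribution M X N"
  unfolding converges_in_distribution_def
proof (intro allI impI, elim conjE)
  fix f :: "real ^ 'd \<Rightarrow> real"
  assume f: "continuous_on UNIV f" "bounded (range f)"
  interpret N: prob_space N by fact
  interpret M: prob_space "M n" for n by (rule M)
  note [measurable] = X
  have [measurable]: "f \<in> borel_measurable borel"
    using f(1) by (rule borel_measurable_continuous_onI)
  have [measurable_cong]: "sets N = sets borel" by fact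
  obtain B where B: "\<And>x. \<bar>f x\<bar> \<le> B" "B > 0"
    using f(2) unfolding bounded_pos by auto
  obtain C where C: "\<And>n. (LINT s|M n. (norm (X n s))\<^sup>2) \<le> C" "C > 0"
    using bound unfolding Bseq_def by (auto simp: abs_le_iff)
  have trig: "(\<lambda>n. CLINT s|M n. p (X n s)) \<longlonglongrightarrow> (CLINT x|N. p x)" and
    int: "\<And>n. complex_integrable (M n) (\<lambda>s. p (X n s))" "complex_integrable N p"
    if "trigonometric_polynomial p" for p
  proof -
    have "(\<lambda>n. CLINT s|M n. p (X n s)) \<longlonglongrightarrow> (CLINT x|N. p x) \<and>
      (\<forall>n. complex_integrable (M n) (\<lambda>s. p (X n s))) \<and> complex_integrable N p"
      using that
    proof (induction rule: trigonometric_polynomial.induct)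
      case (exp c t)
      have "integrable (M n) (\<lambda>s. exp (\<i> * complex_of_real (X n s \<bullet> t)))" for n
        by (rule M.integrable_const_bound[where B = 1]) auto
      moreover have "integrable N (\<lambda>x. exp (\<i> * complex_of_real (x \<bullet> t)))"
        by (rule N.integrable_const_bound[where B = 1]) auto
      moreover note lim[of t]
      ultimately show ?case
        by (auto simp: char_fun_def intro!: tendsto_mult)
    next
      case (add p q)
      then show ?case by (auto intro!: tendsto_add)
    qed
    then show "(\<lambda>n. CLINT s|M n. p (X n s)) \<longlonglongrightarrow> (CLINT x|N. p x)"
      "\<And>n. complex_integrable (M n) (\<lambda>s. p (X n s))" "complex_integrable N p"
      by auto
  qed
  define box where "box = (\<lambda>L. {x :: real ^ 'd. \<forall>i. \<bar>x $ i\<bar> \<le> L})"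
  have box_closed: "closed (box L)" for L
    unfolding box_def
    by (intro closed_Collect_all closed_Collect_le continuous_intros continuous_on_component)
  have [measurable]: "box L \<in> sets borel" for L
    using box_closed by (rule borel_closed)
  show "(\<lambda>n. LINT s|M n. f (X n s)) \<longlonglongrightarrow> (LINT y|N. f y)"
  proof (rule LIMSEQ_I)
    fix r :: real assume r: "r > 0"
    \<comment> \<open>The three errors add up to \<open>e * (4 * B + 5)\<close>, which the
      denominator generously covers; \<open>e \<le> 1\<close> allows \<open>2 * B + 1\<close> as a
      bound for \<open>\<bar>f x - P x\<bar>\<close> off the box.\<close>
    define e where "e = min 1 (r / (8 * B + 20))"
    have e: "0 < e" "e \<le> 1" "e * (8 * B + 20) \<le> r"
    proof -
      have "e \<le> r / (8 * B + 20)" by (simp add: e_def)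
      then show "e * (8 * B + 20) \<le> r" using B(2) by (simp add: pos_le_divide_eq)
      show "0 < e" "e \<le> 1" using r B(2) by (auto simp: e_def)
    qed
    have "(\<lambda>k. measure N (box (real k))) \<longlonglongrightarrow> measure N (\<Union>k. box (real k))"
      by (rule N.finite_Lim_measure_incseq) (auto simp: incseq_def box_def intro: order_trans)
    moreover have "(\<Union>k. box (real k)) = UNIV"
    proof -
      have "x \<in> (\<Union>k. box (real k))" for x
        using real_arch_simple[of "norm x"] component_le_norm_cart[of x]
        by (auto simp: box_def intro: order_trans)
      then show ?thesis by blast
    qed
    moreover have "measure N UNIV = 1"
      using N.prob_space sets_eq_imp_space_eq[OF N(2)] by simp
    ultimately have "(\<lambda>k. measure N (box (real k))) \<longlonglongrightarrow> 1" by simp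
    then have "eventually (\<lambda>k. measure N (box (real k)) > 1 - e) sequentially"
      using e by (intro order_tendstoD) auto
    moreover have "eventually (\<lambda>k. real k > max 1 (C / e)) sequentially"
      by (rule eventually_compose_filterlim[OF eventually_gt_at_top filterlim_real_sequentially])
    ultimately have "eventually (\<lambda>k. measure N (box (real k)) > 1 - e \<and> real k > max 1 (C / e)) sequentially"
      by (rule eventually_conj)
    then obtain k where k: "measure N (box (real k)) > 1 - e" "real k > 1" "real k > C / e"
      using eventually_happens'[OF sequentially_bot] by fastforce
    define L where "L = real k"
    have L: "L > 1" "C \<le> e * L\<^sup>2"
    proof -
      show "L > 1" using k by (simp add: L_def)
      have "C < e * L" using k(3) e by (simp add: L_def field_simps)
      also have "\<dots> \<le> e * L\<^sup>2" using \<open>L > 1\<close> e by (simp add: power2_eq_square)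
      finally show "C \<le> e * L\<^sup>2" by simp
    qed
    obtain P where P: "trigonometric_polynomial (\<lambda>x. complex_of_real (P x))"
      "\<And>x. (\<And>i. \<bar>x $ i\<bar> \<le> L) \<Longrightarrow> \<bar>f x - P x\<bar> \<le> e" "\<And>x. \<bar>P x\<bar> \<le> B + e"
      using trigonometric_approximation[OF f(1) B(1) _ e(1), of L] L by auto
    have P_meas [measurable]: "P \<in> borel_measurable borel"
      using trigonometric_polynomial_measurable[OF P(1)] by (simp add: borel_measurable_complex_iff)
    have lim_P: "(\<lambda>n. LINT s|M n. P (X n s)) \<longlonglongrightarrow> (LINT x|N. P x)"
      using trig[OF P(1)] by (simp add: tendsto_of_real_iff)
    have diff: "\<bar>f x - P x\<bar> \<le> e + (2 * B + 1) * indicator (- box L) x" for x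
    proof (cases "x \<in> box L")
      case True
      then show ?thesis using P(2)[of x] by (auto simp: box_def)
    next
      case False
      then show ?thesis using P(3)[of x] B(1)[of x] e by auto
    qed
    \<comment> \<open>Formulated for any law \<open>Q\<close>, to be used both for \<open>N\<close>
      and for the distribution of each \<open>X n\<close>.\<close>
    have close: "\<bar>(LINT x|Q. f x) - (LINT x|Q. P x)\<bar> \<le> e + (2 * B + 1) * measure Q (- box L)"
      if Q: "prob_space Q" "sets Q = sets borel" for Q
    proof -
      interpret Q: prob_space Q by fact
      have [measurable_cong]: "sets Q = sets borel" by fact
      have ints: "integrable Q f" "integrable Q P"
        by (rule Q.integrable_const_bound[of _ B], use B in auto)
           (rule Q.integrable_const_bound[of _ "B + e"], use P in auto)
      have "\<bar>(LINT x|Q. f x) - (LINT x|Q. P x)\<bar> = \<bar>LINT x|Q. f x - P x\<bar>"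
        using ints by simp
      also have "\<dots> \<le> (LINT x|Q. \<bar>f x - P x\<bar>)"
        by (rule integral_abs_bound)
      also have "\<dots> \<le> (LINT x|Q. e + (2 * B + 1) * indicator (- box L) x)"
        using ints diff by (intro integral_mono) (auto simp: Q.emeasure_finite less_top[symmetric])
      also have "\<dots> = e + (2 * B + 1) * measure Q (- box L)"
        using sets_eq_imp_space_eq[OF Q(2)] Q.prob_space
        by (subst Bochner_Integration.integral_add)
          (auto simp: Q.emeasure_finite less_top[symmetric])
      finally show ?thesis .
    qed
    have N_close: "\<bar>(LINT x|N. f x) - (LINT x|N. P x)\<bar> \<le> e + (2 * B + 1) * e"
    proof -
      have "measure N (- box L) = 1 - measure N (box L)"
        using N.prob_compl[of "box L"] sets_eq_imp_space_eq[OF N(2)] by (simp add: Compl_eq_Diff_UNIV)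
      then have "measure N (- box L) \<le> e" using k(1) by (simp add: L_def)
      then have "(2 * B + 1) * measure N (- box L) \<le> (2 * B + 1) * e"
        using B(2) by (intro mult_left_mono) auto
      then show ?thesis using close[OF N] by linarith
    qed
    have M_close: "\<bar>(LINT s|M n. f (X n s)) - (LINT s|M n. P (X n s))\<bar> \<le> e + (2 * B + 1) * e" for n
    proof -
      let ?Q = "distr (M n) borel (X n)"
      have "measure ?Q (- box L) = measure (M n) {s \<in> space (M n). X n s \<notin> box L}"
        by (subst measure_distr) (auto intro!: arg_cong[where f = "measure (M n)"])
      also have "\<dots> \<le> measure (M n) {s \<in> space (M n). L\<^sup>2 \<le> (norm (X n s))\<^sup>2}"
      proof (rule M.finite_measure_mono)
        show "{s \<in> space (M n). X n s \<notin> box L} \<subseteq> {s \<in> space (M n). L\<^sup>2 \<le> (norm (X n s))\<^sup>2}"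
        proof safe
          fix s assume "X n s \<notin> box L"
          then obtain i where "L < \<bar>X n s $ i\<bar>" by (auto simp: box_def not_le)
          also have "\<dots> \<le> norm (X n s)" by (rule component_le_norm_cart)
          finally show "L\<^sup>2 \<le> (norm (X n s))\<^sup>2" using L by (intro power_mono) auto
        qed
      qed simp
      also have "\<dots> \<le> (LINT s|M n. (norm (X n s))\<^sup>2) / L\<^sup>2"
        using L sq by (intro integral_Markov_inequality_measure[where A = "{}"]) auto
      also have "\<dots> \<le> e"
        using C(1)[of n] L(2) \<open>L > 1\<close> by (simp add: divide_le_eq)
      finally have "(2 * B + 1) * measure ?Q (- box L) \<le> (2 * B + 1) * e"
        using B(2) by (intro mult_left_mono) auto
      moreover have "\<bar>(LINT x|?Q. f x) - (LINT x|?Q. P x)\<bar> \<le> e + (2 * B + 1) * measure ?Q (- box L)"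
        by (rule close) (auto intro: M.prob_space_distr)
      ultimately show ?thesis by (simp add: integral_distr)
    qed
    obtain n0 where n0: "\<And>n. n \<ge> n0 \<Longrightarrow> \<bar>(LINT s|M n. P (X n s)) - (LINT x|N. P x)\<bar> < e"
      using LIMSEQ_D[OF lim_P e(1)] by (auto simp: dist_real_def)
    show "\<exists>n0. \<forall>n\<ge>n0. norm ((LINT s|M n. f (X n s)) - (LINT y|N. f y)) < r"
    proof (intro exI allI impI)
      fix n assume "n \<ge> n0"
      have tri: "\<bar>x - y\<bar> < 2 * d + e" if "\<bar>p - q\<bar> < e" "\<bar>x - p\<bar> \<le> d" "\<bar>y - q\<bar> \<le> d"
        for x y p q d :: real using that by linarith
      have "\<bar>(LINT s|M n. f (X n s)) - (LINT y|N. f y)\<bar> < 2 * (e + (2 * B + 1) * e) + e"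
        by (rule tri[OF n0[OF \<open>n \<ge> n0\<close>] M_close N_close])
      also have "\<dots> \<le> e * (8 * B + 20)" using e B(2) by (simp add: algebra_simps)
      also have "\<dots> \<le> r" by (rule e)
      finally show "norm ((LINT s|M n. f (X n s)) - (LINT y|N. f y)) < r" by simp
    qed
  qed
qed

section \<open>The centered normal law and its characteristic function\<close>

lemma measurable_std_normal_vec:
  "(\<lambda>w. \<chi> i. w i) \<in> (\<Pi>\<^sub>M i\<in>(UNIV :: 'd set). std_normal_distribution) \<rightarrow>\<^sub>M (borel :: (real ^ 'd) measure)"
  unfolding borel_measurable_euclidean_space[where 'c = "real ^ 'd"]
  by (auto simp: Basis_vec_def inner_axis)

lemma char_fun_std_normal_vec:
  "(CLINT x|(std_normal_vec :: (real ^ 'd) measure). exp (\<i> * complex_of_real (x \<bullet> t))) =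
    complex_of_real (exp (- (norm t)\<^sup>2 / 2))"
proof -
  interpret prob_space std_normal_distribution by (rule prob_space_normal_density) simp
  interpret product_sigma_finite "\<lambda>_ :: 'd. std_normal_distribution"
    by standard
  let ?P = "\<Pi>\<^sub>M i\<in>(UNIV :: 'd set). std_normal_distribution"
  have "(CLINT x|(std_normal_vec :: (real ^ 'd) measure). exp (\<i> * complex_of_real (x \<bullet> t))) =
      (CLINT w|?P. (\<Prod>i\<in>UNIV. exp (\<i> * complex_of_real (t $ i * w i))))"
    unfolding std_normal_vec_def
    by (subst integral_distr[OF measurable_std_normal_vec])
      (auto simp: inner_vec_def sum_distrib_left mult.commute exp_sum[symmetric] intro!: Bochner_Integration.integral_cong)
  also have "\<dots> = (\<Prod>i\<in>UNIV. CLINT w|std_normal_distribution. exp (\<i> * complex_of_real (t $ i * w)))"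
    by (rule product_integral_prod) (auto intro!: integrable_const_bound[where B = 1])
  also have "\<dots> = (\<Prod>i\<in>UNIV. char std_normal_distribution (t $ i))"
    by (simp add: char_def)
  also have "\<dots> = complex_of_real (exp (- (norm t)\<^sup>2 / 2))"
  proof -
    have "- (norm t)\<^sup>2 / 2 = (\<Sum>i\<in>UNIV. - (t $ i)\<^sup>2 / 2)"
      by (simp add: norm_vec_def L2_set_def sum_nonneg sum_negf sum_divide_distrib)
    then show ?thesis
      unfolding char_std_normal_distribution by (simp only: exp_sum[OF finite] of_real_prod)
  qed
  finally show ?thesis .
qed

lemma prob_space_std_normal_vec: "prob_space (std_normal_vec :: (real ^ 'd) measure)"
proof -
  interpret prob_space std_normal_distribution by (rule prob_space_normal_density) simp
  show ?thesis
    unfolding std_normal_vec_def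
    by (intro prob_space.prob_space_distr[OF prob_space_PiM] measurable_std_normal_vec prob_space_axioms)
qed

text \<open>Cholesky elimination that tolerates singular matrices; \<open>I\<close> contains the
  indices of rows not yet eliminated. Keeping the columns of \<open>A\<close> outside
  \<open>I\<close> zero leaves column \<open>p\<close> free for the next pivot.\<close>

lemma positive_semidefinite_factorization_aux:
  fixes S :: "real ^ 'd ^ 'd"
  assumes "finite I" "transpose S = S" "\<And>v. 0 \<le> v \<bullet> (S *v v)"
    "\<And>i j. i \<notin> I \<Longrightarrow> S $ i $ j = 0"
  shows "\<exists>A :: real ^ 'd ^ 'd. A ** transpose A = S \<and> (\<forall>i j. j \<notin> I \<longrightarrow> A $ i $ j = 0)"
  using assms
proof (induction I arbitrary: S rule: finite_induct)
  case empty
  then have "S = 0" by (simp add: vec_eq_iff)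
  then show ?case by (intro exI[of _ 0]) (simp add: matrix_matrix_mult_def transpose_def vec_eq_iff)
next
  case (insert p I)
  have sym: "S $ i $ j = S $ j $ i" for i j
    using insert.prems(1) by (metis transpose_def vec_lambda_beta)
  have Sp: "(S *v v) $ p = (\<Sum>j\<in>UNIV. v $ j * S $ j $ p)" for v
    unfolding matrix_vector_mult_def vec_lambda_beta
    by (rule sum.cong[OF refl]) (metis sym mult.commute)
  \<comment> \<open>The quadratic form along the direction \<open>axis p 1\<close> is a quadratic
    polynomial in \<open>s\<close>; two choices of \<open>s\<close> drive both cases below.\<close>
  have shift: "(w + s *\<^sub>R axis p 1) \<bullet> (S *v (w + s *\<^sub>R axis p 1)) =
    w \<bullet> (S *v w) + 2 * s * (S *v w) $ p + s\<^sup>2 * S $ p $ p" for w s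
  proof -
    have "w \<bullet> (S *v axis p 1) = (S *v w) $ p"
      unfolding matrix_vector_mult_basis Sp by (simp add: column_def inner_vec_def)
    moreover have "axis p 1 \<bullet> x = x $ p" for x :: "real ^ 'd"
      by (simp add: inner_axis')
    moreover have "(S *v axis p 1) $ p = S $ p $ p"
      by (simp add: matrix_vector_mult_basis column_def)
    ultimately show ?thesis
      by (simp add: matrix_vector_right_distrib matrix_vector_mult_scaleR inner_add_left inner_add_right
          power2_eq_square algebra_simps)
  qed
  have nonneg: "S $ p $ p \<ge> 0"
    using insert.prems(2)[of "0 + 1 *\<^sub>R axis p 1"] by (subst (asm) shift) simp
  show ?case
  proof (cases "S $ p $ p = 0")
    case True
    have row: "S $ p $ i = 0" for i
    proof (rule ccontr)
      assume i: "S $ p $ i \<noteq> 0"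
      \<comment> \<open>With a zero pivot the form is affine in \<open>s\<close>, and the chosen
        \<open>s\<close> gives it the value \<open>q - (q + 1) = -1\<close>, against
        nonnegativity.\<close>
      define q where "q = axis i 1 \<bullet> (S *v axis i 1)"
      have "0 \<le> q + 2 * (- (q + 1) / (2 * S $ p $ i)) * S $ p $ i"
        using insert.prems(2)[of "axis i 1 + (- (q + 1) / (2 * S $ p $ i)) *\<^sub>R axis p 1"]
        by (subst (asm) shift) (simp add: True q_def matrix_vector_mult_basis column_def)
      moreover have "2 * (- (q + 1) / (2 * S $ p $ i)) * S $ p $ i = - (q + 1)"
        using i by simp
      ultimately show False by linarith
    qed
    have "\<exists>A :: real ^ 'd ^ 'd. A ** transpose A = S \<and> (\<forall>i j. j \<notin> I \<longrightarrow> A $ i $ j = 0)"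
    proof (rule insert.IH)
      show "S $ i $ j = 0" if "i \<notin> I" for i j
        using that insert.prems(3)[of i j] row[of j] by (cases "i = p") auto
    qed (use insert.prems in auto)
    then show ?thesis by blast
  next
    case False
    then have c: "S $ p $ p > 0" using nonneg by simp
    \<comment> \<open>The Schur complement of the pivot: row \<open>p\<close> and column
      \<open>p\<close> vanish.\<close>
    define T where "T = (\<chi> i j. S $ i $ j - S $ i $ p * S $ j $ p / S $ p $ p)"
    have "\<exists>A :: real ^ 'd ^ 'd. A ** transpose A = T \<and> (\<forall>i j. j \<notin> I \<longrightarrow> A $ i $ j = 0)"
    proof (rule insert.IH)
      show "transpose T = T"
        by (simp add: T_def transpose_def vec_eq_iff sym mult.commute)
      show "T $ i $ j = 0" if "i \<notin> I" for i j
      proof (cases "i = p")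
        case True
        then show ?thesis using c sym[of j p] by (simp add: T_def)
      next
        case False
        then show ?thesis using insert.prems(3) that by (simp add: T_def)
      qed
      fix v
      \<comment> \<open>The minimizer of the quadratic polynomial in \<open>shift\<close>. The form
        of \<open>T\<close> at \<open>v\<close> is the minimum of the form of \<open>S\<close> along
        this line, hence nonnegative.\<close>
      let ?s = "- (S *v v) $ p / S $ p $ p"
      let ?x = "(S *v v) $ p"
      have "(T *v v) $ i = (S *v v) $ i - S $ i $ p * ?x / S $ p $ p" for i
      proof -
        have "(T *v v) $ i = (\<Sum>j\<in>UNIV. S $ i $ j * v $ j - S $ i $ p / S $ p $ p * (v $ j * S $ j $ p))"
          by (simp add: T_def matrix_vector_mult_def left_diff_distrib right_diff_distrib mult_ac)
        also have "\<dots> = (S *v v) $ i - S $ i $ p / S $ p $ p * ?x"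
          unfolding sum_subtractf Sp sum_distrib_left[symmetric] by (simp add: matrix_vector_mult_def)
        finally show ?thesis by simp
      qed
      then have "v \<bullet> (T *v v) = (\<Sum>i\<in>UNIV. v $ i * (S *v v) $ i - v $ i * S $ i $ p * (?x / S $ p $ p))"
        by (simp add: inner_vec_def right_diff_distrib mult.assoc)
      also have "\<dots> = v \<bullet> (S *v v) - ?x * ?x / S $ p $ p"
        unfolding sum_subtractf sum_distrib_right[symmetric] Sp[symmetric] by (simp add: inner_vec_def)
      also have "\<dots> =
          (v + ?s *\<^sub>R axis p 1) \<bullet> (S *v (v + ?s *\<^sub>R axis p 1))"
      proof -
        have "q - x * x / c = q + 2 * (- x / c) * x + (- x / c)\<^sup>2 * c" if "c \<noteq> 0" for q x c :: real
          using that by (simp add: field_simps power2_eq_square)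
        then show ?thesis unfolding shift using c by simp
      qed
      finally show "0 \<le> v \<bullet> (T *v v)" using insert.prems(2) by simp
    qed
    then obtain A :: "real ^ 'd ^ 'd" where A: "A ** transpose A = T" "\<And>i j. j \<notin> I \<Longrightarrow> A $ i $ j = 0" by blast
    \<comment> \<open>The rank-one part removed in \<open>T\<close> is restored by one new column,
      written into the free position \<open>p\<close>.\<close>
    define A' where "A' = (\<chi> i j. if j = p then S $ i $ p / sqrt (S $ p $ p) else A $ i $ j)"
    have "(\<Sum>k\<in>UNIV. A' $ i $ k * A' $ j $ k) = S $ i $ j" for i j
    proof -
      have "(\<Sum>k\<in>UNIV. A' $ i $ k * A' $ j $ k) =
          (\<Sum>k\<in>UNIV. A $ i $ k * A $ j $ k + (if k = p then S $ i $ p * S $ j $ p / S $ p $ p else 0))"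
        using A(2) insert.hyps(2) c by (intro sum.cong) (auto simp: A'_def)
      also have "\<dots> = (A ** transpose A) $ i $ j + S $ i $ p * S $ j $ p / S $ p $ p"
        by (simp add: sum.distrib matrix_matrix_mult_def transpose_def)
      finally show ?thesis by (simp add: A T_def)
    qed
    then have "A' ** transpose A' = S"
      by (simp add: matrix_matrix_mult_def transpose_def vec_eq_iff)
    moreover have "\<forall>i j. j \<notin> insert p I \<longrightarrow> A' $ i $ j = 0"
      using A(2) by (simp add: A'_def)
    ultimately show ?thesis by blast
  qed
qed

lemma positive_semidefinite_factorization:
  fixes S :: "real ^ 'd ^ 'd"
  assumes "positive_semidefinite S"
  shows "\<exists>A :: real ^ 'd ^ 'd. A ** transpose A = S"
  using positive_semidefinite_factorization_aux[of UNIV S] assms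
  by (auto simp: positive_semidefinite_def)

text \<open>Moving \<open>A\<close> to the other side of the inner product turns the exponent into
  \<open>(norm (transpose A *v t))\<^sup>2\<close>, which depends on \<open>A\<close> only through
  \<open>A ** transpose A\<close>. Thus the arbitrary choice in \<open>centered_normal\<close> is
  invisible here.\<close>

lemma
  fixes S :: "real ^ 'd ^ 'd"
  assumes "positive_semidefinite S"
  shows prob_space_centered_normal: "prob_space (centered_normal S)"
    and char_fun_centered_normal: "char_fun (centered_normal S) (\<lambda>x. x) t =
      complex_of_real (exp (- (t \<bullet> (S *v t)) / 2))"
proof -
  define A :: "real ^ 'd ^ 'd" where "A = (SOME A. A ** transpose A = S)"
  have A: "A ** transpose A = S"
    unfolding A_def by (rule someI_ex) (rule positive_semidefinite_factorization[OF assms])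
  have [measurable_cong]: "sets (std_normal_vec :: (real ^ 'd) measure) = sets borel"
    by (simp add: std_normal_vec_def)
  have [measurable]: "(\<lambda>x. A *v x) \<in> borel_measurable borel"
    by (intro borel_measurable_continuous_onI linear_continuous_on matrix_vector_mul_bounded_linear)
  have N: "centered_normal S = distr std_normal_vec borel (\<lambda>x. A *v x)"
    by (simp add: centered_normal_def A_def)
  show "prob_space (centered_normal S)"
    unfolding N by (rule prob_space.prob_space_distr[OF prob_space_std_normal_vec]) simp
  have "char_fun (centered_normal S) (\<lambda>x. x) t =
      (CLINT x|std_normal_vec. exp (\<i> * complex_of_real (x \<bullet> (transpose A *v t))))"
    unfolding N char_fun_def
    by (subst integral_distr) (auto simp: dot_lmul_matrix inner_commute[of _ t] inner_commute[of _ "t v* A"] intro!: Bochner_Integration.integral_cong)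
  also have "\<dots> = complex_of_real (exp (- (norm (transpose A *v t))\<^sup>2 / 2))"
    by (rule char_fun_std_normal_vec)
  also have "(norm (transpose A *v t))\<^sup>2 = t \<bullet> (S *v t)"
    unfolding A[symmetric] power2_norm_eq_inner
    by (simp add: matrix_vector_mul_assoc[symmetric] dot_lmul_matrix)
  finally show "char_fun (centered_normal S) (\<lambda>x. x) t =
      complex_of_real (exp (- (t \<bullet> (S *v t)) / 2))" .
qed

subsection \<open>The one-dimensional case\<close>

lemma uniform_limit_tendsto_const:
  "(f \<longlongrightarrow> l) F \<Longrightarrow> uniform_limit S (\<lambda>s z. f s) (\<lambda>z. l) F"
  unfolding uniform_limit_iff tendsto_iff by (auto elim!: eventually_mono)

lemma Bseq_over_n:
  fixes u :: "nat \<Rightarrow> complex"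
  assumes "Bseq u"
  shows "(\<lambda>n. u n / of_nat n) \<longlonglongrightarrow> 0"
proof -
  obtain K where K: "K > 0" "\<And>n. norm (u n) \<le> K" using assms by (auto simp: Bseq_def)
  show ?thesis
  proof (rule Lim_null_comparison)
    show "eventually (\<lambda>n. norm (u n / of_nat n) \<le> K / real n) sequentially"
      using K by (auto simp: norm_divide intro!: divide_right_mono always_eventually)
    show "(\<lambda>n. K / real n) \<longlonglongrightarrow> 0" by real_asymp
  qed
qed

lemma sin_div_tendsto:
  fixes c :: real
  shows "((\<lambda>s. sin (s * c) / s) \<longlongrightarrow> c) (at 0)"
proof -
  have "((\<lambda>s. sin (s * c)) has_field_derivative c) (at 0)"
    by (auto intro!: derivative_eq_intros)
  then show ?thesis by (simp add: has_field_derivative_iff)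
qed

lemma abs_sin_div_le:
  fixes c s :: real
  shows "\<bar>sin (s * c) / s\<bar> \<le> \<bar>c\<bar>"
  using abs_sin_x_le_abs_x[of "s * c"] by (cases "s = 0") (auto simp: abs_mult field_simps)

text \<open>A second-order expansion of the characteristic function at the origin forces a finite
  second moment, by Fatou's lemma.\<close>

lemma moments_from_char_expansion:
  fixes X :: "'a \<Rightarrow> real"
  assumes "prob_space M" and X [measurable]: "X \<in> borel_measurable M"
  assumes exp: "((\<lambda>s. ((CLINT x|M. exp (\<i> * complex_of_real (s * X x))) -
      (1 - complex_of_real s * \<alpha> + (complex_of_real s)\<^sup>2 * \<beta>)) / (complex_of_real s)\<^sup>2) \<longlongrightarrow> 0) (at 0)"
  shows "integrable M (\<lambda>x. (X x)\<^sup>2)" "integrable M X"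
    "complex_of_real (LINT x|M. X x) = \<i> * \<alpha>" "complex_of_real (LINT x|M. (X x)\<^sup>2) = - 2 * \<beta>"
proof -
  interpret prob_space M by fact
  define \<phi> where "\<phi> = (\<lambda>s. CLINT x|M. exp (\<i> * complex_of_real (s * X x)))"
  define \<eta> where "\<eta> = (\<lambda>s. (\<phi> s - (1 - complex_of_real s * \<alpha> + (complex_of_real s)\<^sup>2 * \<beta>)) / (complex_of_real s)\<^sup>2)"
  \<comment> \<open>A sequence is fixed because Fatou's lemma and dominated convergence are applied
    along sequences.\<close>
  define t where "t = (\<lambda>k. 1 / real (Suc k))"
  have t: "filterlim t (at 0) sequentially" "\<And>k. t k > 0"
  proof -
    have "t \<longlonglongrightarrow> 0" unfolding t_def by (rule LIMSEQ_Suc) real_asymp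
    then show "filterlim t (at 0) sequentially" by (auto simp: filterlim_at t_def)
    show "t k > 0" for k by (simp add: t_def)
  qed
  have t': "filterlim (\<lambda>k. - t k) (at 0) sequentially"
    using t(1) t(2) by (auto simp: filterlim_at less_imp_neq[OF t(2), symmetric] intro: tendsto_minus_cancel)
  have \<eta>: "(\<lambda>k. \<eta> (t k)) \<longlonglongrightarrow> 0" "(\<lambda>k. \<eta> (- t k)) \<longlonglongrightarrow> 0"
    using filterlim_compose[OF exp t(1)] filterlim_compose[OF exp t'] by (simp_all add: \<eta>_def \<phi>_def)
  have \<phi>: "\<phi> s = 1 - complex_of_real s * \<alpha> + (complex_of_real s)\<^sup>2 * \<beta> + (complex_of_real s)\<^sup>2 * \<eta> s"
    if "s \<noteq> 0" for s using that by (simp add: \<eta>_def field_simps)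
  have int: "integrable M (\<lambda>x. exp (\<i> * complex_of_real (s * X x)))" for s
    by (rule integrable_const_bound[where B = 1]) auto
  have int_cos: "integrable M (\<lambda>x. cos (s * X x))" and int_sin: "integrable M (\<lambda>x. sin (s * X x))" for s
    by (rule integrable_const_bound[where B = 1], auto)+
  have \<phi>_cs: "\<phi> s = complex_of_real (LINT x|M. cos (s * X x)) + \<i> * complex_of_real (LINT x|M. sin (s * X x))" for s
  proof -
    have "\<phi> s = (CLINT x|M. complex_of_real (cos (s * X x)) + \<i> * complex_of_real (sin (s * X x)))"
      unfolding \<phi>_def by (intro Bochner_Integration.integral_cong)
        (auto simp: complex_eq_iff Re_exp Im_exp)
    also have "\<dots> = complex_of_real (LINT x|M. cos (s * X x)) + \<i> * complex_of_real (LINT x|M. sin (s * X x))"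
      using int_cos[of s] int_sin[of s]
      by (subst Bochner_Integration.integral_add) (auto simp: integral_of_real)
    finally show ?thesis .
  qed
  \<comment> \<open>The symmetric second difference
    \<open>(2 - 2 * cos (t k * X x)) / (t k)\<^sup>2\<close>, written as a square: this shows it to
    be nonnegative, for Fatou, and at most \<open>(X x)\<^sup>2\<close>, for domination.\<close>
  define g where "g = (\<lambda>k x. (2 * (sin (t k * (X x / 2)) / t k))\<^sup>2)"
  have g_lim: "(\<lambda>k. g k x) \<longlonglongrightarrow> (X x)\<^sup>2" for x
  proof -
    have "(\<lambda>k. g k x) \<longlonglongrightarrow> (2 * (X x / 2))\<^sup>2"
      unfolding g_def by (intro tendsto_intros filterlim_compose[OF sin_div_tendsto t(1)])
    then show ?thesis by simp
  qed
  have g_cos: "g k x = (2 - 2 * cos (t k * X x)) / (t k)\<^sup>2" for k x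
    using cos_double_sin[of "t k * (X x / 2)"] by (simp add: g_def power_mult_distrib power_divide)
  have g_int: "integrable M (g k)" for k
    unfolding g_cos using int_cos by simp
  \<comment> \<open>The linear terms cancel between \<open>t k\<close> and \<open>- t k\<close>, so
    only the quadratic coefficient and the two remainders survive.\<close>
  have "complex_of_real (LINT x|M. g k x) = - 2 * \<beta> - \<eta> (t k) - \<eta> (- t k)" for k
  proof -
    have "complex_of_real (LINT x|M. g k x) = (2 - \<phi> (t k) - \<phi> (- t k)) / (complex_of_real (t k))\<^sup>2"
      unfolding g_cos \<phi>_cs using int_cos[of "t k"] prob_space by simp
    also have "\<dots> = - 2 * \<beta> - \<eta> (t k) - \<eta> (- t k)"
      using t(2)[of k] by (subst (1 2) \<phi>) (auto simp: field_simps)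
    finally show ?thesis .
  qed
  then have "(\<lambda>k. complex_of_real (LINT x|M. g k x)) \<longlonglongrightarrow> - 2 * \<beta> - 0 - 0"
    by (simp only:) (intro tendsto_intros \<eta>)
  then have g_conv: "(\<lambda>k. complex_of_real (LINT x|M. g k x)) \<longlonglongrightarrow> - 2 * \<beta>" by simp
  have g_re: "(\<lambda>k. LINT x|M. g k x) \<longlonglongrightarrow> Re (- 2 * \<beta>)"
    using tendsto_Re[OF g_conv] by simp
  \<comment> \<open>Fatou gives only an inequality, but a finite bound; with integrability in hand,
    dominated convergence then identifies the second moment exactly.\<close>
  have "(\<integral>\<^sup>+ x. ennreal ((X x)\<^sup>2) \<partial>M) = (\<integral>\<^sup>+ x. liminf (\<lambda>k. ennreal (g k x)) \<partial>M)"
    using g_lim by (intro nn_integral_cong lim_imp_Liminf[symmetric]) (auto intro!: tendsto_ennrealI)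
  also have "\<dots> \<le> liminf (\<lambda>k. \<integral>\<^sup>+ x. ennreal (g k x) \<partial>M)"
    by (rule nn_integral_liminf) (simp add: g_def)
  also have "\<dots> = liminf (\<lambda>k. ennreal (LINT x|M. g k x))"
    using g_int by (subst nn_integral_eq_integral) (auto simp: g_def)
  also have "\<dots> = ennreal (Re (- 2 * \<beta>))"
    using g_re by (intro lim_imp_Liminf) (auto intro!: tendsto_ennrealI)
  finally have "(\<integral>\<^sup>+ x. ennreal ((X x)\<^sup>2) \<partial>M) < \<infinity>"
    by (metis ennreal_less_top infinity_ennreal_def order_le_less_trans)
  then show sq: "integrable M (\<lambda>x. (X x)\<^sup>2)"
    by (intro integrableI_nonneg) auto
  then show X1: "integrable M X" by (rule square_integrable_imp_integrable[OF X])
  have "(\<lambda>k. LINT x|M. g k x) \<longlonglongrightarrow> (LINT x|M. (X x)\<^sup>2)"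
  proof (rule integral_dominated_convergence[where w = "\<lambda>x. (X x)\<^sup>2"])
    show "AE x in M. norm (g k x) \<le> (X x)\<^sup>2" for k
    proof (rule AE_I2)
      fix x
      have "\<bar>2 * (sin (t k * (X x / 2)) / t k)\<bar> \<le> \<bar>X x\<bar>"
        using abs_sin_div_le[of "t k" "X x / 2"] by (simp add: abs_mult mult.commute)
      then have "(2 * (sin (t k * (X x / 2)) / t k))\<^sup>2 \<le> (X x)\<^sup>2"
        by (simp only: abs_le_square_iff)
      then show "norm (g k x) \<le> (X x)\<^sup>2" by (simp add: g_def)
    qed
  qed (use g_lim sq in \<open>auto simp: g_def\<close>)
  then have "(\<lambda>k. complex_of_real (LINT x|M. g k x)) \<longlonglongrightarrow> complex_of_real (LINT x|M. (X x)\<^sup>2)"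
    by (rule tendsto_of_real)
  then show "complex_of_real (LINT x|M. (X x)\<^sup>2) = - 2 * \<beta>"
    using g_conv LIMSEQ_unique by blast
  have "(\<lambda>k. LINT x|M. sin (t k * X x) / t k) \<longlonglongrightarrow> (LINT x|M. X x)"
    by (rule integral_dominated_convergence[where w = "\<lambda>x. \<bar>X x\<bar>"])
      (use X1 in \<open>auto intro!: filterlim_compose[OF sin_div_tendsto t(1)] simp: abs_sin_div_le simp del: abs_divide\<close>)
  then have 1: "(\<lambda>k. complex_of_real (LINT x|M. sin (t k * X x) / t k)) \<longlonglongrightarrow> complex_of_real (LINT x|M. X x)"
    by (rule tendsto_of_real)
  \<comment> \<open>The mean comes from the odd part, where the constant and quadratic terms cancel
    and the remainders keep a factor \<open>t k\<close>.\<close>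
  have "complex_of_real (LINT x|M. sin (t k * X x) / t k) = \<i> * \<alpha> - \<i> / 2 * complex_of_real (t k) * (\<eta> (t k) - \<eta> (- t k))" for k
  proof -
    have "complex_of_real (LINT x|M. sin (t k * X x) / t k) = (\<phi> (t k) - \<phi> (- t k)) / (2 * \<i> * complex_of_real (t k))"
      unfolding \<phi>_cs using t(2)[of k] by (simp add: field_simps)
    also have "\<dots> = \<i> * \<alpha> - \<i> / 2 * complex_of_real (t k) * (\<eta> (t k) - \<eta> (- t k))"
      using t(2)[of k] by (subst (1 2) \<phi>) (auto simp: field_simps power2_eq_square)
    finally show ?thesis .
  qed
  moreover have "(\<lambda>k. complex_of_real (t k)) \<longlonglongrightarrow> 0"
    using t(1) by (auto simp: filterlim_at intro: tendsto_of_real[where a = 0, simplified])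
  then have "(\<lambda>k. \<i> * \<alpha> - \<i> / 2 * complex_of_real (t k) * (\<eta> (t k) - \<eta> (- t k))) \<longlonglongrightarrow> \<i> * \<alpha> - \<i> / 2 * 0 * (0 - 0)"
    by (intro tendsto_intros \<eta>)
  ultimately show "complex_of_real (LINT x|M. X x) = \<i> * \<alpha>"
    using LIMSEQ_unique[OF 1] by simp
qed

lemma uniform_limit_mult_scalar:
  fixes f :: "real \<Rightarrow> complex \<Rightarrow> complex"
  assumes "uniform_limit S f g F" "bounded (g ` S)" "(h \<longlongrightarrow> l) F"
  shows "uniform_limit S (\<lambda>s z. h s * f s z) (\<lambda>z. l * g z) F"
  by (intro uniform_lim_mult uniform_limit_tendsto_const assms) (auto simp: image_constant_conv)

lemma bounded_holomorphic_cball: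
  fixes f :: "complex \<Rightarrow> complex"
  assumes "f holomorphic_on ball 0 R" "r < R"
  shows "bounded (f ` cball 0 r)"
  using assms by (intro compact_imp_bounded compact_continuous_image holomorphic_on_imp_continuous_on)
    (auto intro: holomorphic_on_subset)

text \<open>Near 0 one has \<open>Ln (1 + u) = u * h u\<close> with \<open>h 0 = 1\<close>, so
  \<open>n\<close> times the logarithm of the base is
  \<open>c n * h (c n / of_nat n)\<close>.\<close>

lemma power_exp_limit:
  fixes c :: "nat \<Rightarrow> complex"
  assumes "c \<longlonglongrightarrow> l"
  shows "(\<lambda>n. (1 + c n / of_nat n) ^ n) \<longlonglongrightarrow> exp l"
proof -
  have "1 + u \<notin> \<real>\<^sub>\<le>\<^sub>0" if "u \<in> ball 0 1" for u :: complex
    using abs_Re_le_cmod[of u] that by (auto simp: complex_nonpos_Reals_iff)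
  then have "(\<lambda>u. Ln (1 + u)) holomorphic_on ball 0 1"
    by (intro holomorphic_intros)
  then obtain h where h: "h holomorphic_on ball 0 1" "h 0 = deriv (\<lambda>u. Ln (1 + u)) (0::complex)"
    "\<And>u. Ln (1 + u) = Ln (1 + 0) + (u - 0) * h u"
    by (rule holomorphic_taylor_remainder[OF _ open_ball, of _ _ _ 0]) auto
  have "((\<lambda>u. Ln (1 + u)) has_field_derivative 1) (at (0::complex))"
    by (auto intro!: derivative_eq_intros)
  then have h0: "h 0 = 1" by (simp add: h(2) DERIV_imp_deriv)
  have u: "(\<lambda>n. c n / of_nat n) \<longlonglongrightarrow> 0"
    using assms by (intro Bseq_over_n convergent_imp_Bseq convergentI)
  have "isCont h 0"
    using holomorphic_on_imp_continuous_on[OF h(1)] by (simp add: continuous_on_eq_continuous_at)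
  then have "(\<lambda>n. exp (c n * h (c n / of_nat n))) \<longlonglongrightarrow> exp (l * h 0)"
    by (intro tendsto_intros assms isCont_tendsto_compose[OF _ u])
  moreover have "eventually (\<lambda>n. (1 + c n / of_nat n) ^ n = exp (c n * h (c n / of_nat n))) sequentially"
  proof -
    have "eventually (\<lambda>n. norm (c n / of_nat n) < 1) sequentially"
      using tendsto_norm[OF u] by (intro order_tendstoD) auto
    then show ?thesis using eventually_gt_at_top[of 0]
    proof eventually_elim
      case (elim n)
      have "1 + c n / of_nat n \<noteq> 0"
        using elim(1) by (metis add.inverse_unique less_irrefl norm_minus_cancel norm_one)
      then have "(1 + c n / of_nat n) ^ n = exp (of_nat n * Ln (1 + c n / of_nat n))"
        by (simp add: exp_of_nat_mult)
      also have "Ln (1 + c n / of_nat n) = c n / of_nat n * h (c n / of_nat n)"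
        by (subst h(3)) simp
      also have "of_nat n * (c n / of_nat n * h (c n / of_nat n)) = c n * h (c n / of_nat n)"
        using elim(2) by simp
      finally show ?case .
    qed
  qed
  ultimately show ?thesis
    unfolding h0 mult_1_right by (rule tendsto_cong[THEN iffD2, rotated])
qed

lemma exp_second_order:
  fixes a :: complex
  shows "((\<lambda>s. (exp (- complex_of_real s * a) - (1 - complex_of_real s * a)) / (complex_of_real s)\<^sup>2)
    \<longlongrightarrow> a\<^sup>2 / 2) (at 0)"
proof (rule LIM_zero_cancel, rule Lim_null_comparison)
  show "eventually (\<lambda>s. norm ((exp (- complex_of_real s * a) - (1 - complex_of_real s * a)) / (complex_of_real s)\<^sup>2 - a\<^sup>2 / 2)
    \<le> exp (\<bar>s\<bar> * norm a) * norm a ^ 3 * \<bar>s\<bar>) (at 0)"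
    unfolding eventually_at
  proof (intro exI[of _ 1] conjI ballI impI)
    fix s :: real assume "s \<noteq> 0 \<and> dist s 0 < 1"
    then have s: "s \<noteq> 0" by simp
    let ?x = "- complex_of_real s * a"
    have "norm (exp ?x - (\<Sum>k\<le>2. ?x ^ k / fact k)) \<le> exp \<bar>Re ?x\<bar> * norm ?x ^ Suc 2 / fact 2"
      by (rule Taylor_exp)
    also have "\<dots> \<le> exp (\<bar>s\<bar> * norm a) * norm ?x ^ Suc 2 / 1"
      using abs_Re_le_cmod[of a] by (intro frac_le mult_right_mono) (auto simp: abs_mult intro!: mult_left_mono)
    also have "\<dots> = exp (\<bar>s\<bar> * norm a) * norm a ^ 3 * \<bar>s\<bar> * \<bar>s\<bar>\<^sup>2"
      by (simp add: norm_mult power_mult_distrib power3_eq_cube power2_eq_square mult_ac)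
    finally have "norm (exp ?x - (\<Sum>k\<le>2. ?x ^ k / fact k)) / \<bar>s\<bar>\<^sup>2 \<le> exp (\<bar>s\<bar> * norm a) * norm a ^ 3 * \<bar>s\<bar>"
      using s by (subst divide_le_eq) auto
    also have "norm (exp ?x - (\<Sum>k\<le>2. ?x ^ k / fact k)) / \<bar>s\<bar>\<^sup>2 = norm ((exp ?x - (\<Sum>k\<le>2. ?x ^ k / fact k)) / (complex_of_real s)\<^sup>2)"
      by (simp add: norm_divide norm_power)
    also have "(exp ?x - (\<Sum>k\<le>2. ?x ^ k / fact k)) / (complex_of_real s)\<^sup>2 =
        (exp ?x - (1 - complex_of_real s * a)) / (complex_of_real s)\<^sup>2 - a\<^sup>2 / 2"
      using s by (simp add: numeral_2_eq_2 field_simps)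
    finally show "norm ((exp ?x - (1 - complex_of_real s * a)) / (complex_of_real s)\<^sup>2 - a\<^sup>2 / 2)
      \<le> exp (\<bar>s\<bar> * norm a) * norm a ^ 3 * \<bar>s\<bar>" .
  qed simp
  have "((\<lambda>s. exp (\<bar>s\<bar> * norm a) * norm a ^ 3 * \<bar>s\<bar>) \<longlongrightarrow> exp (\<bar>0\<bar> * norm a) * norm a ^ 3 * \<bar>0\<bar>) (at 0)"
    by (intro tendsto_intros)
  then show "((\<lambda>s. exp (\<bar>s\<bar> * norm a) * norm a ^ 3 * \<bar>s\<bar>) \<longlongrightarrow> 0) (at 0)" by simp
qed

text \<open>Three terms of the geometric series of \<open>1 / (v + t * u)\<close> with an exact
  remainder: the error after division by \<open>t\<^sup>2\<close> is an explicit expression whose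
  uniform limit can be computed.\<close>

lemma reciprocal_expansion:
  fixes g v u :: complex
  assumes "g = v + t * u" "g \<noteq> 0" "v \<noteq> 0"
  shows "1 / g = 1 / v - t * u / v\<^sup>2 + t\<^sup>2 * u\<^sup>2 / v ^ 3 - t ^ 3 * u ^ 3 / (v ^ 3 * g)"
proof -
  have "v ^ 3 * g * (1 / v - t * u / v\<^sup>2 + t\<^sup>2 * u\<^sup>2 / v ^ 3 - t ^ 3 * u ^ 3 / (v ^ 3 * g)) =
      v\<^sup>2 * g - v * g * (t * u) + g * (t\<^sup>2 * u\<^sup>2) - t ^ 3 * u ^ 3"
    using assms(2,3) by (simp add: distrib_left right_diff_distrib power2_eq_square power3_eq_cube)
  also have "\<dots> = v ^ 3"
    by (simp add: assms(1) algebra_simps power2_eq_square power3_eq_cube)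
  finally show ?thesis
    using assms(2,3) by (simp add: divide_eq_eq mult.commute)
qed

lemma Bseq_plus:
  fixes f g :: "nat \<Rightarrow> complex"
  assumes "Bseq f" "Bseq g"
  shows "Bseq (\<lambda>n. f n + g n)"
proof -
  obtain K L where "\<And>n. norm (f n) \<le> K" "\<And>n. norm (g n) \<le> L"
    using assms by (auto simp: Bseq_def)
  then show ?thesis by (intro BseqI'[of _ "K + L"]) (meson add_mono norm_triangle_le)
qed

lemma Bseq_cmult:
  fixes f :: "nat \<Rightarrow> complex"
  shows "Bseq f \<Longrightarrow> Bseq (\<lambda>n. c * f n)"
  by (intro Bseq_mult) (auto intro: BseqI'[of _ "norm c"])

section \<open>Moments and limit law along a single direction\<close>

locale line_generating_function =
  fixes M :: "nat \<Rightarrow> 'a measure" and X :: "nat \<Rightarrow> 'a \<Rightarrow> real"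
    and G :: "real \<Rightarrow> complex \<Rightarrow> complex" and a b :: "complex \<Rightarrow> complex" and R \<rho> :: real
  assumes prob: "\<And>n. prob_space (M n)"
    and rv: "\<And>n. X n \<in> borel_measurable (M n)"
    and radii: "1 < \<rho>" "\<rho> < R"
    and hol_a: "a holomorphic_on ball 0 R" and hol_b: "b holomorphic_on ball 0 R"
    and hol_G: "\<forall>\<^sub>F s in at 0. G s holomorphic_on ball 0 R"
    and taylor: "uniform_limit (cball 0 \<rho>)
      (\<lambda>s z. (G s z - (1 - z + of_real s * a z + (of_real s)\<^sup>2 * b z / 2)) / (of_real s)\<^sup>2) (\<lambda>z. 0) (at 0)"
    and series: "\<forall>\<^sub>F s in at 0. \<forall>z. norm z < 1 \<longrightarrow> G s z \<noteq> 0 \<and>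
      (\<lambda>n. (CLINT x|M n. exp (\<i> * complex_of_real (s * X n x))) * z ^ n) sums (1 / G s z)"
begin

definition "\<phi> n s = (CLINT x|M n. exp (\<i> * complex_of_real (s * X n x)))"

text \<open>The normalized second-order Taylor remainder in \<open>s\<close>, with \<open>a\<close>
  and \<open>b\<close> in the role of the first and second derivatives of \<open>G\<close> at
  \<open>s = 0\<close>. At \<open>s = 0\<close> the value is 0 by division by zero and is never
  relied on.\<close>

definition "\<eta> s z = (G s z - (1 - z + of_real s * a z + (of_real s)\<^sup>2 * b z / 2)) / (of_real s)\<^sup>2"

definition "first_quotient s z = (G s z - (1 - z)) / of_real s"

lemma eta_limit: "uniform_limit (cball 0 \<rho>) \<eta> (\<lambda>z. 0) (at 0)"
  using taylor unfolding \<eta>_def .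

lemma G_expand: "s \<noteq> 0 \<Longrightarrow> G s z = 1 - z + of_real s * a z + (of_real s)\<^sup>2 * b z / 2 + (of_real s)\<^sup>2 * \<eta> s z"
  by (simp add: \<eta>_def)

lemma first_quotient_expand: "s \<noteq> 0 \<Longrightarrow> first_quotient s z = a z + of_real s * (b z / 2 + \<eta> s z)"
  by (simp add: first_quotient_def G_expand field_simps power2_eq_square)

lemma bounded_coeffs:
  assumes "r \<le> \<rho>"
  shows "bounded (a ` cball 0 r)" "bounded (b ` cball 0 r)"
  using assms radii by (auto intro: bounded_holomorphic_cball hol_a hol_b)

lemma first_quotient_limit: "uniform_limit (cball 0 \<rho>) first_quotient a (at 0)"
proof -
  have b2: "bounded ((\<lambda>z. b z / 2) ` cball 0 \<rho>)"
    using bounded_scaling[OF bounded_coeffs(2)[OF order_refl], of "1/2"]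
    by (simp add: image_image scaleR_conv_of_real)
  have "uniform_limit (cball 0 \<rho>) (\<lambda>s z. b z / 2 + \<eta> s z) (\<lambda>z. b z / 2 + 0) (at 0)"
    by (intro uniform_limit_add uniform_limit_const eta_limit)
  then have "uniform_limit (cball 0 \<rho>) (\<lambda>s z. complex_of_real s * (b z / 2 + \<eta> s z)) (\<lambda>z. 0 * (b z / 2 + 0)) (at 0)"
    by (rule uniform_limit_mult_scalar) (use b2 in \<open>auto intro!: tendsto_eq_intros\<close>)
  then have "uniform_limit (cball 0 \<rho>) (\<lambda>s z. a z + complex_of_real s * (b z / 2 + \<eta> s z)) (\<lambda>z. a z + 0 * (b z / 2 + 0)) (at 0)"
    by (intro uniform_limit_add uniform_limit_const)
  then show ?thesis
    by (rule uniform_limit_cong[THEN iffD1, rotated 2])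
      (auto simp: first_quotient_expand eventually_at_filter)
qed


text \<open>Radius 1/2 keeps \<open>1 - z\<close> away from its zero, so all quotients have uniform
  limits. This is enough for moments, where the index of the coefficient is fixed.\<close>

lemma reciprocal_limit:
  "uniform_limit (cball 0 (1 / 2)) (\<lambda>s z. (1 / G s z - (1 / (1 - z)
      - of_real s * (a z / (1 - z)\<^sup>2) + (of_real s)\<^sup>2 * ((a z)\<^sup>2 / (1 - z) ^ 3 - b z / (1 - z)\<^sup>2 / 2)))
      / (of_real s)\<^sup>2) (\<lambda>z. 0) (at 0)"
proof -
  let ?C = "cball (0::complex) (1 / 2)"
  have sub: "?C \<subseteq> cball 0 \<rho>" using radii by auto
  have first_quotient: "uniform_limit ?C first_quotient a (at 0)" and \<eta>: "uniform_limit ?C \<eta> (\<lambda>z. 0) (at 0)"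
    using first_quotient_limit eta_limit uniform_limit_on_subset[OF _ sub] by blast+
  have bd: "bounded (a ` ?C)" "bounded (b ` ?C)" using bounded_coeffs[of "1 / 2"] radii by auto
  have w: "1 / 2 \<le> norm (1 - z)" if "z \<in> ?C" for z
    using norm_triangle_ineq2[of 1 z] that by simp
  have wp: "(1 / 2) ^ k \<le> norm ((1 - z) ^ k)" if "z \<in> ?C" for z k
    unfolding norm_power using w[OF that] by (intro power_mono) auto
  have bounded0: "bounded ((\<lambda>z. 0::complex) ` ?C)" by (auto simp: image_constant_conv)
  have bounded_w: "bounded ((\<lambda>z. (1 - z) ^ k) ` ?C)" for k
    by (intro compact_imp_bounded compact_continuous_image continuous_intros) auto
  have w_lim: "uniform_limit ?C (\<lambda>s z. (1 - z) ^ k) (\<lambda>z. (1 - z) ^ k) (at (0::real))" for k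
    by (rule uniform_limit_const)
  have s_lim: "((\<lambda>s::real. complex_of_real s) \<longlongrightarrow> 0) (at 0)"
    by (auto intro!: tendsto_eq_intros)
  have sA: "uniform_limit ?C (\<lambda>s z. complex_of_real s * first_quotient s z) (\<lambda>z. 0 * a z) (at 0)"
    by (rule uniform_limit_mult_scalar[OF first_quotient bd(1) s_lim])
  have "uniform_limit ?C (\<lambda>s z. (1 - z) ^ 1 + complex_of_real s * first_quotient s z) (\<lambda>z. (1 - z) ^ 1 + 0 * a z) (at 0)"
    by (intro uniform_limit_add w_lim sA)
  then have G: "uniform_limit ?C G (\<lambda>z. 1 - z) (at 0)"
    by (rule uniform_limit_cong[THEN iffD1, rotated 2]) (auto simp: first_quotient_def eventually_at_filter)
  have A2: "uniform_limit ?C (\<lambda>s z. first_quotient s z * first_quotient s z) (\<lambda>z. a z * a z) (at 0)"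
    by (intro uniform_lim_mult first_quotient bd)
  have bd2: "bounded ((\<lambda>z. a z * a z) ` ?C)"
    using radii by (intro bounded_holomorphic_cball[of _ R] holomorphic_intros hol_a) auto
  have bd3: "bounded ((\<lambda>z. a z * a z * a z) ` ?C)"
    using radii by (intro bounded_holomorphic_cball[of _ R] holomorphic_intros hol_a) auto
  \<comment> \<open>Three errors are treated separately: \<open>T1\<close> is the Taylor remainder
    of \<open>G\<close>, \<open>T2\<close> the replacement of the squared quotient by
    \<open>a z * a z\<close>, \<open>T3\<close> the exact remainder of
    \<open>reciprocal_expansion\<close>.\<close>
  have T1: "uniform_limit ?C (\<lambda>s z. \<eta> s z / (1 - z) ^ 2) (\<lambda>z. 0 / (1 - z) ^ 2) (at 0)"
    by (rule uniform_lim_divide[OF \<eta> w_lim bounded0, where b = "(1/2)^2"]) (use wp in auto)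
  have "uniform_limit ?C (\<lambda>s z. first_quotient s z * first_quotient s z - a z * a z) (\<lambda>z. a z * a z - a z * a z) (at 0)"
    by (intro uniform_limit_minus A2 uniform_limit_const)
  then have T2: "uniform_limit ?C (\<lambda>s z. (first_quotient s z * first_quotient s z - a z * a z) / (1 - z) ^ 3) (\<lambda>z. (a z * a z - a z * a z) / (1 - z) ^ 3) (at 0)"
    by (rule uniform_lim_divide[OF _ w_lim, where b = "(1/2)^3"]) (use wp bounded0 in auto)
  have "uniform_limit ?C (\<lambda>s z. first_quotient s z * first_quotient s z * first_quotient s z) (\<lambda>z. a z * a z * a z) (at 0)"
    by (intro uniform_lim_mult first_quotient A2 bd bd2)
  then have T3a: "uniform_limit ?C (\<lambda>s z. of_real s * (first_quotient s z * first_quotient s z * first_quotient s z)) (\<lambda>z. 0 * (a z * a z * a z)) (at 0)"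
    by (rule uniform_limit_mult_scalar[OF _ bd3 s_lim])
  have "uniform_limit ?C (\<lambda>s z. (1 - z) ^ 3 * G s z) (\<lambda>z. (1 - z) ^ 3 * (1 - z)) (at 0)"
    using bounded_w[of 1] by (intro uniform_lim_mult w_lim G bounded_w) simp
  \<comment> \<open>The limit of the denominator is \<open>(1 - z) ^ 4\<close>, whence the fourth
    power in the lower bound.\<close>
  then have T3: "uniform_limit ?C (\<lambda>s z. of_real s * (first_quotient s z * first_quotient s z * first_quotient s z) / ((1 - z) ^ 3 * G s z))
      (\<lambda>z. 0 * (a z * a z * a z) / ((1 - z) ^ 3 * (1 - z))) (at 0)"
    by (rule uniform_lim_divide[OF T3a, where b = "(1/2)^4"])
      (use wp[of _ 4] bounded0 in \<open>auto simp: norm_mult norm_power numeral_eq_Suc mult_ac\<close>)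
  have "uniform_limit ?C (\<lambda>s z. - (\<eta> s z / (1 - z) ^ 2) + (first_quotient s z * first_quotient s z - a z * a z) / (1 - z) ^ 3
      - of_real s * (first_quotient s z * first_quotient s z * first_quotient s z) / ((1 - z) ^ 3 * G s z))
    (\<lambda>z. - (0 / (1 - z) ^ 2) + (a z * a z - a z * a z) / (1 - z) ^ 3
      - 0 * (a z * a z * a z) / ((1 - z) ^ 3 * (1 - z))) (at 0)"
    by (intro uniform_limit_minus uniform_limit_add uniform_limit_uminus T1 T2 T3)
  then show ?thesis
  proof (rule uniform_limit_cong[THEN iffD1, rotated 2])
    show "\<forall>\<^sub>F s in at 0. \<forall>z\<in>?C. - (\<eta> s z / (1 - z) ^ 2) + (first_quotient s z * first_quotient s z - a z * a z) / (1 - z) ^ 3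
      - of_real s * (first_quotient s z * first_quotient s z * first_quotient s z) / ((1 - z) ^ 3 * G s z) =
      (1 / G s z - (1 / (1 - z)
      - of_real s * (a z / (1 - z)\<^sup>2) + (of_real s)\<^sup>2 * ((a z)\<^sup>2 / (1 - z) ^ 3 - b z / (1 - z)\<^sup>2 / 2)))
      / (of_real s)\<^sup>2"
      using series eventually_neq_at_within[of 0 0 UNIV]
    proof eventually_elim
      case (elim s)
      show ?case
      proof
        fix z assume z: "z \<in> ?C"
        define t where "t = complex_of_real s"
        define v where "v = 1 - z"
        have nz: "G s z \<noteq> 0" "v \<noteq> 0" "t \<noteq> 0"
          using elim z by (auto simp: v_def t_def)
        have gA: "G s z = v + t * first_quotient s z" using nz by (simp add: first_quotient_def v_def t_def)
        have gE: "t\<^sup>2 * \<eta> s z = t * first_quotient s z - t * a z - t\<^sup>2 * b z / 2"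
          using elim by (simp add: first_quotient_def G_expand t_def field_simps)
        have "(1 / G s z - (1 / v - t * (a z / v\<^sup>2) + t\<^sup>2 * ((a z)\<^sup>2 / v ^ 3 - b z / v\<^sup>2 / 2))) / t\<^sup>2 =
          - ((t\<^sup>2 * \<eta> s z) / v\<^sup>2) / t\<^sup>2 + (first_quotient s z * first_quotient s z - a z * a z) / v ^ 3 - t * (first_quotient s z * first_quotient s z * first_quotient s z) / (v ^ 3 * G s z)"
        proof -
          have "1 / G s z = 1 / v - t * first_quotient s z / v\<^sup>2 + t\<^sup>2 * (first_quotient s z)\<^sup>2 / v ^ 3 - t ^ 3 * (first_quotient s z) ^ 3 / (v ^ 3 * G s z)"
            by (rule reciprocal_expansion[OF gA nz(1,2)])
          then have "1 / G s z - (1 / v - t * (a z / v\<^sup>2) + t\<^sup>2 * ((a z)\<^sup>2 / v ^ 3 - b z / v\<^sup>2 / 2)) =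
            t\<^sup>2 * (- ((t\<^sup>2 * \<eta> s z) / v\<^sup>2) / t\<^sup>2 + (first_quotient s z * first_quotient s z - a z * a z) / v ^ 3 - t * (first_quotient s z * first_quotient s z * first_quotient s z) / (v ^ 3 * G s z))"
            unfolding gE using nz
            by (simp add: algebra_simps diff_divide_distrib add_divide_distrib power2_eq_square power3_eq_cube)
          then show ?thesis using nz by (simp add: divide_eq_eq mult.commute)
        qed
        then show "- (\<eta> s z / (1 - z) ^ 2) + (first_quotient s z * first_quotient s z - a z * a z) / (1 - z) ^ 3
            - of_real s * (first_quotient s z * first_quotient s z * first_quotient s z) / ((1 - z) ^ 3 * G s z) =
            (1 / G s z - (1 / (1 - z)
            - of_real s * (a z / (1 - z)\<^sup>2) + (of_real s)\<^sup>2 * ((a z)\<^sup>2 / (1 - z) ^ 3 - b z / (1 - z)\<^sup>2 / 2)))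
            / (of_real s)\<^sup>2"
          using nz by (simp add: t_def v_def)
      qed
    qed
  qed simp
qed


text \<open>Cauchy's estimate on the circle of radius 1/2 transfers the uniform limit to the
  \<open>n\<close>-th coefficient.\<close>

lemma char_expansion:
  assumes \<alpha>: "\<And>z. norm z < 1 \<Longrightarrow> (\<lambda>n. \<alpha> n * z ^ n) sums (a z / (1 - z)\<^sup>2)"
    and \<gamma>: "\<And>z. norm z < 1 \<Longrightarrow> (\<lambda>n. \<gamma> n * z ^ n) sums ((a z)\<^sup>2 / (1 - z) ^ 3)"
    and \<delta>: "\<And>z. norm z < 1 \<Longrightarrow> (\<lambda>n. \<delta> n * z ^ n) sums (b z / (1 - z)\<^sup>2)"
  shows "((\<lambda>s. (\<phi> n s - (1 - complex_of_real s * \<alpha> n + (complex_of_real s)\<^sup>2 * (\<gamma> n - \<delta> n / 2)))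
    / (complex_of_real s)\<^sup>2) \<longlongrightarrow> 0) (at 0)"
proof (rule tendstoI)
  fix e :: real assume e: "e > 0"
  define D where "D = (\<lambda>s z. (1 / G s z - (1 / (1 - z)
      - of_real s * (a z / (1 - z)\<^sup>2) + (of_real s)\<^sup>2 * ((a z)\<^sup>2 / (1 - z) ^ 3 - b z / (1 - z)\<^sup>2 / 2)))
      / (of_real s)\<^sup>2)"
  have "\<forall>\<^sub>F s in at 0. \<forall>z\<in>cball 0 (1 / 2). dist (D s z) 0 < e / 2 ^ (n + 1)"
    using uniform_limitD[OF reciprocal_limit, of "e / 2 ^ (n + 1)"] e by (simp add: D_def)
  with series eventually_neq_at_within[of 0 0 UNIV] show "\<forall>\<^sub>F s in at 0. dist ((\<phi> n s - (1 - complex_of_real s * \<alpha> n + (complex_of_real s)\<^sup>2 * (\<gamma> n - \<delta> n / 2)))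
      / (complex_of_real s)\<^sup>2) 0 < e"
  proof eventually_elim
    case (elim s)
    \<comment> \<open>The tolerance \<open>e / 2 ^ (n + 1)\<close> pays for the factor
      \<open>2 ^ n\<close> of the Cauchy estimate and still leaves \<open>e / 2\<close>.\<close>
    have "norm ((\<phi> n s - (1 - complex_of_real s * \<alpha> n + (complex_of_real s)\<^sup>2 * (\<gamma> n - \<delta> n / 2)))
        / (complex_of_real s)\<^sup>2) \<le> (e / 2 ^ (n + 1)) / (1 / 2) ^ n"
    proof (rule norm_coeff_le[where f = "D s" and r = 1])
      fix z :: complex assume z: "norm z < 1"
      have "(\<lambda>n. \<phi> n s * z ^ n) sums (1 / G s z)" using elim z by (simp add: \<phi>_def)
      moreover have "(\<lambda>n. z ^ n) sums (1 / (1 - z))" by (rule sums_inverse_power(1)[OF z])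
      ultimately have "(\<lambda>n. (\<phi> n s * z ^ n - (z ^ n - of_real s * (\<alpha> n * z ^ n) +
          (of_real s)\<^sup>2 * (\<gamma> n * z ^ n - \<delta> n * z ^ n / 2))) / (of_real s)\<^sup>2) sums D s z"
        unfolding D_def using \<alpha>[OF z] \<gamma>[OF z] \<delta>[OF z]
        by (intro sums_divide sums_diff sums_add sums_mult)
      then show "(\<lambda>n. (\<phi> n s - (1 - complex_of_real s * \<alpha> n + (complex_of_real s)\<^sup>2 * (\<gamma> n - \<delta> n / 2)))
        / (complex_of_real s)\<^sup>2 * z ^ n) sums D s z"
        using elim(2) by (simp add: algebra_simps diff_divide_distrib add_divide_distrib)
    next
      fix z :: complex assume "norm z = 1 / 2"
      then show "norm (D s z) \<le> e / 2 ^ (n + 1)" using elim by (auto intro: less_imp_le)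
    qed auto
    also have "\<dots> = e / 2" by (simp add: power_divide)
    also have "\<dots> < e" using e by simp
    finally show ?case by simp
  qed
qed

definition "drift = \<i> * a 1"

text \<open>The coefficient of \<open>n\<close> left over in
  \<open>- 2 * \<gamma> n + \<delta> n + (\<alpha> n)\<^sup>2\<close> once the terms in
  \<open>n\<^sup>2\<close> have cancelled.\<close>

definition "variance_rate = b 1 + 2 * a 1 * deriv a 1 - (a 1)\<^sup>2"

text \<open>In the variance the squared mean cancels the quadratic growth of the second moment. The
  error of \<open>\<alpha> n\<close> enters multiplied by about \<open>2 * n * a 1\<close>, so it
  must tend to 0; those of \<open>\<gamma> n\<close> and \<open>\<delta> n\<close> enter linearly
  and need only be bounded.\<close>

lemma
  shows square_integrable: "integrable (M n) (\<lambda>x. (X n x)\<^sup>2)"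
    and integrable_X: "integrable (M n) (X n)"
    and mean_bounded: "Bseq (\<lambda>n. complex_of_real (LINT x|M n. X n x) - of_nat n * drift)"
    and variance_limit: "(\<lambda>n. complex_of_real ((LINT x|M n. (X n x)\<^sup>2) - (LINT x|M n. X n x)\<^sup>2) / of_nat n)
      \<longlonglongrightarrow> variance_rate"
proof -
  have R1: "R > 1" using radii by simp
  have a2: "(\<lambda>z. (a z)\<^sup>2) holomorphic_on ball 0 R" by (intro holomorphic_intros hol_a)
  have da: "(a has_field_derivative deriv a 1) (at 1)"
    using R1 by (intro holomorphic_derivI[OF hol_a]) auto
  have da2: "deriv (\<lambda>z. (a z)\<^sup>2) 1 = 2 * a 1 * deriv a 1"
    by (rule DERIV_imp_deriv) (rule derivative_eq_intros da refl | simp)+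
  obtain \<alpha> where \<alpha>: "\<And>z. norm z < 1 \<Longrightarrow> (\<lambda>n. \<alpha> n * z ^ n) sums (a z / (1 - z)\<^sup>2)"
      "(\<lambda>n. \<alpha> n - of_nat (n + 1) * a 1) \<longlonglongrightarrow> - deriv a 1"
    using coeffs_double_pole[OF hol_a R1] by blast
  obtain \<delta> where \<delta>: "\<And>z. norm z < 1 \<Longrightarrow> (\<lambda>n. \<delta> n * z ^ n) sums (b z / (1 - z)\<^sup>2)"
      "(\<lambda>n. \<delta> n - of_nat (n + 1) * b 1) \<longlonglongrightarrow> - deriv b 1"
    using coeffs_double_pole[OF hol_b R1] by blast
  obtain \<gamma> where \<gamma>: "\<And>z. norm z < 1 \<Longrightarrow> (\<lambda>n. \<gamma> n * z ^ n) sums ((a z)\<^sup>2 / (1 - z) ^ 3)"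
      "Bseq (\<lambda>n. \<gamma> n - (of_nat ((n + 1) * (n + 2)) / 2 * (a 1)\<^sup>2 - of_nat (n + 1) * (2 * a 1 * deriv a 1)))"
    using coeffs_triple_pole[OF a2 R1] unfolding da2 by blast
  note mom = moments_from_char_expansion[OF prob rv char_expansion[OF \<alpha>(1) \<gamma>(1) \<delta>(1), unfolded \<phi>_def]]
  show "integrable (M n) (\<lambda>x. (X n x)\<^sup>2)" "integrable (M n) (X n)"
    using mom(1,2) by auto
  have "(\<lambda>n. \<i> * (\<alpha> n - of_nat (n + 1) * a 1 + a 1)) \<longlonglongrightarrow> \<i> * (- deriv a 1 + a 1)"
    by (intro tendsto_intros \<alpha>(2))
  then show "Bseq (\<lambda>n. complex_of_real (LINT x|M n. X n x) - of_nat n * drift)"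
    by (intro convergent_imp_Bseq convergentI) (simp add: mom(3) drift_def algebra_simps)
  \<comment> \<open>The constant \<open>deriv a 1\<close> is included so that this error tends to 0
    and is not merely bounded.\<close>
  define h where "h = (\<lambda>n. \<alpha> n - of_nat (n + 1) * a 1 + deriv a 1)"
  define k where "k = (\<lambda>n. \<delta> n - of_nat (n + 1) * b 1)"
  define g where "g = (\<lambda>n. \<gamma> n - (of_nat ((n + 1) * (n + 2)) / 2 * (a 1)\<^sup>2 - of_nat (n + 1) * (2 * a 1 * deriv a 1)))"
  have h: "h \<longlonglongrightarrow> 0"
    using tendsto_add[OF \<alpha>(2) tendsto_const[of "deriv a 1"]] by (simp add: h_def)
  have Bk: "Bseq k" unfolding k_def using \<delta>(2) by (intro convergent_imp_Bseq convergentI)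
  have Bg: "Bseq g" unfolding g_def by (rule \<gamma>(2))
  have Bh: "Bseq h" using h by (intro convergent_imp_Bseq convergentI)
  \<comment> \<open>Everything in the variance that carries no factor \<open>n\<close>; it is
    bounded.\<close>
  define r where "r = (\<lambda>n. variance_rate + 2 * a 1 * h n + (k n - 2 * g n - 2 * deriv a 1 * h n + (deriv a 1)\<^sup>2 + (h n)\<^sup>2))"
  have var_eq: "complex_of_real ((LINT x|M n. (X n x)\<^sup>2) - (LINT x|M n. X n x)\<^sup>2) =
      of_nat n * (variance_rate + 2 * a 1 * h n) + r n" for n
  proof -
    have \<alpha>n: "\<alpha> n = h n + of_nat (n + 1) * a 1 - deriv a 1" by (simp add: h_def)
    have \<delta>n: "\<delta> n = k n + of_nat (n + 1) * b 1" by (simp add: k_def)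
    have \<gamma>n: "\<gamma> n = g n + (of_nat ((n + 1) * (n + 2)) / 2 * (a 1)\<^sup>2 - of_nat (n + 1) * (2 * a 1 * deriv a 1))"
      by (simp add: g_def)
    have "complex_of_real ((LINT x|M n. (X n x)\<^sup>2) - (LINT x|M n. X n x)\<^sup>2) = - 2 * \<gamma> n + \<delta> n + (\<alpha> n)\<^sup>2"
      by (simp add: mom power_mult_distrib)
    also have "\<dots> = of_nat n * (variance_rate + 2 * a 1 * h n) + r n"
      unfolding \<alpha>n \<delta>n \<gamma>n r_def variance_rate_def
      by (simp add: algebra_simps power2_eq_square add_divide_distrib)
    finally show ?thesis .
  qed
  have "Bseq r"
  proof -
    have "Bseq (\<lambda>n. h n * h n)" by (intro Bseq_mult Bh)
    then have "Bseq (\<lambda>n. (variance_rate + (deriv a 1)\<^sup>2) + ((2 * a 1 - 2 * deriv a 1) * h n + (k n + (- 2 * g n + h n * h n))))"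
      by (intro Bseq_plus Bseq_cmult Bh Bk Bg) (auto intro: BseqI')
    then show ?thesis
      by (simp add: r_def algebra_simps power2_eq_square)
  qed
  have "eventually (\<lambda>n. complex_of_real ((LINT x|M n. (X n x)\<^sup>2) - (LINT x|M n. X n x)\<^sup>2) / of_nat n
     = variance_rate + 2 * a 1 * h n + r n / of_nat n) sequentially"
    by (rule eventually_mono[OF eventually_gt_at_top[of 0]], subst var_eq) (simp add: add_divide_distrib)
  moreover have "(\<lambda>n. variance_rate + 2 * a 1 * h n + r n / of_nat n) \<longlonglongrightarrow> variance_rate + 2 * a 1 * 0 + 0"
    by (intro tendsto_intros h Bseq_over_n \<open>Bseq r\<close>)
  ultimately show "(\<lambda>n. complex_of_real ((LINT x|M n. (X n x)\<^sup>2) - (LINT x|M n. X n x)\<^sup>2) / of_nat n)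
      \<longlonglongrightarrow> variance_rate"
    by (simp add: tendsto_cong)
qed

text \<open>\<open>G s z - (1 - z)\<close> equals \<open>of_real s * first_quotient s z\<close>, so
  on the disc of radius \<open>\<rho>\<close> it is at most \<open>K * \<bar>s\<bar>\<close>; this
  is the \<open>\<epsilon>\<close> passed to \<open>coeff_near_simple_pole\<close>.\<close>

lemma zero_near_one:
  obtains K K' where "K > 0" "\<forall>\<^sub>F s in at 0. \<exists>\<zeta>. norm (\<zeta> - 1) \<le> K * \<bar>s\<bar> \<and> G s \<zeta> = 0 \<and>
    (\<forall>n. norm (\<phi> n s * \<zeta> ^ (n + 1) - 1) \<le> K' * \<bar>s\<bar>)"
proof -
  obtain K0 where K0: "\<And>z. z \<in> cball 0 \<rho> \<Longrightarrow> norm (a z) \<le> K0"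
    using bounded_coeffs(1)[OF order_refl] unfolding bounded_iff by (metis image_eqI)
  \<comment> \<open>\<open>K0\<close> bounds the limit \<open>a\<close>; the extra 1 covers the
    distance of \<open>first_quotient\<close> from it for small \<open>s\<close>.\<close>
  define K where "K = \<bar>K0\<bar> + 1"
  have K: "K > 0" by (simp add: K_def)
  have lim: "((\<lambda>s::real. K * \<bar>s\<bar>) \<longlongrightarrow> 0) (at 0)"
    by (auto intro!: tendsto_eq_intros)
  have "\<forall>\<^sub>F s in at 0. K * \<bar>s\<bar> < (\<rho> - 1) / 8"
    by (rule order_tendstoD(2)[OF lim]) (use radii in simp)
  moreover have "\<forall>\<^sub>F s in at 0. \<forall>z\<in>cball 0 \<rho>. dist (first_quotient s z) (a z) < 1"
    using uniform_limitD[OF first_quotient_limit, of 1] by simp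
  ultimately have "\<forall>\<^sub>F s in at 0. \<exists>\<zeta>. norm (\<zeta> - 1) \<le> K * \<bar>s\<bar> \<and> G s \<zeta> = 0 \<and>
    (\<forall>n. norm (\<phi> n s * \<zeta> ^ (n + 1) - 1) \<le> (16 * \<rho> / (\<rho> - 1)\<^sup>2 * K) * \<bar>s\<bar>)"
    using series hol_G eventually_neq_at_within[of 0 0 UNIV]
  proof eventually_elim
    case (elim s)
    obtain \<zeta> where "norm (\<zeta> - 1) \<le> K * \<bar>s\<bar>" "G s \<zeta> = 0"
      "\<And>n. norm (\<phi> n s * \<zeta> ^ (n + 1) - 1) \<le> 16 * \<rho> / (\<rho> - 1)\<^sup>2 * (K * \<bar>s\<bar>)"
    proof (rule coeff_near_simple_pole[of "G s" R \<rho> "K * \<bar>s\<bar>" "\<lambda>n. \<phi> n s"])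
      fix z :: complex assume z: "norm z \<le> \<rho>"
      have "norm (first_quotient s z) \<le> norm (a z) + norm (first_quotient s z - a z)"
        using norm_triangle_ineq[of "a z" "first_quotient s z - a z"] by simp
      also have "\<dots> \<le> K"
      proof -
        have "norm (first_quotient s z - a z) < 1" using elim(2) z by (simp add: dist_norm)
        then show ?thesis using K0[of z] z by (simp add: K_def)
      qed
      finally show "norm (G s z - (1 - z)) \<le> K * \<bar>s\<bar>"
        using elim(5) by (simp add: first_quotient_def norm_divide divide_le_eq)
    qed (use elim radii K in \<open>auto simp: \<phi>_def\<close>)
    then show ?case by (auto simp: mult.assoc)
  qed
  then show thesis using that K by blast
qed


text \<open>With \<open>s = 1 / sqrt n\<close>, the product of the zero and
  \<open>exp (- s * a 1)\<close> is \<open>1 + s\<^sup>2 * c n\<close>, where \<open>c n\<close>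
  tends to half of \<open>variance_rate\<close>. Since \<open>s\<^sup>2 = 1 / n\<close>, its
  \<open>n\<close>-th power has an exponential limit, and the characteristic function is
  asymptotically the reciprocal of the power of the zero.\<close>

lemma char_limit:
  "(\<lambda>n. \<phi> n (1 / sqrt (real n)) * exp (complex_of_real (sqrt (real n)) * a 1)) \<longlonglongrightarrow> exp (- variance_rate / 2)"
proof -
  define s where "s = (\<lambda>n. 1 / sqrt (real n))"
  have s: "filterlim s (at 0) sequentially"
    unfolding s_def filterlim_at
    by (intro conjI, rule eventually_mono[OF eventually_gt_at_top[of 0]], simp, real_asymp)
  have s0: "(\<lambda>n. complex_of_real (s n)) \<longlonglongrightarrow> 0"
    using s by (auto simp: filterlim_at intro: tendsto_of_real[where a = 0, simplified])
  have s_pos: "\<forall>\<^sub>F n in sequentially. s n > 0 \<and> (complex_of_real (s n))\<^sup>2 = 1 / of_nat n"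
    using eventually_gt_at_top[of 0]
  proof eventually_elim
    case (elim n)
    have "(complex_of_real (s n))\<^sup>2 = complex_of_real ((s n)\<^sup>2)" by simp
    also have "(s n)\<^sup>2 = 1 / real n" using elim by (simp add: s_def power_divide)
    finally show ?case using elim by (simp add: s_def)
  qed
  obtain K K' where K: "K > 0" "\<forall>\<^sub>F s in at 0. \<exists>\<zeta>. norm (\<zeta> - 1) \<le> K * \<bar>s\<bar> \<and> G s \<zeta> = 0 \<and>
    (\<forall>n. norm (\<phi> n s * \<zeta> ^ (n + 1) - 1) \<le> K' * \<bar>s\<bar>)"
    by (rule zero_near_one)
  have "\<forall>\<^sub>F n in sequentially. \<exists>\<zeta>. norm (\<zeta> - 1) \<le> K * \<bar>s n\<bar> \<and> G (s n) \<zeta> = 0 \<and>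
    (\<forall>m. norm (\<phi> m (s n) * \<zeta> ^ (m + 1) - 1) \<le> K' * \<bar>s n\<bar>)"
    by (rule eventually_compose_filterlim[OF K(2) s])
  then obtain \<zeta> where \<zeta>: "\<forall>\<^sub>F n in sequentially. norm (\<zeta> n - 1) \<le> K * \<bar>s n\<bar> \<and> G (s n) (\<zeta> n) = 0 \<and>
    (\<forall>m. norm (\<phi> m (s n) * \<zeta> n ^ (m + 1) - 1) \<le> K' * \<bar>s n\<bar>)"
    unfolding eventually_ex by blast
  have bound0: "(\<lambda>n. c * \<bar>s n\<bar>) \<longlonglongrightarrow> 0" for c
    using s by (auto simp: filterlim_at intro!: tendsto_mult_right_zero tendsto_rabs_zero)
  have \<zeta>1: "\<zeta> \<longlonglongrightarrow> 1"
    by (rule LIM_zero_cancel, rule Lim_null_comparison[OF _ bound0[of K]])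
      (use \<zeta> in \<open>auto elim!: eventually_mono\<close>)
  have "(\<lambda>n. \<phi> n (s n) * \<zeta> n ^ (n + 1)) \<longlonglongrightarrow> 1"
    by (rule LIM_zero_cancel, rule Lim_null_comparison[OF _ bound0[of K']])
      (use \<zeta> in \<open>auto elim!: eventually_mono\<close>)
  from tendsto_divide[OF this \<zeta>1] have shifted: "(\<lambda>n. \<phi> n (s n) * \<zeta> n ^ (n + 1) / \<zeta> n) \<longlonglongrightarrow> 1" by simp
  have \<zeta>nz: "\<forall>\<^sub>F n in sequentially. \<zeta> n \<noteq> 0"
    using tendsto_imp_eventually_ne[OF \<zeta>1, of 0] by simp
  have \<phi>\<zeta>: "(\<lambda>n. \<phi> n (s n) * \<zeta> n ^ n) \<longlonglongrightarrow> 1"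
    by (rule Lim_transform_eventually[OF shifted]) (use \<zeta>nz in \<open>auto elim!: eventually_mono\<close>)
  have in_cball: "\<forall>\<^sub>F n in sequentially. \<zeta> n \<in> cball 0 \<rho>"
    using order_tendstoD(2)[OF tendsto_norm[OF \<zeta>1], of \<rho>] radii by (auto elim!: eventually_mono)
  have cont: "isCont a 1" "isCont b 1"
    using radii holomorphic_on_imp_continuous_on[OF hol_a] holomorphic_on_imp_continuous_on[OF hol_b]
    by (auto simp: continuous_on_eq_continuous_at)
  \<comment> \<open>Uniformity is what allows the evaluation at the moving point
    \<open>\<zeta> n\<close>.\<close>
  have null: "(\<lambda>n. F (s n) (\<zeta> n) - f (\<zeta> n)) \<longlonglongrightarrow> 0" if "uniform_limit (cball 0 \<rho>) F f (at 0)"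
    for F and f :: "complex \<Rightarrow> complex"
  proof (rule tendstoI)
    fix e :: real assume "e > 0"
    from eventually_compose_filterlim[OF uniform_limitD[OF that this] s]
    show "\<forall>\<^sub>F n in sequentially. dist (F (s n) (\<zeta> n) - f (\<zeta> n)) 0 < e"
      using in_cball by eventually_elim (auto simp: dist_norm)
  qed
  have a_lim: "(\<lambda>n. a (\<zeta> n)) \<longlonglongrightarrow> a 1" and b_lim: "(\<lambda>n. b (\<zeta> n)) \<longlonglongrightarrow> b 1"
    using isCont_tendsto_compose[OF _ \<zeta>1] cont by auto
  have \<eta>_lim: "(\<lambda>n. \<eta> (s n) (\<zeta> n)) \<longlonglongrightarrow> 0"
    using null[OF eta_limit] by simp
  define \<delta> where "\<delta> = (\<lambda>n. first_quotient (s n) (\<zeta> n))"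
  have \<delta>: "\<delta> \<longlonglongrightarrow> a 1"
    using tendsto_add[OF null[OF first_quotient_limit] a_lim] by (simp add: \<delta>_def)
  obtain h where h: "h holomorphic_on ball 0 R" "h 1 = deriv a 1" "\<And>z. a z = a 1 + (z - 1) * h z"
    using holomorphic_taylor_remainder[OF hol_a open_ball, of 1] radii by auto
  have "isCont h 1"
    using radii holomorphic_on_imp_continuous_on[OF h(1)] by (auto simp: continuous_on_eq_continuous_at)
  then have h_lim: "(\<lambda>n. h (\<zeta> n)) \<longlonglongrightarrow> deriv a 1"
    using isCont_tendsto_compose[OF _ \<zeta>1] h(2) by metis
  \<comment> \<open>At the zero, \<open>G s \<zeta> = 0\<close> reads
    \<open>\<zeta> - 1 = s * first_quotient s \<zeta>\<close>. Inserting the Taylor forms of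
    \<open>first_quotient\<close> and of \<open>a\<close> at 1 makes this the quadratic coefficient
    of \<open>\<zeta>\<close>.\<close>
  define \<kappa> where "\<kappa> = (\<lambda>n. \<delta> n * h (\<zeta> n) + b (\<zeta> n) / 2 + \<eta> (s n) (\<zeta> n))"
  have \<kappa>: "\<kappa> \<longlonglongrightarrow> a 1 * deriv a 1 + b 1 / 2 + 0"
    unfolding \<kappa>_def by (intro tendsto_intros \<delta> h_lim b_lim \<eta>_lim) simp
  have \<zeta>_eq: "\<forall>\<^sub>F n in sequentially. \<zeta> n = 1 + of_real (s n) * a 1 + (of_real (s n))\<^sup>2 * \<kappa> n"
    using \<zeta> s_pos
  proof eventually_elim
    case (elim n)
    have s: "s n \<noteq> 0" using elim by simp
    have 1: "\<zeta> n - 1 = of_real (s n) * \<delta> n"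
      using elim by (simp add: \<delta>_def first_quotient_def)
    have "\<delta> n = a (\<zeta> n) + of_real (s n) * (b (\<zeta> n) / 2 + \<eta> (s n) (\<zeta> n))"
      unfolding \<delta>_def by (rule first_quotient_expand[OF s])
    also have "a (\<zeta> n) = a 1 + of_real (s n) * \<delta> n * h (\<zeta> n)"
      by (subst h(3)) (simp add: 1)
    finally have "\<delta> n = a 1 + of_real (s n) * \<kappa> n" by (simp add: \<kappa>_def algebra_simps)
    then have "\<zeta> n - 1 = of_real (s n) * (a 1 + of_real (s n) * \<kappa> n)" using 1 by simp
    then show ?case by (simp add: algebra_simps power2_eq_square)
  qed
  define \<tau> where "\<tau> = (\<lambda>n. (exp (- complex_of_real (s n) * a 1) - (1 - complex_of_real (s n) * a 1)) / (complex_of_real (s n))\<^sup>2)"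
  have \<tau>: "\<tau> \<longlonglongrightarrow> (a 1)\<^sup>2 / 2"
    unfolding \<tau>_def by (rule filterlim_compose[OF exp_second_order s])
  \<comment> \<open>The coefficient in \<open>(1 + t * a 1 + t\<^sup>2 * \<kappa> n) * (1 - t * a 1
    + t\<^sup>2 * \<tau> n) = 1 + t\<^sup>2 * c n\<close>: the linear terms cancel.\<close>
  define c where "c = (\<lambda>n. \<kappa> n + \<tau> n - (a 1)\<^sup>2 + of_real (s n) * (a 1 * \<tau> n - a 1 * \<kappa> n) + (of_real (s n))\<^sup>2 * (\<kappa> n * \<tau> n))"
  have c: "c \<longlonglongrightarrow> variance_rate / 2"
  proof (rule tendsto_eq_rhs)
    show "c \<longlonglongrightarrow> (a 1 * deriv a 1 + b 1 / 2 + 0) + (a 1)\<^sup>2 / 2 - (a 1)\<^sup>2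
      + 0 * (a 1 * ((a 1)\<^sup>2 / 2) - a 1 * (a 1 * deriv a 1 + b 1 / 2 + 0))
      + 0\<^sup>2 * ((a 1 * deriv a 1 + b 1 / 2 + 0) * ((a 1)\<^sup>2 / 2))"
      unfolding c_def by (intro tendsto_intros \<kappa> \<tau> s0)
  qed (simp add: variance_rate_def field_simps)
  have eq: "\<forall>\<^sub>F n in sequentially. (1 + c n / of_nat n) ^ n = \<zeta> n ^ n * exp (- complex_of_real (sqrt (real n)) * a 1)"
    using \<zeta>_eq s_pos eventually_gt_at_top[of 0]
  proof eventually_elim
    case (elim n)
    define t where "t = complex_of_real (s n)"
    have \<zeta>t: "\<zeta> n = 1 + t * a 1 + t\<^sup>2 * \<kappa> n" using elim(1) by (simp add: t_def)
    have t: "t \<noteq> 0" "t\<^sup>2 = 1 / of_nat n" using elim by (auto simp: t_def)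
    have e: "exp (- t * a 1) = 1 - t * a 1 + t\<^sup>2 * \<tau> n"
    proof -
      have "\<tau> n = (exp (- t * a 1) - (1 - t * a 1)) / t\<^sup>2" by (simp only: \<tau>_def t_def)
      then have "t\<^sup>2 * \<tau> n = exp (- t * a 1) - (1 - t * a 1)" using t(1) by simp
      then show ?thesis by (simp add: algebra_simps)
    qed
    have "1 + t\<^sup>2 * c n = \<zeta> n * exp (- t * a 1)"
      unfolding e \<zeta>t c_def t_def[symmetric] by (simp add: algebra_simps power2_eq_square)
    moreover have "t\<^sup>2 * c n = c n / of_nat n" unfolding t(2) by simp
    ultimately have "1 + c n / of_nat n = \<zeta> n * exp (- t * a 1)" by (simp only:)
    then have pow: "(1 + c n / of_nat n) ^ n = \<zeta> n ^ n * exp (- t * a 1) ^ n"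
      by (simp only: power_mult_distrib)
    have e_pow: "exp (- t * a 1) ^ n = exp (of_nat n * (- t * a 1))"
      by (rule exp_of_nat_mult[symmetric])
    have nt: "of_nat n * (- t * a 1) = - complex_of_real (sqrt (real n)) * a 1"
    proof -
      have "sqrt (real n) = real n * s n" unfolding s_def by (simp add: real_div_sqrt)
      then have "complex_of_real (sqrt (real n)) = of_nat n * t"
        unfolding t_def by (simp only: of_real_mult of_real_of_nat_eq)
      then show ?thesis by simp
    qed
    show ?case unfolding pow e_pow nt ..
  qed
  have "(\<lambda>n. \<zeta> n ^ n * exp (- complex_of_real (sqrt (real n)) * a 1)) \<longlonglongrightarrow> exp (variance_rate / 2)"
    by (rule Lim_transform_eventually[OF power_exp_limit[OF c] eq])
  from tendsto_divide[OF \<phi>\<zeta> this]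
  have "(\<lambda>n. \<phi> n (s n) * \<zeta> n ^ n / (\<zeta> n ^ n * exp (- complex_of_real (sqrt (real n)) * a 1)))
      \<longlonglongrightarrow> 1 / exp (variance_rate / 2)"
    by simp
  also have "1 / exp (variance_rate / 2) = exp (- variance_rate / 2)"
    by (simp add: exp_minus inverse_eq_divide)
  finally have "(\<lambda>n. \<phi> n (s n) * \<zeta> n ^ n / (\<zeta> n ^ n * exp (- complex_of_real (sqrt (real n)) * a 1)))
      \<longlonglongrightarrow> exp (- variance_rate / 2)" .
  then show ?thesis
  proof (rule Lim_transform_eventually)
    show "\<forall>\<^sub>F n in sequentially. \<phi> n (s n) * \<zeta> n ^ n / (\<zeta> n ^ n * exp (- complex_of_real (sqrt (real n)) * a 1)) =
        \<phi> n (1 / sqrt (real n)) * exp (complex_of_real (sqrt (real n)) * a 1)"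
      using \<zeta>nz
    proof eventually_elim
      case (elim n)
      have "x * y / (y * exp (- w)) = x * exp w" if "y \<noteq> 0" for x y w :: complex
        using that by (simp add: exp_minus field_simps)
      from this[of "\<zeta> n ^ n" "\<phi> n (s n)" "complex_of_real (sqrt (real n)) * a 1"]
      show ?case using elim by (simp add: s_def)
    qed
  qed
qed

end

subsection \<open>The multivariate case\<close>

text \<open>The mean value inequality in the direction \<open>v\<close> reduces the second
  difference to a first difference of \<open>g'\<close> in the direction \<open>u\<close>, which the
  derivative \<open>H\<close> controls at \<open>p\<close>.\<close>

lemma second_difference_limit:
  fixes g :: "'p::real_normed_vector \<Rightarrow> 'q::real_normed_vector"
  assumes U: "open U" "p \<in> U"
    and g': "\<And>q. q \<in> U \<Longrightarrow> (g has_derivative blinfun_apply (g' q)) (at q)"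
    and g'': "(g' has_derivative blinfun_apply H) (at p)"
  shows "((\<lambda>t. (g (p + t *\<^sub>R u + t *\<^sub>R v) - g (p + t *\<^sub>R u) - g (p + t *\<^sub>R v) + g p) /\<^sub>R t\<^sup>2)
    \<longlongrightarrow> blinfun_apply (blinfun_apply H u) v) (at_right 0)"
proof (rule tendstoI)
  fix e :: real assume "e > 0"
  \<comment> \<open>Any positive bound for \<open>2 * (norm u + norm v) * norm v\<close> serves; the
    added ones keep it positive when \<open>u\<close> or \<open>v\<close> is 0.\<close>
  define K where "K = (2 * norm u + 3 * norm v + 1) * (norm v + 1)"
  have K: "K > 0" by (auto simp: K_def intro!: mult_pos_pos add_nonneg_pos)
  define e' where "e' = e / (2 * K)"
  have e': "e' > 0" using \<open>e > 0\<close> K by (simp add: e'_def)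
  obtain d1 where d1: "d1 > 0" "ball p d1 \<subseteq> U" using U open_contains_ball by blast
  obtain d2 where d2: "d2 > 0" "\<And>y. norm (y - p) < d2 \<Longrightarrow> norm (g' y - g' p - blinfun_apply H (y - p)) \<le> e' * norm (y - p)"
    using g'' e' unfolding has_derivative_at_alt by blast
  \<comment> \<open>For \<open>t < d\<close> the whole parallelogram spanned by
    \<open>t *\<^sub>R u\<close> and \<open>t *\<^sub>R v\<close> at \<open>p\<close> stays in
    \<open>U\<close> and in the range of \<open>d2\<close>.\<close>
  define d where "d = min d1 d2 / (norm u + norm v + 1)"
  have nn: "norm u + norm v + 1 > 0" by (intro add_nonneg_pos) auto
  have d: "d > 0" using d1 d2 nn by (simp add: d_def)
  show "\<forall>\<^sub>F t in at_right 0. dist ((g (p + t *\<^sub>R u + t *\<^sub>R v) - g (p + t *\<^sub>R u) - g (p + t *\<^sub>R v) + g p) /\<^sub>R t\<^sup>2)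
    (blinfun_apply (blinfun_apply H u) v) < e"
    unfolding eventually_at
  proof (intro exI[of _ d] conjI ballI impI d)
    fix t :: real assume "t \<in> {0<..}" "t \<noteq> 0 \<and> dist t 0 < d"
    then have t: "0 < t" "t < d" by auto
    have small: "norm (r *\<^sub>R u + s *\<^sub>R v) < min d1 d2" "norm (r *\<^sub>R u + s *\<^sub>R v) \<le> t * (norm u + norm v)"
      if "0 \<le> r" "r \<le> t" "0 \<le> s" "s \<le> t" for r s
    proof -
      have "norm (r *\<^sub>R u + s *\<^sub>R v) \<le> r * norm u + s * norm v"
        using norm_triangle_ineq[of "r *\<^sub>R u" "s *\<^sub>R v"] that by simp
      also have "\<dots> \<le> t * norm u + t * norm v"
        using that by (intro add_mono mult_right_mono) auto
      finally show le: "norm (r *\<^sub>R u + s *\<^sub>R v) \<le> t * (norm u + norm v)" by (simp add: distrib_left)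
      also have "\<dots> \<le> t * (norm u + norm v + 1)" using t by simp
      also have "\<dots> < d * (norm u + norm v + 1)" using t nn by simp
      also have "\<dots> = min d1 d2" using nn by (simp add: d_def)
      finally show "norm (r *\<^sub>R u + s *\<^sub>R v) < min d1 d2" .
    qed
    have der: "((\<lambda>s. g (p + (r *\<^sub>R u + s *\<^sub>R v))) has_vector_derivative g' (p + (r *\<^sub>R u + s *\<^sub>R v)) v) (at s within {0..t})"
      if "0 \<le> r" "r \<le> t" "s \<in> {0..t}" for r s
    proof -
      have "p + (r *\<^sub>R u + s *\<^sub>R v) \<in> U"
      proof (rule subsetD[OF d1(2)])
        have "dist p (p + w) = norm w" for w by (simp add: dist_norm)
        then show "p + (r *\<^sub>R u + s *\<^sub>R v) \<in> ball p d1"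
          using small(1)[of r s] that by simp
      qed
      then have "(g has_derivative blinfun_apply (g' (p + (r *\<^sub>R u + s *\<^sub>R v)))) (at (p + (r *\<^sub>R u + s *\<^sub>R v)))"
        by (rule g')
      moreover have "((\<lambda>s. p + (r *\<^sub>R u + s *\<^sub>R v)) has_derivative (\<lambda>s. s *\<^sub>R v)) (at s within {0..t})"
        by (auto intro!: derivative_eq_intros)
      ultimately have "((\<lambda>s. g (p + (r *\<^sub>R u + s *\<^sub>R v))) has_derivative (\<lambda>x. g' (p + (r *\<^sub>R u + s *\<^sub>R v)) (x *\<^sub>R v))) (at s within {0..t})"
        by (rule has_derivative_compose[rotated])
      then show ?thesis by (simp add: has_vector_derivative_def blinfun.scaleR_right)
    qed
    define f where "f = (\<lambda>s. g (p + (t *\<^sub>R u + s *\<^sub>R v)) - g (p + (0 *\<^sub>R u + s *\<^sub>R v)) - (t * s) *\<^sub>R blinfun_apply (blinfun_apply H u) v)"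
    define f' where "f' = (\<lambda>s. g' (p + (t *\<^sub>R u + s *\<^sub>R v)) v - g' (p + (0 *\<^sub>R u + s *\<^sub>R v)) v - t *\<^sub>R blinfun_apply (blinfun_apply H u) v)"
    have "norm (f t - f 0) \<le> (e' * (2 * t * (norm u + norm v)) * norm v) * norm (t - 0)"
    proof (rule differentiable_bound[where S = "{0..t}" and f' = "\<lambda>s x. x *\<^sub>R f' s"])
      fix s assume s: "s \<in> {0..t}"
      have "(f has_vector_derivative f' s) (at s within {0..t})"
        unfolding f_def f'_def using t s
        by (intro has_vector_derivative_diff der) (auto intro!: derivative_eq_intros simp: has_vector_derivative_def)
      then show "(f has_derivative (\<lambda>x. x *\<^sub>R f' s)) (at s within {0..t})"
        by (simp add: has_vector_derivative_def)
      have rem: "norm (g' (p + (r *\<^sub>R u + s *\<^sub>R v)) - g' p - blinfun_apply H (r *\<^sub>R u + s *\<^sub>R v)) \<le> e' * (t * (norm u + norm v))"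
        if "0 \<le> r" "r \<le> t" for r
        using d2(2)[of "p + (r *\<^sub>R u + s *\<^sub>R v)"] small[of r s] s that e'
        by (auto intro: order_trans mult_left_mono)
      \<comment> \<open>By linearity of \<open>H\<close> the two first-order terms differ by
        \<open>t *\<^sub>R H u\<close>, so only the two remainders of \<open>g'\<close> are
        left.\<close>
      have "f' s = blinfun_apply ((g' (p + (t *\<^sub>R u + s *\<^sub>R v)) - g' p - blinfun_apply H (t *\<^sub>R u + s *\<^sub>R v))
          - (g' (p + (0 *\<^sub>R u + s *\<^sub>R v)) - g' p - blinfun_apply H (0 *\<^sub>R u + s *\<^sub>R v))) v"
        by (simp add: f'_def blinfun.diff_left blinfun.add_left blinfun.add_right blinfun.scaleR_right blinfun.scaleR_left)
      also have "norm \<dots> \<le> norm ((g' (p + (t *\<^sub>R u + s *\<^sub>R v)) - g' p - blinfun_apply H (t *\<^sub>R u + s *\<^sub>R v))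
          - (g' (p + (0 *\<^sub>R u + s *\<^sub>R v)) - g' p - blinfun_apply H (0 *\<^sub>R u + s *\<^sub>R v))) * norm v"
        by (rule norm_blinfun)
      also have "\<dots> \<le> (e' * (t * (norm u + norm v)) + e' * (t * (norm u + norm v))) * norm v"
        using t by (intro mult_right_mono order_trans[OF norm_triangle_ineq4] add_mono rem) auto
      finally have "norm (f' s) \<le> e' * (2 * t * (norm u + norm v)) * norm v"
        by (simp add: algebra_simps)
      then show "onorm (\<lambda>x. x *\<^sub>R f' s) \<le> e' * (2 * t * (norm u + norm v)) * norm v"
        by (simp add: onorm_scaleR_left onorm_id)
    qed (use t in auto)
    also have "(e' * (2 * t * (norm u + norm v)) * norm v) * norm (t - 0) = t\<^sup>2 * (e' * (2 * (norm u + norm v) * norm v))"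
      using t by (simp add: power2_eq_square)
    also have "f t - f 0 = (g (p + t *\<^sub>R u + t *\<^sub>R v) - g (p + t *\<^sub>R u) - g (p + t *\<^sub>R v) + g p) - t\<^sup>2 *\<^sub>R blinfun_apply (blinfun_apply H u) v"
      by (simp add: f_def power2_eq_square add.assoc)
    finally have main: "norm ((g (p + t *\<^sub>R u + t *\<^sub>R v) - g (p + t *\<^sub>R u) - g (p + t *\<^sub>R v) + g p) - t\<^sup>2 *\<^sub>R blinfun_apply (blinfun_apply H u) v)
      \<le> t\<^sup>2 * (e' * (2 * (norm u + norm v) * norm v))" .
    have "2 * (norm u + norm v) * norm v \<le> K"
      unfolding K_def by (intro mult_mono) (auto intro: add_nonneg_nonneg)
    then have "e' * (2 * (norm u + norm v) * norm v) \<le> e' * K"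
      using e' by (intro mult_left_mono) auto
    also have "\<dots> = e / 2" using K by (simp add: e'_def)
    also have "\<dots> < e" using \<open>e > 0\<close> by simp
    finally have lt: "e' * (2 * (norm u + norm v) * norm v) < e" .
    have "dist ((g (p + t *\<^sub>R u + t *\<^sub>R v) - g (p + t *\<^sub>R u) - g (p + t *\<^sub>R v) + g p) /\<^sub>R t\<^sup>2) (blinfun_apply (blinfun_apply H u) v)
      = norm ((g (p + t *\<^sub>R u + t *\<^sub>R v) - g (p + t *\<^sub>R u) - g (p + t *\<^sub>R v) + g p) - t\<^sup>2 *\<^sub>R blinfun_apply (blinfun_apply H u) v) / t\<^sup>2"
    proof -
      have "norm (D /\<^sub>R t\<^sup>2 - E) = norm (D - t\<^sup>2 *\<^sub>R E) / t\<^sup>2" for D E :: 'q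
      proof -
        have "D /\<^sub>R t\<^sup>2 - E = (D - t\<^sup>2 *\<^sub>R E) /\<^sub>R t\<^sup>2"
          using t by (simp add: scaleR_diff_right)
        then show ?thesis by (simp add: divide_inverse_commute)
      qed
      then show ?thesis by (simp add: dist_norm)
    qed
    also have "\<dots> \<le> e' * (2 * (norm u + norm v) * norm v)"
      using main t by (simp add: pos_divide_le_eq mult.commute)
    finally show "dist ((g (p + t *\<^sub>R u + t *\<^sub>R v) - g (p + t *\<^sub>R u) - g (p + t *\<^sub>R v) + g p) /\<^sub>R t\<^sup>2)
      (blinfun_apply (blinfun_apply H u) v) < e"
      using lt by linarith
  qed
qed

text \<open>Both sides are limits of the same symmetric second difference.\<close>

lemma second_derivative_symmetric:
  fixes g :: "'p::real_normed_vector \<Rightarrow> 'q::real_normed_vector"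
  assumes U: "open U" "p \<in> U"
    and g': "\<And>q. q \<in> U \<Longrightarrow> (g has_derivative blinfun_apply (g' q)) (at q)"
    and g'': "(g' has_derivative blinfun_apply H) (at p)"
  shows "blinfun_apply (blinfun_apply H u) v = blinfun_apply (blinfun_apply H v) u"
proof (rule tendsto_unique[OF trivial_limit_at_right_real])
  show "((\<lambda>t. (g (p + t *\<^sub>R u + t *\<^sub>R v) - g (p + t *\<^sub>R u) - g (p + t *\<^sub>R v) + g p) /\<^sub>R t\<^sup>2)
    \<longlongrightarrow> blinfun_apply (blinfun_apply H u) v) (at_right 0)"
    using assms by (rule second_difference_limit)
  have "((\<lambda>t. (g (p + t *\<^sub>R v + t *\<^sub>R u) - g (p + t *\<^sub>R v) - g (p + t *\<^sub>R u) + g p) /\<^sub>R t\<^sup>2)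
    \<longlongrightarrow> blinfun_apply (blinfun_apply H v) u) (at_right 0)"
    using assms by (rule second_difference_limit)
  then show "((\<lambda>t. (g (p + t *\<^sub>R u + t *\<^sub>R v) - g (p + t *\<^sub>R u) - g (p + t *\<^sub>R v) + g p) /\<^sub>R t\<^sup>2)
    \<longlongrightarrow> blinfun_apply (blinfun_apply H v) u) (at_right 0)"
    by (simp add: algebra_simps)
qed

text \<open>The mean value inequality is applied twice, to \<open>h1\<close> and then to
  \<open>h\<close>. The bound depends only on the oscillation \<open>e\<close>, which makes it
  uniform in any further parameter.\<close>

lemma second_order_taylor_bound:
  fixes h :: "real \<Rightarrow> 'b::real_normed_vector"
  assumes h: "\<And>s. \<bar>s\<bar> < d \<Longrightarrow> (h has_vector_derivative h1 s) (at s)"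
    and h1: "\<And>s. \<bar>s\<bar> < d \<Longrightarrow> (h1 has_vector_derivative h2 s) (at s)"
    and e: "\<And>s. \<bar>s\<bar> < d \<Longrightarrow> norm (h2 s - B) \<le> e" and t: "\<bar>t\<bar> < d"
  shows "norm (h t - (h 0 + t *\<^sub>R h1 0 + (t\<^sup>2 / 2) *\<^sub>R B)) \<le> e * t\<^sup>2"
proof -
  have e0: "0 \<le> e" using e[OF t] norm_ge_zero order_trans by blast
  have 1: "norm (h1 s - (h1 0 + s *\<^sub>R B)) \<le> e * \<bar>s\<bar>" if "\<bar>s\<bar> < d" for s
  proof -
    have "norm ((h1 s - s *\<^sub>R B) - (h1 0 - 0 *\<^sub>R B)) \<le> e * norm (s - 0)"
    proof (rule differentiable_bound[where S = "{- \<bar>s\<bar>..\<bar>s\<bar>}" and f' = "\<lambda>x y. y *\<^sub>R (h2 x - B)"])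
      fix x assume x: "x \<in> {- \<bar>s\<bar>..\<bar>s\<bar>}"
      then have xd: "\<bar>x\<bar> < d" using that by auto
      have "((\<lambda>s. h1 s - s *\<^sub>R B) has_vector_derivative h2 x - B) (at x)"
        by (intro has_vector_derivative_diff h1[OF xd])
          (auto intro!: derivative_eq_intros simp: has_vector_derivative_def)
      then show "((\<lambda>s. h1 s - s *\<^sub>R B) has_derivative (\<lambda>y. y *\<^sub>R (h2 x - B))) (at x within {- \<bar>s\<bar>..\<bar>s\<bar>})"
        by (simp add: has_vector_derivative_def has_derivative_at_withinI)
      show "onorm (\<lambda>y. y *\<^sub>R (h2 x - B)) \<le> e"
        using e[OF xd] by (simp add: onorm_scaleR_left onorm_id)
    qed auto
    then show ?thesis by (simp add: algebra_simps)
  qed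
  have "norm ((h t - t *\<^sub>R h1 0 - (t\<^sup>2 / 2) *\<^sub>R B) - (h 0 - 0 *\<^sub>R h1 0 - (0\<^sup>2 / 2) *\<^sub>R B)) \<le> (e * \<bar>t\<bar>) * norm (t - 0)"
  proof (rule differentiable_bound[where S = "{- \<bar>t\<bar>..\<bar>t\<bar>}" and f' = "\<lambda>x y. y *\<^sub>R (h1 x - h1 0 - x *\<^sub>R B)"
        and f = "\<lambda>s. h s - s *\<^sub>R h1 0 - (s\<^sup>2 / 2) *\<^sub>R B"])
    fix x assume x: "x \<in> {- \<bar>t\<bar>..\<bar>t\<bar>}"
    then have xd: "\<bar>x\<bar> < d" using t by auto
    have "((\<lambda>s. h s - s *\<^sub>R h1 0 - (s\<^sup>2 / 2) *\<^sub>R B) has_vector_derivative h1 x - h1 0 - x *\<^sub>R B) (at x)"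
      by (intro has_vector_derivative_diff h[OF xd])
        (auto intro!: derivative_eq_intros simp: has_vector_derivative_def)
    then show "((\<lambda>s. h s - s *\<^sub>R h1 0 - (s\<^sup>2 / 2) *\<^sub>R B) has_derivative (\<lambda>y. y *\<^sub>R (h1 x - h1 0 - x *\<^sub>R B))) (at x within {- \<bar>t\<bar>..\<bar>t\<bar>})"
      by (simp add: has_vector_derivative_def has_derivative_at_withinI)
    have "e * \<bar>x\<bar> \<le> e * \<bar>t\<bar>" using x e0 by (intro mult_left_mono) auto
    then show "onorm (\<lambda>y. y *\<^sub>R (h1 x - h1 0 - x *\<^sub>R B)) \<le> e * \<bar>t\<bar>"
      using 1[OF xd] by (simp add: onorm_scaleR_left onorm_id diff_diff_eq)
  qed auto
  then show ?thesis by (simp add: algebra_simps power2_eq_square)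
qed

lemma linear_axis_sum:
  fixes f :: "real ^ 'd \<Rightarrow> 'b::real_vector"
  assumes "linear f"
  shows "f v = (\<Sum>i\<in>UNIV. v $ i *\<^sub>R f (axis i 1))"
proof -
  have "v = (\<Sum>i\<in>UNIV. v $ i *\<^sub>R axis i 1)"
    by (simp add: vec_eq_iff axis_def if_distrib cong: if_cong)
  then have "f v = f (\<Sum>i\<in>UNIV. v $ i *\<^sub>R axis i 1)" by (rule arg_cong)
  also have "\<dots> = (\<Sum>i\<in>UNIV. v $ i *\<^sub>R f (axis i 1))"
    by (simp only: linear_sum[OF assms] linear_scale[OF assms])
  finally show ?thesis .
qed

lemma taylor_quotient:
  fixes t :: complex
  assumes "t \<noteq> 0"
  shows "b / 2 + (x - (w + t * a + t\<^sup>2 * b / 2)) / t\<^sup>2 = (x - (w + t * a)) / t\<^sup>2"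
    and "a + t * (b / 2 + (x - (w + t * a + t\<^sup>2 * b / 2)) / t\<^sup>2) = (x - w) / t"
proof -
  have "x - (w + t * a + t\<^sup>2 * b / 2) = (x - (w + t * a)) - t\<^sup>2 * (b / 2)" by simp
  then show 1: "b / 2 + (x - (w + t * a + t\<^sup>2 * b / 2)) / t\<^sup>2 = (x - (w + t * a)) / t\<^sup>2"
    using assms by (simp only: diff_divide_distrib[of "x - (w + t * a)"]) simp
  have "a + t * ((x - (w + t * a)) / t\<^sup>2) = (x - w) / t"
    using assms by (simp add: field_simps power2_eq_square)
  then show "a + t * (b / 2 + (x - (w + t * a + t\<^sup>2 * b / 2)) / t\<^sup>2) = (x - w) / t"
    by (simp only: 1)
qed

lemma holomorphic_on_smaller_ball:
  assumes "f holomorphic_on ball 0 R" "r < R"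
  shows "f holomorphic_on ball 0 r" "continuous_on (cball 0 r) f"
  using assms(2)
  by (auto intro!: holomorphic_on_imp_continuous_on holomorphic_on_subset[OF assms(1)])

lemma has_vector_derivative_at_0_complex:
  fixes F :: "real \<Rightarrow> complex"
  assumes "((\<lambda>s. (F s - F 0) / of_real s) \<longlongrightarrow> D) (at 0)"
  shows "(F has_vector_derivative D) (at 0)"
proof -
  have "((\<lambda>s. Re ((F s - F 0) / of_real s)) \<longlongrightarrow> Re D) (at 0)"
    "((\<lambda>s. Im ((F s - F 0) / of_real s)) \<longlongrightarrow> Im D) (at 0)"
    using tendsto_Re[OF assms] tendsto_Im[OF assms] by blast+
  then show ?thesis
    by (simp add: has_vector_derivative_complex_iff has_field_derivative_iff)
qed

section \<open>Restriction of the generating function to lines through the origin\<close>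

locale char_generating_function =
  fixes M :: "nat \<Rightarrow> 'a measure" and Y :: "nat \<Rightarrow> 'a \<Rightarrow> real ^ 'd"
    and U :: "((real ^ 'd) \<times> complex) set" and g :: "(real ^ 'd) \<times> complex \<Rightarrow> complex"
    and g' :: "(real ^ 'd) \<times> complex \<Rightarrow> (((real ^ 'd) \<times> complex) \<Rightarrow>\<^sub>L complex)"
    and g'' :: "(real ^ 'd) \<times> complex \<Rightarrow> (((real ^ 'd) \<times> complex) \<Rightarrow>\<^sub>L ((real ^ 'd) \<times> complex) \<Rightarrow>\<^sub>L complex)"
    and \<epsilon> :: real
  assumes prob: "\<And>n. prob_space (M n)"
    and rv: "\<And>n. Y n \<in> borel_measurable (M n)"
    and U_open: "open U"
    and \<epsilon>: "\<epsilon> > 0" and box: "\<And>x z. norm x < \<epsilon> \<Longrightarrow> norm z < 1 + \<epsilon> \<Longrightarrow> (x, z) \<in> U"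
    and hol: "\<And>x. (\<lambda>z. g (x, z)) holomorphic_on {z. (x, z) \<in> U}"
    and g': "\<And>p. p \<in> U \<Longrightarrow> (g has_derivative blinfun_apply (g' p)) (at p)"
    and g'': "\<And>p. p \<in> U \<Longrightarrow> (g' has_derivative blinfun_apply (g'' p)) (at p)"
    and cont: "continuous_on U g''"
    and series: "\<And>x z. (x, z) \<in> U \<Longrightarrow> norm z < 1 \<Longrightarrow>
      g (x, z) \<noteq> 0 \<and> (\<lambda>n. char_fun (M n) (Y n) x * z ^ n) sums (1 / g (x, z))"
begin

text \<open>Derivatives are taken in directions \<open>(v, 0)\<close>, so \<open>z\<close> is held
  fixed. Holomorphy in \<open>z\<close> is not visible from these real derivatives and is proved
  below.\<close>

definition "a v z = blinfun_apply (g' (0, z)) (v, 0)"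

definition "hessian v w = blinfun_apply (blinfun_apply (g'' (0, 1)) (v, 0)) (w, 0)"

definition "b v z = blinfun_apply (blinfun_apply (g'' (0, z)) (v, 0)) (v, 0)"

lemma half_lt: "1 + \<epsilon> / 2 < 1 + \<epsilon>"
  using \<epsilon> by linarith

lemma g_holomorphic: "norm x < \<epsilon> \<Longrightarrow> (\<lambda>z. g (x, z)) holomorphic_on ball 0 (1 + \<epsilon>)"
  using box by (intro holomorphic_on_subset[OF hol]) auto

text \<open>At \<open>x = 0\<close> all characteristic functions are 1, so inside the unit disc the
  series is geometric; the identity theorem carries the formula beyond the circle.\<close>

lemma g_0:
  assumes "norm z < 1 + \<epsilon>"
  shows "g (0, z) = 1 - z"
proof (rule analytic_continuation_open[of "ball 0 1" "ball 0 (1 + \<epsilon>)" "\<lambda>z. g (0, z)" "\<lambda>z. 1 - z"])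
  fix z :: complex assume "z \<in> ball 0 1"
  then have z: "norm z < 1" by simp
  have c: "char_fun (M n) (Y n) 0 = 1" for n
    using prob_space.prob_space[OF prob, of n] by (simp add: char_fun_def)
  have "g (0, z) \<noteq> 0" "(\<lambda>n. z ^ n) sums (1 / g (0, z))"
    using series[of 0 z] box[of 0 z] \<epsilon> z by (auto simp: c)
  moreover have "(\<lambda>n. z ^ n) sums (1 / (1 - z))" by (rule sums_inverse_power(1)[OF z])
  ultimately have "1 / g (0, z) = 1 / (1 - z)" using sums_unique2 by blast
  then show "g (0, z) = 1 - z" using \<open>g (0, z) \<noteq> 0\<close> z by auto
qed (use \<epsilon> assms in \<open>auto intro!: g_holomorphic holomorphic_intros\<close>)

lemma g_line_derivatives:
  assumes "(x + s *\<^sub>R v, z) \<in> U"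
  shows "((\<lambda>s. g (x + s *\<^sub>R v, z)) has_vector_derivative blinfun_apply (g' (x + s *\<^sub>R v, z)) (v, 0)) (at s)"
    and "((\<lambda>s. blinfun_apply (g' (x + s *\<^sub>R v, z)) (w, 0)) has_vector_derivative
      blinfun_apply (blinfun_apply (g'' (x + s *\<^sub>R v, z)) (v, 0)) (w, 0)) (at s)"
proof -
  have path: "((\<lambda>s. (x + s *\<^sub>R v, z)) has_derivative (\<lambda>s. (s *\<^sub>R v, 0))) (at s)"
    by (auto intro!: derivative_eq_intros)
  have sc: "(s *\<^sub>R v, 0) = s *\<^sub>R (v, 0::complex)" for s by simp
  show "((\<lambda>s. g (x + s *\<^sub>R v, z)) has_vector_derivative blinfun_apply (g' (x + s *\<^sub>R v, z)) (v, 0)) (at s)"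
    using has_derivative_compose[OF path g'[OF assms]]
    unfolding has_vector_derivative_def sc blinfun.scaleR_right .
  have "((\<lambda>s. g' (x + s *\<^sub>R v, z)) has_derivative (\<lambda>t. t *\<^sub>R blinfun_apply (g'' (x + s *\<^sub>R v, z)) (v, 0))) (at s)"
    using has_derivative_compose[OF path g''[OF assms]] unfolding sc blinfun.scaleR_right .
  then have "((\<lambda>s. blinfun_apply (g' (x + s *\<^sub>R v, z)) (w, 0)) has_derivative
      (\<lambda>t. blinfun_apply (t *\<^sub>R blinfun_apply (g'' (x + s *\<^sub>R v, z)) (v, 0)) (w, 0))) (at s)"
    by (rule bounded_linear.has_derivative[OF blinfun.bounded_linear_left])
  then show "((\<lambda>s. blinfun_apply (g' (x + s *\<^sub>R v, z)) (w, 0)) has_vector_derivative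
      blinfun_apply (blinfun_apply (g'' (x + s *\<^sub>R v, z)) (v, 0)) (w, 0)) (at s)"
    unfolding has_vector_derivative_def blinfun.scaleR_left .
qed

text \<open>Here the continuity of the second derivative enters: on a compact set of pairs
  \<open>(s, z)\<close> it is uniform, so the second derivative at \<open>s\<close> is close to the
  one at 0 for all \<open>z\<close> simultaneously.\<close>

lemma taylor_line:
  "uniform_limit (cball 0 (1 + \<epsilon> / 2))
    (\<lambda>s z. (g (s *\<^sub>R v, z) - (1 - z + of_real s * a v z + (of_real s)\<^sup>2 * b v z / 2)) / (of_real s)\<^sup>2)
    (\<lambda>z. 0) (at 0)"
proof (rule uniform_limitI)
  fix e :: real assume e: "e > 0"
  \<comment> \<open>The added 1 avoids division by zero for \<open>v = 0\<close>, the factor 2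
    leaves room to work with closed intervals.\<close>
  define d0 where "d0 = \<epsilon> / (2 * (norm v + 1))"
  have nv: "norm v + 1 > 0" by (intro add_nonneg_pos) auto
  have d0: "d0 > 0" using \<epsilon> nv by (simp add: d0_def)
  have small: "norm (s *\<^sub>R v) < \<epsilon>" if "\<bar>s\<bar> \<le> d0" for s
  proof -
    have "norm (s *\<^sub>R v) \<le> d0 * norm v" using that by (simp add: mult_right_mono)
    also have "\<dots> < d0 * (2 * (norm v + 1))" using d0 nv by (intro mult_strict_left_mono) auto
    also have "\<dots> = \<epsilon>" using nv by (simp add: d0_def)
    finally show ?thesis .
  qed
  define B where "B = (\<lambda>(s, z). blinfun_apply (blinfun_apply (g'' (s *\<^sub>R v, z)) (v, 0)) (v, 0))"
  have inU: "(s *\<^sub>R v, z) \<in> U" if "\<bar>s\<bar> \<le> d0" "z \<in> cball 0 (1 + \<epsilon> / 2)" for s z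
    using small[OF that(1)] that(2) \<epsilon> by (intro box) auto
  have "continuous_on ({- d0..d0} \<times> cball 0 (1 + \<epsilon> / 2)) B"
    unfolding B_def case_prod_beta
    by (intro continuous_intros continuous_on_compose2[OF cont]) (use inU in auto)
  moreover have "compact ({- d0..d0} \<times> cball (0::complex) (1 + \<epsilon> / 2))"
    by (intro compact_Times) auto
  ultimately have "uniformly_continuous_on ({- d0..d0} \<times> cball 0 (1 + \<epsilon> / 2)) B"
    by (rule compact_uniformly_continuous)
  then obtain d1 where d1: "d1 > 0" "\<And>p q. p \<in> {- d0..d0} \<times> cball 0 (1 + \<epsilon> / 2) \<Longrightarrow>
      q \<in> {- d0..d0} \<times> cball 0 (1 + \<epsilon> / 2) \<Longrightarrow> dist q p < d1 \<Longrightarrow> dist (B q) (B p) < e / 2"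
    using e unfolding uniformly_continuous_on_def by (meson half_gt_zero)
  define d where "d = min d0 d1"
  have d: "d > 0" using d0 d1 by (simp add: d_def)
  show "\<forall>\<^sub>F s in at 0. \<forall>z\<in>cball 0 (1 + \<epsilon> / 2). dist ((g (s *\<^sub>R v, z) - (1 - z + of_real s * a v z + (of_real s)\<^sup>2 * b v z / 2)) / (of_real s)\<^sup>2) 0 < e"
    unfolding eventually_at
  proof (intro exI[of _ d] conjI ballI impI d)
    fix t :: real and z :: complex assume "t \<noteq> 0 \<and> dist t 0 < d" and z: "z \<in> cball 0 (1 + \<epsilon> / 2)"
    then have t: "t \<noteq> 0" "\<bar>t\<bar> < d" by auto
    have "norm (g (t *\<^sub>R v, z) - (g (0 *\<^sub>R v, z) + t *\<^sub>R blinfun_apply (g' (0 *\<^sub>R v, z)) (v, 0) + (t\<^sup>2 / 2) *\<^sub>R b v z)) \<le> e / 2 * t\<^sup>2"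
    proof (rule second_order_taylor_bound[where d = d])
      fix s assume s: "\<bar>s\<bar> < d"
      then have "(0 + s *\<^sub>R v, z) \<in> U" using inU[of s z] z by (simp add: d_def)
      from g_line_derivatives[OF this]
      show "((\<lambda>s. g (s *\<^sub>R v, z)) has_vector_derivative blinfun_apply (g' (s *\<^sub>R v, z)) (v, 0)) (at s)"
        "((\<lambda>s. blinfun_apply (g' (s *\<^sub>R v, z)) (v, 0)) has_vector_derivative
          blinfun_apply (blinfun_apply (g'' (s *\<^sub>R v, z)) (v, 0)) (v, 0)) (at s)"
        by simp_all
      have "dist (B (s, z)) (B (0, z)) < e / 2"
        using s z d0 by (intro d1) (auto simp: d_def dist_Pair_Pair)
      then show "norm (blinfun_apply (blinfun_apply (g'' (s *\<^sub>R v, z)) (v, 0)) (v, 0) - b v z) \<le> e / 2"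
        by (simp add: B_def b_def dist_norm)
    qed (rule t)
    also have "g (0 *\<^sub>R v, z) = 1 - z"
      using z \<epsilon> by (simp add: g_0)
    finally have "norm (g (t *\<^sub>R v, z) - (1 - z + of_real t * a v z + (of_real t)\<^sup>2 * b v z / 2)) \<le> e / 2 * t\<^sup>2"
      by (simp add: a_def scaleR_conv_of_real)
    then have "norm ((g (t *\<^sub>R v, z) - (1 - z + of_real t * a v z + (of_real t)\<^sup>2 * b v z / 2)) / (of_real t)\<^sup>2) \<le> e / 2"
      using t(1) by (simp add: norm_divide norm_power pos_divide_le_eq)
    then show "dist ((g (t *\<^sub>R v, z) - (1 - z + of_real t * a v z + (of_real t)\<^sup>2 * b v z / 2)) / (of_real t)\<^sup>2) 0 < e"
      using e by simp
  qed
qed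


lemma a_limit: "uniform_limit (cball 0 (1 + \<epsilon> / 2)) (\<lambda>s z. (g (s *\<^sub>R v, z) - (1 - z)) / of_real s) (a v) (at 0)"
  and a_continuous: "continuous_on (cball 0 (1 + \<epsilon> / 2)) (a v)"
proof -
  let ?C = "cball (0::complex) (1 + \<epsilon> / 2)"
  have inU: "(0, z) \<in> U" if "z \<in> ?C" for z using that \<epsilon> by (intro box) auto
  have g'_cont: "continuous_on U g'"
    using g'' U_open by (intro has_derivative_continuous_on[of U g' "\<lambda>p. blinfun_apply (g'' p)"]) (auto intro: has_derivative_at_withinI)
  show "continuous_on ?C (a v)"
    unfolding a_def by (intro continuous_intros continuous_on_compose2[OF g'_cont]) (use inU in auto)
  have b: "continuous_on ?C (b v)"
    unfolding b_def by (intro continuous_intros continuous_on_compose2[OF cont]) (use inU in auto)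
  have b2: "bounded ((\<lambda>z. b v z / 2) ` ?C)"
    by (intro compact_imp_bounded compact_continuous_image continuous_intros b) auto
  have s_lim: "((\<lambda>s::real. complex_of_real s) \<longlongrightarrow> 0) (at 0)"
    by (auto intro!: tendsto_eq_intros)
  let ?\<eta> = "\<lambda>s z. (g (s *\<^sub>R v, z) - (1 - z + of_real s * a v z + (of_real s)\<^sup>2 * b v z / 2)) / (of_real s)\<^sup>2"
  have "uniform_limit ?C (\<lambda>s z. b v z / 2 + ?\<eta> s z) (\<lambda>z. b v z / 2 + 0) (at 0)"
    by (intro uniform_limit_add uniform_limit_const taylor_line)
  then have "uniform_limit ?C (\<lambda>s z. complex_of_real s * (b v z / 2 + ?\<eta> s z)) (\<lambda>z. 0 * (b v z / 2 + 0)) (at 0)"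
    by (rule uniform_limit_mult_scalar) (use b2 s_lim in auto)
  then have "uniform_limit ?C (\<lambda>s z. a v z + complex_of_real s * (b v z / 2 + ?\<eta> s z)) (\<lambda>z. a v z + 0 * (b v z / 2 + 0)) (at 0)"
    by (intro uniform_limit_add uniform_limit_const)
  then show "uniform_limit ?C (\<lambda>s z. (g (s *\<^sub>R v, z) - (1 - z)) / of_real s) (a v) (at 0)"
    by (rule uniform_limit_cong[THEN iffD1, rotated 2]) (auto simp: eventually_at_filter taylor_quotient(2))
qed

lemma line_holomorphic: "\<forall>\<^sub>F s in at 0. (\<lambda>z. g (s *\<^sub>R v, z)) holomorphic_on ball 0 (1 + \<epsilon>)"
  and line_in_U: "\<forall>\<^sub>F s in at 0. \<forall>z\<in>ball 0 (1 + \<epsilon>). (s *\<^sub>R v, z) \<in> U"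
proof -
  have "((\<lambda>s. norm (s *\<^sub>R v)) \<longlongrightarrow> 0) (at 0)"
    by (auto intro!: tendsto_eq_intros)
  then have *: "\<forall>\<^sub>F s in at 0. norm (s *\<^sub>R v) < \<epsilon>"
    using \<epsilon> by (rule order_tendstoD)
  show "\<forall>\<^sub>F s in at 0. (\<lambda>z. g (s *\<^sub>R v, z)) holomorphic_on ball 0 (1 + \<epsilon>)"
    using * by eventually_elim (rule g_holomorphic)
  show "\<forall>\<^sub>F s in at 0. \<forall>z\<in>ball 0 (1 + \<epsilon>). (s *\<^sub>R v, z) \<in> U"
    using * by eventually_elim (auto intro: box)
qed

text \<open>A uniform limit of difference quotients in \<open>s\<close>, each of them holomorphic in
  \<open>z\<close>.\<close>

lemma a_holomorphic: "a v holomorphic_on ball 0 (1 + \<epsilon> / 2)"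
proof (rule holomorphic_uniform_limit[OF _ a_limit])
  show "\<forall>\<^sub>F s in at 0. continuous_on (cball 0 (1 + \<epsilon> / 2)) (\<lambda>z. (g (s *\<^sub>R v, z) - (1 - z)) / of_real s) \<and>
      (\<lambda>z. (g (s *\<^sub>R v, z) - (1 - z)) / of_real s) holomorphic_on ball 0 (1 + \<epsilon> / 2)"
    using line_holomorphic[of v] eventually_neq_at_within[of 0 0 UNIV]
  proof eventually_elim
    case (elim s)
    then have "(\<lambda>z. (g (s *\<^sub>R v, z) - (1 - z)) / of_real s) holomorphic_on ball 0 (1 + \<epsilon>)"
      by (intro holomorphic_intros) auto
    from holomorphic_on_smaller_ball[OF this half_lt] show ?case by blast
  qed
qed auto

text \<open>The same argument one order higher; subtracting the linear term uses the holomorphy of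
  \<open>a v\<close>.\<close>

lemma b_holomorphic: "b v holomorphic_on ball 0 (1 + \<epsilon> / 2)"
proof -
  let ?C = "cball (0::complex) (1 + \<epsilon> / 2)"
  let ?\<eta> = "\<lambda>s z. (g (s *\<^sub>R v, z) - (1 - z + of_real s * a v z + (of_real s)\<^sup>2 * b v z / 2)) / (of_real s)\<^sup>2"
  have "uniform_limit ?C (\<lambda>s z. b v z / 2 + ?\<eta> s z) (\<lambda>z. b v z / 2 + 0) (at 0)"
    by (intro uniform_limit_add uniform_limit_const taylor_line)
  then have lim: "uniform_limit ?C (\<lambda>s z. (g (s *\<^sub>R v, z) - (1 - z + of_real s * a v z)) / (of_real s)\<^sup>2) (\<lambda>z. b v z / 2) (at 0)"
    by (rule uniform_limit_cong[THEN iffD1, rotated 2]) (auto simp: eventually_at_filter taylor_quotient(1))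
  have "\<forall>\<^sub>F s in at 0. continuous_on ?C (\<lambda>z. (g (s *\<^sub>R v, z) - (1 - z + of_real s * a v z)) / (of_real s)\<^sup>2) \<and>
      (\<lambda>z. (g (s *\<^sub>R v, z) - (1 - z + of_real s * a v z)) / (of_real s)\<^sup>2) holomorphic_on ball 0 (1 + \<epsilon> / 2)"
    using line_holomorphic[of v] eventually_neq_at_within[of 0 0 UNIV]
  proof eventually_elim
    case (elim s)
    have "(\<lambda>z. g (s *\<^sub>R v, z)) holomorphic_on ball 0 (1 + \<epsilon> / 2)" "continuous_on ?C (\<lambda>z. g (s *\<^sub>R v, z))"
      by (rule holomorphic_on_smaller_ball[OF elim(1) half_lt])+
    then show ?case
      using elim(2) by (intro conjI holomorphic_intros continuous_intros a_holomorphic a_continuous) auto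
  qed
  then have "(\<lambda>z. b v z / 2) holomorphic_on ball 0 (1 + \<epsilon> / 2)"
    by (rule holomorphic_uniform_limit[OF _ lim]) auto
  then have "(\<lambda>z. 2 * (b v z / 2)) holomorphic_on ball 0 (1 + \<epsilon> / 2)"
    by (rule holomorphic_on_mult[OF holomorphic_on_const])
  then show ?thesis by simp
qed

text \<open>The radii are nested: \<open>g\<close> is holomorphic up to
  \<open>1 + \<epsilon>\<close>, the limits \<open>a v\<close> and \<open>b v\<close> up to
  \<open>1 + \<epsilon> / 2\<close>, and the uniform estimates are used on the closed disc of radius
  \<open>1 + \<epsilon> / 4\<close>.\<close>

sublocale line: line_generating_function M "\<lambda>n s. Y n s \<bullet> v" "\<lambda>s z. g (s *\<^sub>R v, z)" "a v" "b v"
    "1 + \<epsilon> / 2" "1 + \<epsilon> / 4" for v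
proof (rule line_generating_function.intro)
  show "(\<lambda>s. Y n s \<bullet> v) \<in> borel_measurable (M n)" for n
    by (intro borel_measurable_inner rv borel_measurable_const)
  show "\<forall>\<^sub>F s in at 0. (\<lambda>z. g (s *\<^sub>R v, z)) holomorphic_on ball 0 (1 + \<epsilon> / 2)"
    using line_holomorphic[of v]
    by eventually_elim (rule holomorphic_on_smaller_ball(1)[OF _ half_lt])
  show "uniform_limit (cball 0 (1 + \<epsilon> / 4))
    (\<lambda>s z. (g (s *\<^sub>R v, z) - (1 - z + of_real s * a v z + (of_real s)\<^sup>2 * b v z / 2)) / (of_real s)\<^sup>2)
    (\<lambda>z. 0) (at 0)"
    using \<epsilon> by (intro uniform_limit_on_subset[OF taylor_line]) auto
  show "\<forall>\<^sub>F s in at 0. \<forall>z. norm z < 1 \<longrightarrow> g (s *\<^sub>R v, z) \<noteq> 0 \<and>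
      (\<lambda>n. (CLINT x|M n. exp (\<i> * complex_of_real (s * (Y n x \<bullet> v)))) * z ^ n) sums (1 / g (s *\<^sub>R v, z))"
    using line_in_U[of v]
  proof eventually_elim
    case (elim s)
    show ?case
    proof (intro allI impI)
      fix z :: complex assume z: "norm z < 1"
      then have "z \<in> ball 0 (1 + \<epsilon>)" using \<epsilon> by simp
      then have "(s *\<^sub>R v, z) \<in> U" using elim by blast
      from series[OF this z] show "g (s *\<^sub>R v, z) \<noteq> 0 \<and>
        (\<lambda>n. (CLINT x|M n. exp (\<i> * complex_of_real (s * (Y n x \<bullet> v)))) * z ^ n) sums (1 / g (s *\<^sub>R v, z))"
        by (simp add: char_fun_def)
    qed
  qed
qed (use \<epsilon> in \<open>simp_all add: prob a_holomorphic b_holomorphic\<close>)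

section \<open>Partial derivatives and the covariance form\<close>

lemma d_x_g: "(x, z) \<in> U \<Longrightarrow> d_x j g (x, z) = blinfun_apply (g' (x, z)) (axis j 1, 0)"
  using g_line_derivatives(1)[of x 0 "axis j 1" z] by (simp add: d_x_def vector_derivative_at)

lemma zero_one_in_U: "(0, 1) \<in> U"
  using \<epsilon> by (intro box) auto

lemma d_x_d_x_g: "d_x j (d_x k g) (0, 1) = hessian (axis j 1) (axis k 1)"
proof -
  \<comment> \<open>The inner derivative is known only at points of \<open>U\<close>, so the outer
    one is computed on an open set of parameters around 0.\<close>
  define S where "S = {t. (t *\<^sub>R axis j 1, 1) \<in> U}"
  have "S = (\<lambda>t. (t *\<^sub>R axis j 1, 1)) -` U" by (auto simp: S_def)
  then have "open S"
    using U_open by (auto intro!: continuous_open_vimage continuous_intros)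
  have "((\<lambda>t. d_x k g (0 + t *\<^sub>R axis j 1, 1)) has_vector_derivative hessian (axis j 1) (axis k 1)) (at 0)"
  proof (rule has_vector_derivative_transform_within_open[OF _ \<open>open S\<close>])
    show "((\<lambda>t. blinfun_apply (g' (0 + t *\<^sub>R axis j 1, 1)) (axis k 1, 0)) has_vector_derivative hessian (axis j 1) (axis k 1)) (at 0)"
      using g_line_derivatives(2)[of 0 0 "axis j 1" 1 "axis k 1"] zero_one_in_U by (simp add: hessian_def)
  qed (use zero_one_in_U in \<open>auto simp: S_def d_x_g\<close>)
  then show ?thesis by (simp add: d_x_def[of j] vector_derivative_at)
qed

text \<open>The order of differentiation is exchanged by complex analysis: uniform convergence of
  holomorphic difference quotients entails convergence of their
  \<open>z\<close>-derivatives.\<close>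

lemma d_x_d_z_g: "d_x j (d_z g) (0, 1) = deriv (a (axis j 1)) 1"
proof -
  let ?v = "axis j 1 :: real ^ 'd"
  let ?R = "1 + \<epsilon> / 2"
  have one: "1 \<in> ball (0::complex) ?R" using \<epsilon> by simp
  have "\<forall>\<^sub>F s in at 0. continuous_on (cball 0 ?R) (\<lambda>z. (g (s *\<^sub>R ?v, z) - (1 - z)) / of_real s) \<and>
      (\<forall>w\<in>ball 0 ?R. ((\<lambda>z. (g (s *\<^sub>R ?v, z) - (1 - z)) / of_real s) has_field_derivative
        (deriv (\<lambda>z. g (s *\<^sub>R ?v, z)) w - (- 1)) / of_real s) (at w))"
    using line_holomorphic[of ?v] eventually_neq_at_within[of 0 0 UNIV]
  proof eventually_elim
    case (elim s)
    have "(\<lambda>z. (g (s *\<^sub>R ?v, z) - (1 - z)) / of_real s) holomorphic_on ball 0 (1 + \<epsilon>)"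
      using elim by (intro holomorphic_intros) auto
    then have "continuous_on (cball 0 ?R) (\<lambda>z. (g (s *\<^sub>R ?v, z) - (1 - z)) / of_real s)"
      by (rule holomorphic_on_smaller_ball(2)[OF _ half_lt])
    moreover have "((\<lambda>z. (g (s *\<^sub>R ?v, z) - (1 - z)) / of_real s) has_field_derivative
        (deriv (\<lambda>z. g (s *\<^sub>R ?v, z)) w - (- 1)) / of_real s) (at w)" if "w \<in> ball 0 ?R" for w
    proof -
      have "((\<lambda>z. g (s *\<^sub>R ?v, z)) has_field_derivative deriv (\<lambda>z. g (s *\<^sub>R ?v, z)) w) (at w)"
        using that \<epsilon> by (intro holomorphic_derivI[OF elim(1)]) auto
      moreover have "((\<lambda>z::complex. 1 - z) has_field_derivative - 1) (at w)"
        by (auto intro!: derivative_eq_intros)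
      ultimately show ?thesis by (intro DERIV_cdivide DERIV_diff)
    qed
    ultimately show ?case by blast
  qed
  then obtain D where D: "\<And>w. w \<in> ball 0 ?R \<Longrightarrow> (a ?v has_field_derivative D w) (at w) \<and>
      ((\<lambda>s. (deriv (\<lambda>z. g (s *\<^sub>R ?v, z)) w - (- 1)) / of_real s) \<longlongrightarrow> D w) (at 0)"
    by (rule has_complex_derivative_uniform_limit[OF _ a_limit]) (use \<epsilon> in auto)
  have D1: "deriv (a ?v) 1 = D 1" using D[OF one] by (blast intro: DERIV_imp_deriv)
  \<comment> \<open>This identifies the constant \<open>- 1\<close> in the limit as the value at
    \<open>s = 0\<close>, so that the quotient is a genuine difference quotient.\<close>
  have "deriv (\<lambda>z. g (0, z)) 1 = - 1"
  proof (rule DERIV_imp_deriv)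
    have "((\<lambda>z::complex. 1 - z) has_field_derivative - 1) (at 1)"
      by (auto intro!: derivative_eq_intros)
    then show "((\<lambda>z. g (0, z)) has_field_derivative - 1) (at 1)"
      by (rule has_field_derivative_transform_within_open[OF _ open_ball one]) (use \<epsilon> in \<open>auto simp: g_0\<close>)
  qed
  then have "((\<lambda>s. (deriv (\<lambda>z. g (s *\<^sub>R ?v, z)) 1 - deriv (\<lambda>z. g (0 *\<^sub>R ?v, z)) 1) / of_real s) \<longlongrightarrow> D 1) (at 0)"
    using D[OF one] by simp
  then have "((\<lambda>s. deriv (\<lambda>z. g (s *\<^sub>R ?v, z)) 1) has_vector_derivative D 1) (at 0)"
    by (rule has_vector_derivative_at_0_complex)
  then show ?thesis by (simp add: D1 d_x_def d_z_def vector_derivative_at)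
qed

lemma a_linear: "linear (\<lambda>v. a v z)"
proof -
  have "a (v + w) z = a v z + a w z" for v w
  proof -
    have "(v + w, 0) = (v, 0) + (w, 0::complex)" by simp
    then show ?thesis unfolding a_def by (simp only: blinfun.add_right)
  qed
  moreover have "a (r *\<^sub>R v) z = r *\<^sub>R a v z" for r v
  proof -
    have "(r *\<^sub>R v, 0) = r *\<^sub>R (v, 0::complex)" by simp
    then show ?thesis unfolding a_def by (simp only: blinfun.scaleR_right)
  qed
  ultimately show ?thesis by (rule linearI)
qed

lemma hessian_linear: "linear (\<lambda>v. hessian v w)" "linear (hessian v)"
proof -
  have sum: "(v + w, 0) = (v, 0) + (w, 0::complex)" and scale: "(r *\<^sub>R v, 0) = r *\<^sub>R (v, 0::complex)"
    for v w :: "real ^ 'd" and r by simp_all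
  show "linear (\<lambda>v. hessian v w)" "linear (hessian v)"
    unfolding hessian_def sum scale
    by (rule linearI; simp only: sum scale blinfun.add_right blinfun.scaleR_right blinfun.add_left blinfun.scaleR_left)+
qed

lemma hessian_symmetric: "hessian v w = hessian w v"
  unfolding hessian_def by (rule second_derivative_symmetric[OF U_open zero_one_in_U g' g''[OF zero_one_in_U]])

lemma deriv_a_linear: "linear (\<lambda>v. deriv (a v) 1)"
proof -
  have der: "(a v has_field_derivative deriv (a v) 1) (at 1)" for v
    using \<epsilon> by (intro holomorphic_derivI[OF a_holomorphic]) auto
  have "deriv (a (v + w)) 1 = deriv (a v) 1 + deriv (a w) 1" for v w
  proof -
    have "a (v + w) = (\<lambda>z. a v z + a w z)" using linear_add[OF a_linear] by auto
    then show ?thesis using DERIV_imp_deriv[OF DERIV_add[OF der der]] by simp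
  qed
  moreover have "deriv (a (r *\<^sub>R v)) 1 = r *\<^sub>R deriv (a v) 1" for r v
  proof -
    have "a (r *\<^sub>R v) = (\<lambda>z. of_real r * a v z)" using linear_scale[OF a_linear] by (auto simp: scaleR_conv_of_real)
    then show ?thesis using DERIV_imp_deriv[OF DERIV_cmult[OF der]] by (simp add: scaleR_conv_of_real)
  qed
  ultimately show ?thesis by (rule linearI)
qed


text \<open>The symmetric bilinear form whose diagonal is the \<open>variance_rate\<close> of each
  line. On coordinate vectors it is \<open>\<sigma>\<close>, since \<open>\<mu> j\<close> is
  \<open>\<i>\<close> times \<open>a (axis j 1) 1\<close>.\<close>

definition "covariance_form v w = hessian v w + a v 1 * deriv (a w) 1 + a w 1 * deriv (a v) 1 - a v 1 * a w 1"

lemma covariance_form_symmetric: "covariance_form v w = covariance_form w v"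
  by (simp add: covariance_form_def hessian_symmetric[of v w] mult.commute)

lemma covariance_form_linear: "linear (covariance_form v)"
  unfolding covariance_form_def
  by (rule linearI; simp only: linear_add[OF hessian_linear(2)] linear_add[OF a_linear] linear_add[OF deriv_a_linear]
      linear_scale[OF hessian_linear(2)] linear_scale[OF a_linear] linear_scale[OF deriv_a_linear])
    (simp_all add: algebra_simps scaleR_conv_of_real)

lemma covariance_form_expand: "covariance_form v w = (\<Sum>j\<in>UNIV. \<Sum>k\<in>UNIV. complex_of_real (v $ j * w $ k) * covariance_form (axis j 1) (axis k 1))"
proof -
  have "covariance_form v w = covariance_form w v" by (rule covariance_form_symmetric)
  also have "\<dots> = (\<Sum>j\<in>UNIV. v $ j *\<^sub>R covariance_form w (axis j 1))"
    by (rule linear_axis_sum[OF covariance_form_linear])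
  also have "\<dots> = (\<Sum>j\<in>UNIV. \<Sum>k\<in>UNIV. complex_of_real (v $ j * w $ k) * covariance_form (axis j 1) (axis k 1))"
  proof (rule sum.cong[OF refl])
    fix j
    have "covariance_form w (axis j 1) = covariance_form (axis j 1) w" by (rule covariance_form_symmetric)
    also have "\<dots> = (\<Sum>k\<in>UNIV. w $ k *\<^sub>R covariance_form (axis j 1) (axis k 1))"
      by (rule linear_axis_sum[OF covariance_form_linear])
    finally have *: "covariance_form w (axis j 1) = (\<Sum>k\<in>UNIV. w $ k *\<^sub>R covariance_form (axis j 1) (axis k 1))" .
    show "v $ j *\<^sub>R covariance_form w (axis j 1) = (\<Sum>k\<in>UNIV. complex_of_real (v $ j * w $ k) * covariance_form (axis j 1) (axis k 1))"
      unfolding * scaleR_sum_right by (simp add: scaleR_conv_of_real mult.assoc)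
  qed
  finally show ?thesis .
qed

lemma covariance_form_polarization: "2 * covariance_form v w = covariance_form (v + w) (v + w) - covariance_form v v - covariance_form w w"
proof -
  have "covariance_form (v + w) (v + w) = covariance_form (v + w) v + covariance_form (v + w) w" by (rule linear_add[OF covariance_form_linear])
  also have "covariance_form (v + w) v = covariance_form v v + covariance_form v w"
    by (subst covariance_form_symmetric, subst linear_add[OF covariance_form_linear]) (rule refl)
  also have "covariance_form (v + w) w = covariance_form v w + covariance_form w w"
    by (subst covariance_form_symmetric, subst linear_add[OF covariance_form_linear]) (simp add: covariance_form_symmetric[of w v])
  finally show ?thesis by simp
qed

lemma variance_rate_eq: "line.variance_rate v = covariance_form v v"
  by (simp add: line.variance_rate_def covariance_form_def hessian_def b_def power2_eq_square)

definition "variance_along n v = (LINT s|M n. (Y n s \<bullet> v)\<^sup>2) - (LINT s|M n. Y n s \<bullet> v)\<^sup>2"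

lemma variance_along_limit: "(\<lambda>n. complex_of_real (variance_along n v) / of_nat n) \<longlonglongrightarrow> covariance_form v v"
  using line.variance_limit[of v] unfolding variance_along_def variance_rate_eq .

lemma variance_along_nonneg: "0 \<le> variance_along n v"
proof -
  interpret prob_space "M n" by (rule prob)
  have "variance_along n v = variance (\<lambda>s. Y n s \<bullet> v)"
    unfolding variance_along_def by (rule variance_eq[symmetric]) (rule line.integrable_X line.square_integrable)+
  then show ?thesis using variance_positive by simp
qed

lemma tendsto_complex_real:
  assumes "(\<lambda>n. complex_of_real (f n)) \<longlonglongrightarrow> z"
  shows "complex_of_real (Re z) = z" "f \<longlonglongrightarrow> Re z"
proof -
  have "(\<lambda>n. Im (complex_of_real (f n))) \<longlonglongrightarrow> Im z" by (rule tendsto_Im[OF assms])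
  then have "Im z = 0" by (simp add: LIMSEQ_const_iff)
  then show "complex_of_real (Re z) = z" by (simp add: complex_eq_iff)
  show "f \<longlonglongrightarrow> Re z" using tendsto_Re[OF assms] by simp
qed

lemma variance_along_real: "complex_of_real (Re (covariance_form v v)) = covariance_form v v" "(\<lambda>n. variance_along n v / real n) \<longlonglongrightarrow> Re (covariance_form v v)"
proof -
  have "(\<lambda>n. complex_of_real (variance_along n v / real n)) \<longlonglongrightarrow> covariance_form v v"
    using variance_along_limit[of v] by simp
  then show "complex_of_real (Re (covariance_form v v)) = covariance_form v v" "(\<lambda>n. variance_along n v / real n) \<longlonglongrightarrow> Re (covariance_form v v)"
    by (rule tendsto_complex_real)+
qed

text \<open>Diagonal values are limits of real variances; polarization extends this to all
  pairs.\<close>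

lemma covariance_form_real: "complex_of_real (Re (covariance_form v w)) = covariance_form v w"
proof -
  have "covariance_form v w = (2 * covariance_form v w) / 2" by simp
  also have "\<dots> = (covariance_form (v + w) (v + w) - covariance_form v v - covariance_form w w) / 2" by (simp only: covariance_form_polarization)
  also have "\<dots> = complex_of_real ((Re (covariance_form (v + w) (v + w)) - Re (covariance_form v v) - Re (covariance_form w w)) / 2)"
    by (simp add: variance_along_real)
  finally show ?thesis by (metis Re_complex_of_real)
qed

text \<open>The third claim is stronger than convergence of the quotient: centering at
  \<open>n\<close> times the limit instead of the mean costs only a bounded amount, which
  \<open>central_limit\<close> needs.\<close>

lemma mean_limit:
  "complex_of_real (Re (\<i> * a v 1)) = \<i> * a v 1"
  "(\<lambda>n. (LINT s|M n. Y n s \<bullet> v) / real n) \<longlonglongrightarrow> Re (\<i> * a v 1)"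
  "Bseq (\<lambda>n. (LINT s|M n. Y n s \<bullet> v) - real n * Re (\<i> * a v 1))"
proof -
  have B: "Bseq (\<lambda>n. complex_of_real (LINT s|M n. Y n s \<bullet> v) - of_nat n * (\<i> * a v 1))"
    using line.mean_bounded[of v] unfolding line.drift_def .
  have "(\<lambda>n. complex_of_real ((LINT s|M n. Y n s \<bullet> v) / real n)) \<longlonglongrightarrow> \<i> * a v 1"
  proof (rule Lim_transform_eventually)
    show "(\<lambda>n. \<i> * a v 1 + (complex_of_real (LINT s|M n. Y n s \<bullet> v) - of_nat n * (\<i> * a v 1)) / of_nat n) \<longlonglongrightarrow> \<i> * a v 1"
      using tendsto_add[OF tendsto_const[of "\<i> * a v 1"] Bseq_over_n[OF B]] by simp
    show "\<forall>\<^sub>F n in sequentially. \<i> * a v 1 + (complex_of_real (LINT s|M n. Y n s \<bullet> v) - of_nat n * (\<i> * a v 1)) / of_nat n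
        = complex_of_real ((LINT s|M n. Y n s \<bullet> v) / real n)"
      using eventually_gt_at_top[of 0] by eventually_elim (simp add: diff_divide_distrib)
  qed
  note * = tendsto_complex_real[OF this]
  show real: "complex_of_real (Re (\<i> * a v 1)) = \<i> * a v 1" by (rule *)
  show "(\<lambda>n. (LINT s|M n. Y n s \<bullet> v) / real n) \<longlonglongrightarrow> Re (\<i> * a v 1)" by (rule *)
  have "norm (complex_of_real x - of_nat n * (\<i> * a v 1)) = norm (x - real n * Re (\<i> * a v 1))" for x n
  proof -
    have "complex_of_real x - of_nat n * (\<i> * a v 1) = complex_of_real (x - real n * Re (\<i> * a v 1))"
      by (subst real[symmetric]) (simp only: of_real_diff of_real_mult of_real_of_nat_eq)
    then show ?thesis by (simp only: norm_of_real real_norm_def)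
  qed
  then show "Bseq (\<lambda>n. (LINT s|M n. Y n s \<bullet> v) - real n * Re (\<i> * a v 1))"
    using B unfolding Bseq_def by (simp only:)
qed

section \<open>Mean vector, covariance matrix and limit law\<close>

definition "m = (\<chi> j. Re (\<i> * a (axis j 1) 1))"

definition "S = (\<chi> j k. Re (covariance_form (axis j 1) (axis k 1)))"

lemma m_inner: "v \<bullet> m = Re (\<i> * a v 1)"
proof -
  have "a v 1 = (\<Sum>j\<in>UNIV. v $ j *\<^sub>R a (axis j 1) 1)" by (rule linear_axis_sum[OF a_linear])
  then show ?thesis by (simp add: m_def inner_vec_def sum_distrib_left sum_negf)
qed

lemma S_inner: "v \<bullet> (S *v v) = Re (covariance_form v v)"
  by (subst covariance_form_expand) (simp add: S_def inner_vec_def matrix_vector_mult_def sum_distrib_left mult_ac)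

text \<open>The quadratic form of \<open>S\<close> is a limit of normalized variances.\<close>

lemma S_positive_semidefinite: "positive_semidefinite S"
proof -
  have "transpose S = S"
    by (simp add: S_def transpose_def vec_eq_iff covariance_form_symmetric)
  moreover have "0 \<le> v \<bullet> (S *v v)" for v
    unfolding S_inner using variance_along_nonneg
    by (intro LIMSEQ_le_const[OF variance_along_real(2)]) (auto intro: exI[of _ 0])
  ultimately show ?thesis by (simp add: positive_semidefinite_def)
qed

lemma integrable_coordinates:
  "integrable (M n) (\<lambda>s. Y n s $ j)" "integrable (M n) (\<lambda>s. (Y n s $ j)\<^sup>2)"
  using line.integrable_X[of n "axis j 1"] line.square_integrable[of n "axis j 1"] by (simp_all add: inner_axis)

lemma integrable_Y: "integrable (M n) (Y n)"
proof -
  have "integrable (M n) (\<lambda>s. \<Sum>j\<in>UNIV. (Y n s $ j) *\<^sub>R (axis j 1 :: real ^ 'd))"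
    by (intro Bochner_Integration.integrable_sum integrable_scaleR_left integrable_coordinates)
  moreover have "(\<Sum>j\<in>UNIV. (y $ j) *\<^sub>R axis j 1) = y" for y :: "real ^ 'd"
    by (rule linear_axis_sum[OF linear_ident, symmetric])
  ultimately show ?thesis by simp
qed

lemma norm_square_coordinates: "(norm y)\<^sup>2 = (\<Sum>j\<in>UNIV. (y $ j)\<^sup>2)" for y :: "real ^ 'd"
  by (simp add: norm_vec_def L2_set_def sum_nonneg)

lemma integrable_norm_square: "integrable (M n) (\<lambda>s. (norm (Y n s))\<^sup>2)"
  unfolding norm_square_coordinates by (intro Bochner_Integration.integrable_sum integrable_coordinates)

lemma mean_vec_nth: "mean_vec (M n) (Y n) $ j = (LINT s|M n. Y n s $ j)"
  unfolding mean_vec_def by (rule integral_bounded_linear[OF bounded_linear_vec_nth integrable_Y, symmetric])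

text \<open>Covariances are combinations of variances along three lines, which the one-dimensional
  case controls. The same identity gives integrability of the product of two coordinates.\<close>

lemma covariance_polarization:
  "covariance_matrix (M n) (Y n) $ j $ k = (variance_along n (axis j 1 + axis k 1) - variance_along n (axis j 1) - variance_along n (axis k 1)) / 2"
proof -
  interpret prob_space "M n" by (rule prob)
  let ?E = "\<lambda>f. LINT s|M n. f s"
  let ?mj = "?E (\<lambda>s. Y n s $ j)" and ?mk = "?E (\<lambda>s. Y n s $ k)"
  have sq: "integrable (M n) (\<lambda>s. (Y n s $ j + Y n s $ k)\<^sup>2)"
    using line.square_integrable[of n "axis j 1 + axis k 1"] by (simp add: inner_axis inner_add_right)
  have "integrable (M n) (\<lambda>s. ((Y n s $ j + Y n s $ k)\<^sup>2 - (Y n s $ j)\<^sup>2 - (Y n s $ k)\<^sup>2) / 2)"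
    by (intro integrable_divide Bochner_Integration.integrable_diff sq integrable_coordinates)
  then have prod: "integrable (M n) (\<lambda>s. Y n s $ j * Y n s $ k)"
    by (simp add: power2_sum)
  have "?E (\<lambda>s. (Y n s $ j + Y n s $ k)\<^sup>2) =
      ?E (\<lambda>s. (Y n s $ j)\<^sup>2) + ?E (\<lambda>s. (Y n s $ k)\<^sup>2) + 2 * ?E (\<lambda>s. Y n s $ j * Y n s $ k)"
    using integrable_coordinates prod by (simp add: power2_sum mult.assoc)
  moreover have "?E (\<lambda>s. Y n s $ j + Y n s $ k) = ?mj + ?mk"
    using integrable_coordinates by simp
  ultimately have "(variance_along n (axis j 1 + axis k 1) - variance_along n (axis j 1) - variance_along n (axis k 1)) / 2 =
      ?E (\<lambda>s. Y n s $ j * Y n s $ k) - ?mj * ?mk"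
    unfolding variance_along_def by (simp add: inner_axis inner_add_right power2_sum)
  moreover have "?E (\<lambda>s. (Y n s $ j - ?mj) * (Y n s $ k - ?mk)) = ?E (\<lambda>s. Y n s $ j * Y n s $ k) - ?mj * ?mk"
  proof -
    have "?E (\<lambda>s. (Y n s $ j - ?mj) * (Y n s $ k - ?mk)) =
        ?E (\<lambda>s. Y n s $ j * Y n s $ k - ?mk * Y n s $ j - ?mj * Y n s $ k + ?mj * ?mk)"
      by (intro Bochner_Integration.integral_cong) (auto simp: algebra_simps)
    also have "\<dots> = ?E (\<lambda>s. Y n s $ j * Y n s $ k) - ?mk * ?mj - ?mj * ?mk + ?mj * ?mk"
      using integrable_coordinates prod prob_space by simp
    finally show ?thesis by simp
  qed
  ultimately show ?thesis
    by (simp add: covariance_matrix_def mean_vec_nth)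
qed

lemma mean_vec_limit: "(\<lambda>n. mean_vec (M n) (Y n) /\<^sub>R real n) \<longlonglongrightarrow> m"
proof (rule vec_tendstoI)
  fix j
  show "(\<lambda>n. (mean_vec (M n) (Y n) /\<^sub>R real n) $ j) \<longlonglongrightarrow> m $ j"
    using mean_limit(2)[of "axis j 1"] by (simp add: mean_vec_nth m_def inner_axis divide_inverse mult.commute)
qed

lemma covariance_limit: "(\<lambda>n. covariance_matrix (M n) (Y n) /\<^sub>R real n) \<longlonglongrightarrow> S"
proof (intro vec_tendstoI)
  fix j k
  have "(\<lambda>n. (variance_along n (axis j 1 + axis k 1) / real n - variance_along n (axis j 1) / real n - variance_along n (axis k 1) / real n) / 2)
      \<longlonglongrightarrow> (Re (covariance_form (axis j 1 + axis k 1) (axis j 1 + axis k 1)) - Re (covariance_form (axis j 1) (axis j 1)) - Re (covariance_form (axis k 1) (axis k 1))) / 2"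
    by (rule tendsto_divide[OF tendsto_diff[OF tendsto_diff[OF variance_along_real(2) variance_along_real(2)] variance_along_real(2)] tendsto_const]) simp
  also have "(Re (covariance_form (axis j 1 + axis k 1) (axis j 1 + axis k 1)) - Re (covariance_form (axis j 1) (axis j 1)) - Re (covariance_form (axis k 1) (axis k 1))) / 2 = S $ j $ k"
    using arg_cong[OF covariance_form_polarization[of "axis j 1" "axis k 1"], of Re] by (simp add: S_def)
  finally have lim: "(\<lambda>n. (variance_along n (axis j 1 + axis k 1) / real n - variance_along n (axis j 1) / real n - variance_along n (axis k 1) / real n) / 2)
      \<longlonglongrightarrow> S $ j $ k" .
  have "(covariance_matrix (M n) (Y n) /\<^sub>R real n) $ j $ k =
      (variance_along n (axis j 1 + axis k 1) / real n - variance_along n (axis j 1) / real n - variance_along n (axis k 1) / real n) / 2" for n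
  proof -
    have "inverse r * ((x - y - z) / 2) = (x / r - y / r - z / r) / 2" for r x y z :: real
      unfolding divide_inverse left_diff_distrib[symmetric] by (simp only: mult_ac)
    then show ?thesis by (simp only: vector_scaleR_component covariance_polarization real_scaleR_def)
  qed
  then show "(\<lambda>n. (covariance_matrix (M n) (Y n) /\<^sub>R real n) $ j $ k) \<longlonglongrightarrow> S $ j $ k"
    using lim by (simp only:)
qed

text \<open>The projection of the normalized vector on \<open>t\<close> falls under
  \<open>char_limit\<close> for the line through \<open>t\<close>; what remains is the bound on
  second moments that tightness requires.\<close>

lemma central_limit:
  "converges_in_distribution M (\<lambda>n s. (Y n s - real n *\<^sub>R m) /\<^sub>R sqrt (real n)) (centered_normal S)"
proof (rule converges_in_distribution_char_fun)
  let ?Z = "\<lambda>n s. (Y n s - real n *\<^sub>R m) /\<^sub>R sqrt (real n)"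
  show "prob_space (M n)" for n by (rule prob)
  show "?Z n \<in> borel_measurable (M n)" for n
    by (intro borel_measurable_scaleR borel_measurable_diff rv borel_measurable_const)
  show "prob_space (centered_normal S)"
    by (rule prob_space_centered_normal[OF S_positive_semidefinite])
  show "sets (centered_normal S) = sets borel" by (simp add: centered_normal_def)
  have norm_Z: "(norm (?Z n s))\<^sup>2 = (\<Sum>j\<in>UNIV. (Y n s $ j - real n * m $ j)\<^sup>2) / real n" for n s
    by (simp add: norm_square_coordinates power_mult_distrib divide_inverse sum_distrib_left mult.commute power_inverse)
  \<comment> \<open>Variance plus squared bias. For \<open>c = real n * m $ j\<close> the bias is
    bounded, so after division by \<open>n\<close> its square vanishes.\<close>
  have shifted: "integrable (M n) (\<lambda>s. (Y n s $ j - c)\<^sup>2)"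
    "(LINT s|M n. (Y n s $ j - c)\<^sup>2) = variance_along n (axis j 1) + ((LINT s|M n. Y n s $ j) - c)\<^sup>2" for n j c
  proof -
    interpret prob_space "M n" by (rule prob)
    show "integrable (M n) (\<lambda>s. (Y n s $ j - c)\<^sup>2)"
      unfolding power2_diff using integrable_coordinates by simp
    show "(LINT s|M n. (Y n s $ j - c)\<^sup>2) = variance_along n (axis j 1) + ((LINT s|M n. Y n s $ j) - c)\<^sup>2"
      unfolding power2_diff variance_along_def using integrable_coordinates[of n j] prob_space
      by (simp add: inner_axis)
  qed
  show "integrable (M n) (\<lambda>s. (norm (?Z n s))\<^sup>2)" for n
    unfolding norm_Z by (intro integrable_divide Bochner_Integration.integrable_sum shifted)
  have "(LINT s|M n. (norm (?Z n s))\<^sup>2) =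
      (\<Sum>j\<in>UNIV. variance_along n (axis j 1) / real n + ((LINT s|M n. Y n s $ j) - real n * m $ j)\<^sup>2 / real n)" for n
    unfolding norm_Z using shifted by (simp add: sum_divide_distrib add_divide_distrib)
  moreover have "(\<lambda>n. (\<Sum>j\<in>UNIV. variance_along n (axis j 1) / real n + ((LINT s|M n. Y n s $ j) - real n * m $ j)\<^sup>2 / real n))
      \<longlonglongrightarrow> (\<Sum>j\<in>UNIV. Re (covariance_form (axis j 1) (axis j 1)) + 0)"
  proof (intro tendsto_sum tendsto_add variance_along_real(2))
    fix j :: 'd
    have "Bseq (\<lambda>n. (LINT s|M n. Y n s $ j) - real n * m $ j)"
      using mean_limit(3)[of "axis j 1"] by (simp add: inner_axis m_def)
    then obtain K where K: "\<And>n. \<bar>(LINT s|M n. Y n s $ j) - real n * m $ j\<bar> \<le> K"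
      unfolding Bseq_def by auto
    show "(\<lambda>n. ((LINT s|M n. Y n s $ j) - real n * m $ j)\<^sup>2 / real n) \<longlonglongrightarrow> 0"
    proof (rule Lim_null_comparison)
      have "((LINT s|M n. Y n s $ j) - real n * m $ j)\<^sup>2 \<le> K\<^sup>2" for n
        using K[of n] by (simp add: abs_le_square_iff[symmetric])
      then show "\<forall>\<^sub>F n in sequentially. norm (((LINT s|M n. Y n s $ j) - real n * m $ j)\<^sup>2 / real n) \<le> K\<^sup>2 / real n"
        by (intro always_eventually allI) (simp add: divide_right_mono)
      show "(\<lambda>n. K\<^sup>2 / real n) \<longlonglongrightarrow> 0" by real_asymp
    qed
  qed
  ultimately show "Bseq (\<lambda>n. LINT s|M n. (norm (?Z n s))\<^sup>2)"
    by (simp only:) (rule convergent_imp_Bseq, rule convergentI)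
  fix t
  \<comment> \<open>The factor involving \<open>a 1\<close> in \<open>char_limit\<close> is
    therefore the centering by \<open>m\<close>.\<close>
  have a_t: "a t 1 = - \<i> * complex_of_real (t \<bullet> m)"
    using mean_limit(1)[of t] by (simp add: m_inner mult.assoc[symmetric])
  \<comment> \<open>The identity includes \<open>n = 0\<close>, where the normalization by
    \<open>sqrt 0\<close> yields 0 on both sides.\<close>
  have "char_fun (M n) (?Z n) t = line.\<phi> t n (1 / sqrt (real n)) * exp (complex_of_real (sqrt (real n)) * a t 1)" for n
  proof -
    have "exp (\<i> * complex_of_real (?Z n s \<bullet> t)) =
        exp (\<i> * complex_of_real (1 / sqrt (real n) * (Y n s \<bullet> t))) * exp (complex_of_real (sqrt (real n)) * a t 1)" for s
    proof -
      have "?Z n s \<bullet> t = 1 / sqrt (real n) * (Y n s \<bullet> t) - (real n / sqrt (real n)) * (t \<bullet> m)"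
        by (simp add: inner_diff_left right_diff_distrib inner_commute[of _ t] inner_diff_right divide_inverse mult_ac)
      also have "real n / sqrt (real n) = sqrt (real n)" by (simp add: real_div_sqrt)
      finally have Z: "?Z n s \<bullet> t = 1 / sqrt (real n) * (Y n s \<bullet> t) - sqrt (real n) * (t \<bullet> m)" .
      have "\<i> * complex_of_real (?Z n s \<bullet> t) = \<i> * complex_of_real (1 / sqrt (real n) * (Y n s \<bullet> t)) + complex_of_real (sqrt (real n)) * a t 1"
        unfolding Z a_t of_real_diff of_real_mult[of "sqrt (real n)"] by (simp add: right_diff_distrib)
      then show ?thesis by (simp only: exp_add)
    qed
    then show ?thesis unfolding char_fun_def line.\<phi>_def by simp
  qed
  moreover have "char_fun (centered_normal S) (\<lambda>x. x) t = exp (- line.variance_rate t / 2)"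
    unfolding char_fun_centered_normal[OF S_positive_semidefinite] S_inner variance_rate_eq
    by (simp add: variance_along_real(1) flip: exp_of_real)
  ultimately show "(\<lambda>n. char_fun (M n) (?Z n) t) \<longlonglongrightarrow> char_fun (centered_normal S) (\<lambda>x. x) t"
    using line.char_limit[of t] by (simp only:)
qed

end

theorem theorem1p1:
  fixes M :: "nat \<Rightarrow> 'a measure"
    and Y :: "nat \<Rightarrow> 'a \<Rightarrow> real ^ 'd"
    and U :: "((real ^ 'd) \<times> complex) set"
    and g :: "(real ^ 'd) \<times> complex \<Rightarrow> complex"
    and \<mu> :: "'d \<Rightarrow> complex"
    and \<sigma> :: "'d \<Rightarrow> 'd \<Rightarrow> complex"
  assumes prob: "\<And>n. prob_space (M n)"
    and rv: "\<And>n. Y n \<in> borel_measurable (M n)"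
    and U_open: "open U"
    and U_nbhd: "{0} \<times> cball 0 1 \<subseteq> U"
    and g_holomorphic: "\<And>x. (\<lambda>z. g (x, z)) holomorphic_on {z. (x, z) \<in> U}"
    and g_twice_diff: "twice_continuously_differentiable_on g U"
    and g_series: "\<And>x z. (x, z) \<in> U \<Longrightarrow> norm z < 1 \<Longrightarrow>
      g (x, z) \<noteq> 0 \<and> (\<lambda>n. char_fun (M n) (Y n) x * z ^ n) sums (1 / g (x, z))"
    and mu_eq: "\<And>j. \<mu> j = \<i> * d_x j g (0, 1)"
    and sigma_eq: "\<And>j k. \<sigma> j k =
      d_x j (d_x k g) (0, 1)
        - \<i> * (\<mu> j * d_x k (d_z g) (0, 1) + \<mu> k * d_x j (d_z g) (0, 1))
        + \<mu> j * \<mu> k"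
  shows "(\<forall>n. integrable (M n) (Y n) \<and> integrable (M n) (\<lambda>s. (norm (Y n s))\<^sup>2)) \<and>
    (\<exists>(m :: real ^ 'd) (S :: real ^ 'd ^ 'd).
       (\<forall>j. complex_of_real (m $ j) = \<mu> j) \<and>
       (\<forall>j k. complex_of_real (S $ j $ k) = \<sigma> j k) \<and>
       positive_semidefinite S \<and>
       (\<lambda>n. mean_vec (M n) (Y n) /\<^sub>R real n) \<longlonglongrightarrow> m \<and>
       (\<lambda>n. covariance_matrix (M n) (Y n) /\<^sub>R real n) \<longlonglongrightarrow> S \<and>
       converges_in_distribution M
         (\<lambda>n s. (Y n s - real n *\<^sub>R m) /\<^sub>R sqrt (real n)) (centered_normal S))"
proof -
  have "compact ({0 :: real ^ 'd} \<times> cball (0::complex) 1)" by (intro compact_Times) auto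
  then obtain e where e: "e > 0" "(\<Union>p\<in>{0} \<times> cball 0 1. ball p e) \<subseteq> U"
    using compact_subset_open_imp_ball_epsilon_subset[OF _ U_open U_nbhd] by blast
  \<comment> \<open>Half of \<open>e\<close> for each component, as the distance in the product is
    at most the sum of the two distances.\<close>
  define \<epsilon> where "\<epsilon> = e / 2"
  have box: "(x, z) \<in> U" if x: "norm x < \<epsilon>" and z: "norm z < 1 + \<epsilon>" for x z
  proof -
    \<comment> \<open>The nearest point of the closed unit disc; a point \<open>z\<close> outside is
      moved by \<open>norm z - 1\<close>.\<close>
    define w where "w = (if norm z \<le> 1 then z else z / of_real (norm z))"
    have w: "norm w \<le> 1" by (auto simp: w_def norm_divide)
    have "dist w z < \<epsilon>"
    proof (cases "norm z \<le> 1")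
      case True
      then show ?thesis using e by (simp add: w_def \<epsilon>_def)
    next
      case False
      then have nz: "norm z > 1" by simp
      then have "w - z = z * of_real ((1 - norm z) / norm z)"
      proof -
        have "z \<noteq> 0" using False by (metis norm_zero zero_le_one)
        then show ?thesis using False by (simp add: w_def diff_divide_distrib right_diff_distrib)
      qed
      then have "norm (w - z) = norm z * \<bar>(1 - norm z) / norm z\<bar>"
        by (simp only: norm_mult norm_of_real)
      also have "\<dots> = norm z - 1"
      proof -
        have "r * \<bar>(1 - r) / r\<bar> = r - 1" if "r > 1" for r :: real
          using that by simp
        then show ?thesis using nz .
      qed
      finally show ?thesis using z by (simp add: dist_norm)
    qed
    moreover have "dist (0, w) (x, z) \<le> dist 0 x + dist w z"
      unfolding dist_Pair_Pair by (rule sqrt_sum_squares_le_sum) auto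
    ultimately have "dist (0, w) (x, z) < e" using x by (simp add: \<epsilon>_def)
    then have "(x, z) \<in> (\<Union>p\<in>{0} \<times> cball 0 1. ball p e)" using w by auto
    then show ?thesis using e by blast
  qed
  obtain g' :: "(real ^ 'd) \<times> complex \<Rightarrow> (((real ^ 'd) \<times> complex) \<Rightarrow>\<^sub>L complex)"
    and g'' :: "(real ^ 'd) \<times> complex \<Rightarrow> (((real ^ 'd) \<times> complex) \<Rightarrow>\<^sub>L ((real ^ 'd) \<times> complex) \<Rightarrow>\<^sub>L complex)"
    where g': "\<And>p. p \<in> U \<Longrightarrow> (g has_derivative blinfun_apply (g' p)) (at p)"
      "\<And>p. p \<in> U \<Longrightarrow> (g' has_derivative blinfun_apply (g'' p)) (at p)" "continuous_on U g''"
    using g_twice_diff unfolding twice_continuously_differentiable_on_def by blast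
  interpret char_generating_function M Y U g g' g'' \<epsilon>
    by (rule char_generating_function.intro) (use prob rv U_open e box g_holomorphic g' g_series in \<open>simp_all add: \<epsilon>_def\<close>)
  have \<mu>: "\<mu> j = \<i> * a (axis j 1) 1" for j
    unfolding mu_eq d_x_g[OF zero_one_in_U] a_def ..
  \<comment> \<open>The factors \<open>\<i>\<close> in \<open>\<mu>\<close> combine with the
    explicit \<open>- \<i>\<close> to 1, and in \<open>\<mu> j * \<mu> k\<close> to -1, which are
    the signs in \<open>covariance_form\<close>.\<close>
  have \<sigma>: "\<sigma> j k = covariance_form (axis j 1) (axis k 1)" for j k
    unfolding sigma_eq \<mu> d_x_d_x_g d_x_d_z_g covariance_form_def by (simp add: algebra_simps)
  have "complex_of_real (m $ j) = \<mu> j" for j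
    unfolding \<mu> m_def vec_lambda_beta by (rule mean_limit)
  moreover have "complex_of_real (S $ j $ k) = \<sigma> j k" for j k
    unfolding \<sigma> S_def vec_lambda_beta by (rule covariance_form_real)
  ultimately show ?thesis
    using integrable_Y integrable_norm_square S_positive_semidefinite mean_vec_limit covariance_limit central_limit
    by blast
qed

end
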